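(* Let $k$ be a commutative ring, let $\mathcal{H}=(\mathcal{H}_L,\mathcal{H}_R,S)$ be a Hopf algebroid over base $k$-algebras $L$ and $R$, where $S$ is assumed to be bijective, and let $A$ be a left $\mathcal{H}$-module algebra. Then ${}_{\mathcal{H}}M^A$, the category of all finitely generated left $\mathcal{H}$-equivariant right $A$-modules whose morphisms are the morphisms of right $A$-modules, is an $\mathcal{H}$-category.
   Context: **Bialgebroids.** A left bialgebroid $\mathcal{H}_L=(H,L,s_L,t_L,\Delta_L,\varepsilon_L)$ consists of $k$-algebras $H$ (total) and $L$ (base), algebra maps $s_L:L\to H$, $t_L:L^{op}\to H$ with commuting images, making $H$ an $L$-$L$-bimodule by $l\cdot h\cdot l'=s_L(l)t_L(l')h$, and an $L$-coring $(H,\Delta_L,\varepsilon_L)$, $\Delta_L(h)=h_{(1)}\otimes_L h_{(2)}$, with $h_{(1)}t_L(l)\otimes_L h_{(2)}=h_{(1)}\otimes_L h_{(2)}s_L(l)$, $\Delta_L(1)=1\otimes_L1$, $\Delta_L(hg)=\Delta_L(h)\Delta_L(g)$, $\varepsilon_L(1)=1$, $\varepsilon_L(hs_L\varepsilon_L(g))=\varepsilon_L(hg)=\varepsilon_L(ht_L\varepsilon_L(g))$. A right bialgebroid $\mathcal{H}_R=(H,R,s_R,t_R,\Delta_R,\varepsilon_R)$ consists of $k$-algebras $H$, $R$, algebra maps $s_R:R\to H$, $t_R:R^{op}\to H$ with commuting images, making $H$ an $R$-$R$-bimodule by $r\cdot h\cdot r'=h\,s_R(r')t_R(r)$, and an $R$-coring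 $(H,\Delta_R,\varepsilon_R)$, $\Delta_R(h)=h^{(1)}\otimes_R h^{(2)}$, with $s_R(r)h^{(1)}\otimes_R h^{(2)}=h^{(1)}\otimes_R t_R(r)h^{(2)}$, $\Delta_R(1)=1\otimes_R1$, $\Delta_R(hg)=\Delta_R(h)\Delta_R(g)$, $\varepsilon_R(1)=1$, $\varepsilon_R(s_R\varepsilon_R(h)g)=\varepsilon_R(hg)=\varepsilon_R(t_R\varepsilon_R(h)g)$. **Hopf algebroid.** $\mathcal{H}=(\mathcal{H}_L,\mathcal{H}_R,S)$: a left and a right bialgebroid on the same total algebra $H$ and a $k$-linear map $S:H\to H$ (antipode) with $s_L\varepsilon_Lt_R=t_R$, $t_L\varepsilon_Ls_R=s_R$, $s_R\varepsilon_Rt_L=t_L$, $t_R\varepsilon_Rs_L=s_L$; $(\Delta_L\otimes_R id)\Delta_R=(id\otimes_L\Delta_R)\Delta_L$, $(\Delta_R\otimes_L id)\Delta_L=(id\otimes_R\Delta_L)\Delta_R$; $S(t_L(l)ht_R(r))=s_R(r)S(h)s_L(l)$; $S(h_{(1)})h_{(2)}=s_R\varepsilon_R(h)$, $h^{(1)}S(h^{(2)})=s_L\varepsilon_L(h)$. A left $\mathcal{H}$-module is a left $\mathcal{H}_L$-module, i.e. a left $H$-module; it is an $L$-$L$-bimodule by $l\cdot m\cdot l'=s_L(l)t_L(l')m$. **Module algebras and equivariant modules.** A left $\mathcal{H}$-module algebra is a $k$-algebra $A$ that is a left $\mathcal{H}$-module with $h(ab)=(h_{(1)}a)(h_{(2)}b)$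 and $h1_A=s_L\varepsilon_L(h)1_A=t_L\varepsilon_L(h)1_A$. A left $\mathcal{H}$-equivariant right $A$-module $X$ is a left $\mathcal{H}$-module and right $A$-module with $h(xa)=(h_{(1)}x)(h_{(2)}a)$. **$\mathcal{H}$-categories.** A small $k$-linear category $\mathcal{C}$ is an $\mathcal{H}$-category if (i) each $\mathrm{Hom}_{\mathcal{C}}(X,Y)$ is a left $\mathcal{H}$-module inheriting the $L$-$L$-bimodule structure $l\cdot f\cdot l'=s_L(l)t_L(l')f$, and $l\cdot id_X=id_X\cdot l$; (ii) $h(id_X)=s_L\varepsilon_L(h)id_X=t_L\varepsilon_L(h)id_X$ for all objects $X$ and all $h$; (iii) $h(fg)=(h_{(1)}f)(h_{(2)}g)$ for all $h$ and composable $g:X\to Y$, $f:Y\to Z$. The action on $\mathrm{Hom}_A(X,Y)$ intended here is $h(f)(x)=h_{(1)}f(S(h_{(2)})x)$.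
   Formalization: The action on Hom_A(X,Y) is h(f)(x)=h^(1)f(S(h^(2))x), using the right coproduct Δ_R instead of the printed Δ_L indices; with Δ_L the formula is not well defined over L in general and can violate h(id)=s_Lε_L(h)id, e.g. for a group algebra twisted by a character. *)

theory Defs
  imports "HOL-Algebra.Module" "HOL-Algebra.Generated_Groups" "HOL-Algebra.Free_Abelian_Groups"
begin

section \<open>Algebras and modules over a commutative ring\<close>

text \<open>The locale \<open>algebra\<close> of \<open>HOL-Algebra\<close> is restricted to commutative algebras.\<close>

locale kalgebra = Module.module K A + ring A
  for K :: "('k, 'x) ring_scheme" and A :: "('k, 'a, 'y) module_scheme" +
  assumes smult_mult_left:
      "\<lbrakk>c \<in> carrier K; x \<in> carrier A; y \<in> carrier A\<rbrakk>
        \<Longrightarrow> (c \<odot>\<^bsub>A\<^esub> x) \<otimes>\<^bsub>A\<^esub> y = c \<odot>\<^bsub>A\<^esub> (x \<otimes>\<^bsub>A\<^esub> y)"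
    and smult_mult_right:
      "\<lbrakk>c \<in> carrier K; x \<in> carrier A; y \<in> carrier A\<rbrakk>
        \<Longrightarrow> x \<otimes>\<^bsub>A\<^esub> (c \<odot>\<^bsub>A\<^esub> y) = c \<odot>\<^bsub>A\<^esub> (x \<otimes>\<^bsub>A\<^esub> y)"

definition opp :: "('k, 'a) module \<Rightarrow> ('k, 'a) module" where
  "opp A = A\<lparr>mult := (\<lambda>x y. y \<otimes>\<^bsub>A\<^esub> x)\<rparr>"

definition kalgebra_hom ::
    "('k, 'x) ring_scheme \<Rightarrow> ('k, 'a) module \<Rightarrow> ('k, 'b) module \<Rightarrow> ('a \<Rightarrow> 'b) set" where
  "kalgebra_hom K A B =
     {f \<in> ring_hom A B. \<forall>c\<in>carrier K. \<forall>x\<in>carrier A. f (c \<odot>\<^bsub>A\<^esub> x) = c \<odot>\<^bsub>B\<^esub> f x}"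

locale left_module = kalgebra K H + M: Module.module K M
  for K :: "('k, 'x) ring_scheme" and H :: "('k, 'h) module" and M :: "('k, 'm, 'y) module_scheme"
    and act :: "'h \<Rightarrow> 'm \<Rightarrow> 'm" +
  assumes act_closed: "\<lbrakk>h \<in> carrier H; m \<in> carrier M\<rbrakk> \<Longrightarrow> act h m \<in> carrier M"
    and act_add_left: "\<lbrakk>h \<in> carrier H; g \<in> carrier H; m \<in> carrier M\<rbrakk>
          \<Longrightarrow> act (h \<oplus>\<^bsub>H\<^esub> g) m = act h m \<oplus>\<^bsub>M\<^esub> act g m"
    and act_add_right: "\<lbrakk>h \<in> carrier H; m \<in> carrier M; n \<in> carrier M\<rbrakk>
          \<Longrightarrow> act h (m \<oplus>\<^bsub>M\<^esub> n) = act h m \<oplus>\<^bsub>M\<^esub> act h n"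
    and act_smult_left: "\<lbrakk>c \<in> carrier K; h \<in> carrier H; m \<in> carrier M\<rbrakk>
          \<Longrightarrow> act (c \<odot>\<^bsub>H\<^esub> h) m = c \<odot>\<^bsub>M\<^esub> act h m"
    and act_smult_right: "\<lbrakk>c \<in> carrier K; h \<in> carrier H; m \<in> carrier M\<rbrakk>
          \<Longrightarrow> act h (c \<odot>\<^bsub>M\<^esub> m) = c \<odot>\<^bsub>M\<^esub> act h m"
    and act_mult: "\<lbrakk>h \<in> carrier H; g \<in> carrier H; m \<in> carrier M\<rbrakk>
          \<Longrightarrow> act (h \<otimes>\<^bsub>H\<^esub> g) m = act h (act g m)"
    and act_one: "m \<in> carrier M \<Longrightarrow> act \<one>\<^bsub>H\<^esub> m = m"

definition right_module ::
    "('k, 'x) ring_scheme \<Rightarrow> ('k, 'a) module \<Rightarrow> ('k, 'm, 'y) module_scheme \<Rightarrow> ('m \<Rightarrow> 'a \<Rightarrow> 'm) \<Rightarrow> bool"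
  where "right_module K A M ract \<longleftrightarrow> kalgebra K A \<and> left_module K (opp A) M (\<lambda>a m. ract m a)"

definition finitely_generated_right ::
    "('k, 'a) module \<Rightarrow> ('k, 'm, 'y) module_scheme \<Rightarrow> ('m \<Rightarrow> 'a \<Rightarrow> 'm) \<Rightarrow> bool" where
  "finitely_generated_right A M ract \<longleftrightarrow>
     (\<exists>F. finite F \<and> F \<subseteq> carrier M \<and>
        (\<forall>m\<in>carrier M. \<exists>\<alpha>\<in>F \<rightarrow> carrier A. m = (\<Oplus>\<^bsub>M\<^esub>y\<in>F. ract y (\<alpha> y))))"

locale bimodule = B: ring B + M: abelian_group M
  for B :: "('b, 'x) ring_scheme" and M :: "('m, 'y) ring_scheme"
    and l :: "'b \<Rightarrow> 'm \<Rightarrow> 'm" and r :: "'m \<Rightarrow> 'b \<Rightarrow> 'm" +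
  assumes l_closed: "\<lbrakk>b \<in> carrier B; m \<in> carrier M\<rbrakk> \<Longrightarrow> l b m \<in> carrier M"
    and l_add_left: "\<lbrakk>b \<in> carrier B; b' \<in> carrier B; m \<in> carrier M\<rbrakk>
          \<Longrightarrow> l (b \<oplus>\<^bsub>B\<^esub> b') m = l b m \<oplus>\<^bsub>M\<^esub> l b' m"
    and l_add_right: "\<lbrakk>b \<in> carrier B; m \<in> carrier M; m' \<in> carrier M\<rbrakk>
          \<Longrightarrow> l b (m \<oplus>\<^bsub>M\<^esub> m') = l b m \<oplus>\<^bsub>M\<^esub> l b m'"
    and l_mult: "\<lbrakk>b \<in> carrier B; b' \<in> carrier B; m \<in> carrier M\<rbrakk>
          \<Longrightarrow> l (b \<otimes>\<^bsub>B\<^esub> b') m = l b (l b' m)"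
    and l_one: "m \<in> carrier M \<Longrightarrow> l \<one>\<^bsub>B\<^esub> m = m"
    and r_closed: "\<lbrakk>b \<in> carrier B; m \<in> carrier M\<rbrakk> \<Longrightarrow> r m b \<in> carrier M"
    and r_add_left: "\<lbrakk>b \<in> carrier B; m \<in> carrier M; m' \<in> carrier M\<rbrakk>
          \<Longrightarrow> r (m \<oplus>\<^bsub>M\<^esub> m') b = r m b \<oplus>\<^bsub>M\<^esub> r m' b"
    and r_add_right: "\<lbrakk>b \<in> carrier B; b' \<in> carrier B; m \<in> carrier M\<rbrakk>
          \<Longrightarrow> r m (b \<oplus>\<^bsub>B\<^esub> b') = r m b \<oplus>\<^bsub>M\<^esub> r m b'"
    and r_mult: "\<lbrakk>b \<in> carrier B; b' \<in> carrier B; m \<in> carrier M\<rbrakk>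
          \<Longrightarrow> r m (b \<otimes>\<^bsub>B\<^esub> b') = r (r m b) b'"
    and r_one: "m \<in> carrier M \<Longrightarrow> r m \<one>\<^bsub>B\<^esub> = m"
    and l_r_commute: "\<lbrakk>b \<in> carrier B; b' \<in> carrier B; m \<in> carrier M\<rbrakk>
          \<Longrightarrow> r (l b m) b' = l b (r m b')"


section \<open>Tensor products over noncommutative rings\<close>

text \<open>Tensor products are built as quotients of free abelian groups. An element of a tensor
  product is thus a coset, whose members are the formal sums representing it.\<close>

definition presented_group :: "'a set \<Rightarrow> ('a \<Rightarrow>\<^sub>0 int) set \<Rightarrow> ('a \<Rightarrow>\<^sub>0 int) set monoid" where
  "presented_group X E = free_Abelian_group X Mod generate (free_Abelian_group X) E"

definition presented_class :: "'a set \<Rightarrow> ('a \<Rightarrow>\<^sub>0 int) set \<Rightarrow> ('a \<Rightarrow>\<^sub>0 int) \<Rightarrow> ('a \<Rightarrow>\<^sub>0 int) set" where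
  "presented_class X E u = generate (free_Abelian_group X) E #>\<^bsub>free_Abelian_group X\<^esub> u"

text \<open>\<open>M \<otimes>\<^sub>B N\<close>, for a right action \<open>r\<close> of \<open>B\<close> on \<open>M\<close> and a left action \<open>l\<close> of \<open>B\<close> on \<open>N\<close>.\<close>

definition tensor_relators ::
    "('m, 'x) ring_scheme \<Rightarrow> ('n, 'y) ring_scheme \<Rightarrow> ('b, 'z) ring_scheme \<Rightarrow>
     ('m \<Rightarrow> 'b \<Rightarrow> 'm) \<Rightarrow> ('b \<Rightarrow> 'n \<Rightarrow> 'n) \<Rightarrow> ('m \<times> 'n \<Rightarrow>\<^sub>0 int) set" where
  "tensor_relators M N B r l =
     {frag_of (m \<oplus>\<^bsub>M\<^esub> m', n) - frag_of (m, n) - frag_of (m', n) | m m' n.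
        m \<in> carrier M \<and> m' \<in> carrier M \<and> n \<in> carrier N}
   \<union> {frag_of (m, n \<oplus>\<^bsub>N\<^esub> n') - frag_of (m, n) - frag_of (m, n') | m n n'.
        m \<in> carrier M \<and> n \<in> carrier N \<and> n' \<in> carrier N}
   \<union> {frag_of (r m b, n) - frag_of (m, l b n) | m b n.
        m \<in> carrier M \<and> b \<in> carrier B \<and> n \<in> carrier N}"

definition tensor ::
    "('m, 'x) ring_scheme \<Rightarrow> ('n, 'y) ring_scheme \<Rightarrow> ('b, 'z) ring_scheme \<Rightarrow>
     ('m \<Rightarrow> 'b \<Rightarrow> 'm) \<Rightarrow> ('b \<Rightarrow> 'n \<Rightarrow> 'n) \<Rightarrow> ('m \<times> 'n \<Rightarrow>\<^sub>0 int) set monoid" where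
  "tensor M N B r l = presented_group (carrier M \<times> carrier N) (tensor_relators M N B r l)"

definition pure ::
    "('m, 'x) ring_scheme \<Rightarrow> ('n, 'y) ring_scheme \<Rightarrow> ('b, 'z) ring_scheme \<Rightarrow>
     ('m \<Rightarrow> 'b \<Rightarrow> 'm) \<Rightarrow> ('b \<Rightarrow> 'n \<Rightarrow> 'n) \<Rightarrow> 'm \<Rightarrow> 'n \<Rightarrow> ('m \<times> 'n \<Rightarrow>\<^sub>0 int) set" where
  "pure M N B r l m n =
     presented_class (carrier M \<times> carrier N) (tensor_relators M N B r l) (frag_of (m, n))"

text \<open>\<open>M \<otimes>\<^sub>B N \<otimes>\<^sub>C P\<close>, i.e. both \<open>(M \<otimes>\<^sub>B N) \<otimes>\<^sub>C P\<close> and \<open>M \<otimes>\<^sub>B (N \<otimes>\<^sub>C P)\<close>, for a \<open>B\<close>-\<open>C\<close>-bimodule \<open>N\<close>.\<close>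

definition tensor3_relators ::
    "('m, 'x) ring_scheme \<Rightarrow> ('n, 'y) ring_scheme \<Rightarrow> ('p, 'z) ring_scheme \<Rightarrow>
     ('b, 'v) ring_scheme \<Rightarrow> ('m \<Rightarrow> 'b \<Rightarrow> 'm) \<Rightarrow> ('b \<Rightarrow> 'n \<Rightarrow> 'n) \<Rightarrow>
     ('c, 'w) ring_scheme \<Rightarrow> ('n \<Rightarrow> 'c \<Rightarrow> 'n) \<Rightarrow> ('c \<Rightarrow> 'p \<Rightarrow> 'p) \<Rightarrow> ('m \<times> 'n \<times> 'p \<Rightarrow>\<^sub>0 int) set" where
  "tensor3_relators M N P B rB lB C rC lC =
     {frag_of (m \<oplus>\<^bsub>M\<^esub> m', n, p) - frag_of (m, n, p) - frag_of (m', n, p) | m m' n p.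
        m \<in> carrier M \<and> m' \<in> carrier M \<and> n \<in> carrier N \<and> p \<in> carrier P}
   \<union> {frag_of (m, n \<oplus>\<^bsub>N\<^esub> n', p) - frag_of (m, n, p) - frag_of (m, n', p) | m n n' p.
        m \<in> carrier M \<and> n \<in> carrier N \<and> n' \<in> carrier N \<and> p \<in> carrier P}
   \<union> {frag_of (m, n, p \<oplus>\<^bsub>P\<^esub> p') - frag_of (m, n, p) - frag_of (m, n, p') | m n p p'.
        m \<in> carrier M \<and> n \<in> carrier N \<and> p \<in> carrier P \<and> p' \<in> carrier P}
   \<union> {frag_of (rB m b, n, p) - frag_of (m, lB b n, p) | m b n p.
        m \<in> carrier M \<and> b \<in> carrier B \<and> n \<in> carrier N \<and> p \<in> carrier P}
   \<union> {frag_of (m, rC n c, p) - frag_of (m, n, lC c p) | m n c p.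
        m \<in> carrier M \<and> n \<in> carrier N \<and> c \<in> carrier C \<and> p \<in> carrier P}"

definition tensor3 ::
    "('m, 'x) ring_scheme \<Rightarrow> ('n, 'y) ring_scheme \<Rightarrow> ('p, 'z) ring_scheme \<Rightarrow>
     ('b, 'v) ring_scheme \<Rightarrow> ('m \<Rightarrow> 'b \<Rightarrow> 'm) \<Rightarrow> ('b \<Rightarrow> 'n \<Rightarrow> 'n) \<Rightarrow>
     ('c, 'w) ring_scheme \<Rightarrow> ('n \<Rightarrow> 'c \<Rightarrow> 'n) \<Rightarrow> ('c \<Rightarrow> 'p \<Rightarrow> 'p) \<Rightarrow>
     ('m \<times> 'n \<times> 'p \<Rightarrow>\<^sub>0 int) set monoid" where
  "tensor3 M N P B rB lB C rC lC =
     presented_group (carrier M \<times> carrier N \<times> carrier P) (tensor3_relators M N P B rB lB C rC lC)"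

definition pure3 ::
    "('m, 'x) ring_scheme \<Rightarrow> ('n, 'y) ring_scheme \<Rightarrow> ('p, 'z) ring_scheme \<Rightarrow>
     ('b, 'v) ring_scheme \<Rightarrow> ('m \<Rightarrow> 'b \<Rightarrow> 'm) \<Rightarrow> ('b \<Rightarrow> 'n \<Rightarrow> 'n) \<Rightarrow>
     ('c, 'w) ring_scheme \<Rightarrow> ('n \<Rightarrow> 'c \<Rightarrow> 'n) \<Rightarrow> ('c \<Rightarrow> 'p \<Rightarrow> 'p) \<Rightarrow>
     'm \<Rightarrow> 'n \<Rightarrow> 'p \<Rightarrow> ('m \<times> 'n \<times> 'p \<Rightarrow>\<^sub>0 int) set" where
  "pure3 M N P B rB lB C rC lC m n p =
     presented_class (carrier M \<times> carrier N \<times> carrier P)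
       (tensor3_relators M N P B rB lB C rC lC) (frag_of (m, n, p))"

text \<open>\<open>formal_eval G \<phi> u\<close> is \<open>\<Sum> n\<^sub>x \<phi>(x)\<close> for the formal sum \<open>u = \<Sum> n\<^sub>x x\<close>, computed in the abelian
  group \<open>G\<close>, which is written multiplicatively; for the additive group of a ring or module \<open>M\<close>
  one takes \<open>G = add_monoid M\<close>.

  \<open>tensor_evals_to G \<phi> z y\<close> is the Sweedler-style assertion \<open>\<Sum> \<phi>(z\<^sub>1, z\<^sub>2) = y\<close>. It includes that
  the left-hand side does not depend on the formal sum representing the tensor \<open>z\<close>.
  \<open>tensor_eval G \<phi> z\<close> is the value \<open>\<Sum> \<phi>(z\<^sub>1, z\<^sub>2)\<close> itself, and is meaningful only if
  there is no such dependence, as is the case when \<open>\<phi>\<close> is biadditive and balanced.\<close>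

definition formal_eval :: "('g, 'x) monoid_scheme \<Rightarrow> ('a \<Rightarrow> 'g) \<Rightarrow> ('a \<Rightarrow>\<^sub>0 int) \<Rightarrow> 'g" where
  "formal_eval G \<phi> u =
     finprod G (\<lambda>x. \<phi> x [^]\<^bsub>G\<^esub> Poly_Mapping.lookup u x) (Poly_Mapping.keys u)"

definition tensor_evals_to ::
    "('g, 'x) monoid_scheme \<Rightarrow> ('a \<Rightarrow> 'g) \<Rightarrow> ('a \<Rightarrow>\<^sub>0 int) set \<Rightarrow> 'g \<Rightarrow> bool" where
  "tensor_evals_to G \<phi> z y \<longleftrightarrow> (\<forall>u\<in>z. formal_eval G \<phi> u = y)"

definition tensor_eval :: "('g, 'x) monoid_scheme \<Rightarrow> ('a \<Rightarrow> 'g) \<Rightarrow> ('a \<Rightarrow>\<^sub>0 int) set \<Rightarrow> 'g" where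
  "tensor_eval G \<phi> z = (THE y. tensor_evals_to G \<phi> z y)"


section \<open>Corings\<close>

locale coring = bimodule B C l r
  for B :: "('b, 'x) ring_scheme" and C :: "('c, 'y) ring_scheme"
    and l :: "'b \<Rightarrow> 'c \<Rightarrow> 'c" and r :: "'c \<Rightarrow> 'b \<Rightarrow> 'c"
    and \<Delta> :: "'c \<Rightarrow> ('c \<times> 'c \<Rightarrow>\<^sub>0 int) set" and \<epsilon> :: "'c \<Rightarrow> 'b" +
  assumes comult_hom: "\<Delta> \<in> hom (add_monoid C) (tensor C C B r l)"
    and comult_left: "\<lbrakk>b \<in> carrier B; c \<in> carrier C\<rbrakk> \<Longrightarrow>
          tensor_evals_to (tensor C C B r l) (\<lambda>(x, y). pure C C B r l (l b x) y) (\<Delta> c) (\<Delta> (l b c))"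
    and comult_right: "\<lbrakk>b \<in> carrier B; c \<in> carrier C\<rbrakk> \<Longrightarrow>
          tensor_evals_to (tensor C C B r l) (\<lambda>(x, y). pure C C B r l x (r y b)) (\<Delta> c) (\<Delta> (r c b))"
    and counit_hom: "\<epsilon> \<in> hom (add_monoid C) (add_monoid B)"
    and counit_left: "\<lbrakk>b \<in> carrier B; c \<in> carrier C\<rbrakk> \<Longrightarrow> \<epsilon> (l b c) = b \<otimes>\<^bsub>B\<^esub> \<epsilon> c"
    and counit_right: "\<lbrakk>b \<in> carrier B; c \<in> carrier C\<rbrakk> \<Longrightarrow> \<epsilon> (r c b) = \<epsilon> c \<otimes>\<^bsub>B\<^esub> b"
    and coassociative: "c \<in> carrier C \<Longrightarrow>
          tensor_eval (tensor3 C C C B r l B r l)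
            (\<lambda>(x, y). tensor_eval (tensor3 C C C B r l B r l)
               (\<lambda>(x\<^sub>1, x\<^sub>2). pure3 C C C B r l B r l x\<^sub>1 x\<^sub>2 y) (\<Delta> x)) (\<Delta> c)
        = tensor_eval (tensor3 C C C B r l B r l)
            (\<lambda>(x, y). tensor_eval (tensor3 C C C B r l B r l)
               (\<lambda>(y\<^sub>1, y\<^sub>2). pure3 C C C B r l B r l x y\<^sub>1 y\<^sub>2) (\<Delta> y)) (\<Delta> c)"
    and counital_left: "c \<in> carrier C \<Longrightarrow>
          tensor_evals_to (add_monoid C) (\<lambda>(x, y). l (\<epsilon> x) y) (\<Delta> c) c"
    and counital_right: "c \<in> carrier C \<Longrightarrow>
          tensor_evals_to (add_monoid C) (\<lambda>(x, y). r x (\<epsilon> y)) (\<Delta> c) c"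


section \<open>Bialgebroids and Hopf algebroids\<close>

definition left_lact :: "('k, 'h) module \<Rightarrow> ('l \<Rightarrow> 'h) \<Rightarrow> 'l \<Rightarrow> 'h \<Rightarrow> 'h" where
  "left_lact H s a h = s a \<otimes>\<^bsub>H\<^esub> h"

definition left_ract :: "('k, 'h) module \<Rightarrow> ('l \<Rightarrow> 'h) \<Rightarrow> 'h \<Rightarrow> 'l \<Rightarrow> 'h" where
  "left_ract H t h a = t a \<otimes>\<^bsub>H\<^esub> h"

definition right_lact :: "('k, 'h) module \<Rightarrow> ('r \<Rightarrow> 'h) \<Rightarrow> 'r \<Rightarrow> 'h \<Rightarrow> 'h" where
  "right_lact H t a h = h \<otimes>\<^bsub>H\<^esub> t a"

definition right_ract :: "('k, 'h) module \<Rightarrow> ('r \<Rightarrow> 'h) \<Rightarrow> 'h \<Rightarrow> 'r \<Rightarrow> 'h" where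
  "right_ract H s h a = h \<otimes>\<^bsub>H\<^esub> s a"

abbreviation left_tensor where
  "left_tensor H L s t \<equiv> tensor H H L (left_ract H t) (left_lact H s)"

abbreviation left_pure where
  "left_pure H L s t \<equiv> pure H H L (left_ract H t) (left_lact H s)"

abbreviation right_tensor where
  "right_tensor H R s t \<equiv> tensor H H R (right_ract H s) (right_lact H t)"

abbreviation right_pure where
  "right_pure H R s t \<equiv> pure H H R (right_ract H s) (right_lact H t)"

locale left_bialgebroid = kalgebra K H + L: kalgebra K L +
    coring L H "left_lact H s" "left_ract H t" \<Delta> \<epsilon>
  for K :: "('k, 'x) ring_scheme" and H :: "('k, 'h) module" and L :: "('k, 'l) module"
    and s :: "'l \<Rightarrow> 'h" and t :: "'l \<Rightarrow> 'h"
    and \<Delta> :: "'h \<Rightarrow> ('h \<times> 'h \<Rightarrow>\<^sub>0 int) set" and \<epsilon> :: "'h \<Rightarrow> 'l" +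
  assumes source_hom: "s \<in> kalgebra_hom K L H"
    and target_hom: "t \<in> kalgebra_hom K (opp L) H"
    and source_target_commute: "\<lbrakk>a \<in> carrier L; b \<in> carrier L\<rbrakk> \<Longrightarrow> s a \<otimes>\<^bsub>H\<^esub> t b = t b \<otimes>\<^bsub>H\<^esub> s a"
    and takeuchi: "\<lbrakk>h \<in> carrier H; a \<in> carrier L\<rbrakk> \<Longrightarrow>
          tensor_eval (left_tensor H L s t) (\<lambda>(x, y). left_pure H L s t (x \<otimes>\<^bsub>H\<^esub> t a) y) (\<Delta> h)
        = tensor_eval (left_tensor H L s t) (\<lambda>(x, y). left_pure H L s t x (y \<otimes>\<^bsub>H\<^esub> s a)) (\<Delta> h)"
    and comult_one: "\<Delta> \<one>\<^bsub>H\<^esub> = left_pure H L s t \<one>\<^bsub>H\<^esub> \<one>\<^bsub>H\<^esub>"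
    and comult_mult: "\<lbrakk>h \<in> carrier H; g \<in> carrier H; u \<in> \<Delta> h; v \<in> \<Delta> g\<rbrakk> \<Longrightarrow>
          \<Delta> (h \<otimes>\<^bsub>H\<^esub> g) =
            formal_eval (left_tensor H L s t)
              (\<lambda>(x, y). formal_eval (left_tensor H L s t)
                 (\<lambda>(x', y'). left_pure H L s t (x \<otimes>\<^bsub>H\<^esub> x') (y \<otimes>\<^bsub>H\<^esub> y')) v) u"
    and counit_one: "\<epsilon> \<one>\<^bsub>H\<^esub> = \<one>\<^bsub>L\<^esub>"
    and counit_source: "\<lbrakk>h \<in> carrier H; g \<in> carrier H\<rbrakk> \<Longrightarrow> \<epsilon> (h \<otimes>\<^bsub>H\<^esub> s (\<epsilon> g)) = \<epsilon> (h \<otimes>\<^bsub>H\<^esub> g)"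
    and counit_target: "\<lbrakk>h \<in> carrier H; g \<in> carrier H\<rbrakk> \<Longrightarrow> \<epsilon> (h \<otimes>\<^bsub>H\<^esub> t (\<epsilon> g)) = \<epsilon> (h \<otimes>\<^bsub>H\<^esub> g)"

text \<open>In \<open>comult_mult\<close>, componentwise multiplication is only defined on representatives: it does not
  descend to the whole tensor product over the base, but to the part of it singled out by
  \<open>takeuchi\<close>.\<close>

locale right_bialgebroid = kalgebra K H + R: kalgebra K R +
    coring R H "right_lact H t" "right_ract H s" \<Delta> \<epsilon>
  for K :: "('k, 'x) ring_scheme" and H :: "('k, 'h) module" and R :: "('k, 'r) module"
    and s :: "'r \<Rightarrow> 'h" and t :: "'r \<Rightarrow> 'h"
    and \<Delta> :: "'h \<Rightarrow> ('h \<times> 'h \<Rightarrow>\<^sub>0 int) set" and \<epsilon> :: "'h \<Rightarrow> 'r" +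
  assumes source_hom: "s \<in> kalgebra_hom K R H"
    and target_hom: "t \<in> kalgebra_hom K (opp R) H"
    and source_target_commute: "\<lbrakk>a \<in> carrier R; b \<in> carrier R\<rbrakk> \<Longrightarrow> s a \<otimes>\<^bsub>H\<^esub> t b = t b \<otimes>\<^bsub>H\<^esub> s a"
    and takeuchi: "\<lbrakk>h \<in> carrier H; a \<in> carrier R\<rbrakk> \<Longrightarrow>
          tensor_eval (right_tensor H R s t) (\<lambda>(x, y). right_pure H R s t (s a \<otimes>\<^bsub>H\<^esub> x) y) (\<Delta> h)
        = tensor_eval (right_tensor H R s t) (\<lambda>(x, y). right_pure H R s t x (t a \<otimes>\<^bsub>H\<^esub> y)) (\<Delta> h)"
    and comult_one: "\<Delta> \<one>\<^bsub>H\<^esub> = right_pure H R s t \<one>\<^bsub>H\<^esub> \<one>\<^bsub>H\<^esub>"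
    and comult_mult: "\<lbrakk>h \<in> carrier H; g \<in> carrier H; u \<in> \<Delta> h; v \<in> \<Delta> g\<rbrakk> \<Longrightarrow>
          \<Delta> (h \<otimes>\<^bsub>H\<^esub> g) =
            formal_eval (right_tensor H R s t)
              (\<lambda>(x, y). formal_eval (right_tensor H R s t)
                 (\<lambda>(x', y'). right_pure H R s t (x \<otimes>\<^bsub>H\<^esub> x') (y \<otimes>\<^bsub>H\<^esub> y')) v) u"
    and counit_one: "\<epsilon> \<one>\<^bsub>H\<^esub> = \<one>\<^bsub>R\<^esub>"
    and counit_source: "\<lbrakk>h \<in> carrier H; g \<in> carrier H\<rbrakk> \<Longrightarrow> \<epsilon> (s (\<epsilon> h) \<otimes>\<^bsub>H\<^esub> g) = \<epsilon> (h \<otimes>\<^bsub>H\<^esub> g)"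
    and counit_target: "\<lbrakk>h \<in> carrier H; g \<in> carrier H\<rbrakk> \<Longrightarrow> \<epsilon> (t (\<epsilon> h) \<otimes>\<^bsub>H\<^esub> g) = \<epsilon> (h \<otimes>\<^bsub>H\<^esub> g)"

text \<open>\<open>H \<otimes>\<^sub>L H \<otimes>\<^sub>R H\<close> and \<open>H \<otimes>\<^sub>R H \<otimes>\<^sub>L H\<close>, the targets of the mixed coassociativity laws.\<close>

abbreviation LR_tensor where
  "LR_tensor H L sL tL R sR tR \<equiv>
     tensor3 H H H L (left_ract H tL) (left_lact H sL) R (right_ract H sR) (right_lact H tR)"

abbreviation LR_pure where
  "LR_pure H L sL tL R sR tR \<equiv>
     pure3 H H H L (left_ract H tL) (left_lact H sL) R (right_ract H sR) (right_lact H tR)"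

abbreviation RL_tensor where
  "RL_tensor H L sL tL R sR tR \<equiv>
     tensor3 H H H R (right_ract H sR) (right_lact H tR) L (left_ract H tL) (left_lact H sL)"

abbreviation RL_pure where
  "RL_pure H L sL tL R sR tR \<equiv>
     pure3 H H H R (right_ract H sR) (right_lact H tR) L (left_ract H tL) (left_lact H sL)"

locale hopf_algebroid =
    left: left_bialgebroid K H L sL tL \<Delta>L \<epsilon>L + right: right_bialgebroid K H R sR tR \<Delta>R \<epsilon>R
  for K :: "('k, 'x) ring_scheme" and H :: "('k, 'h) module"
    and L :: "('k, 'l) module" and sL :: "'l \<Rightarrow> 'h" and tL :: "'l \<Rightarrow> 'h"
    and \<Delta>L :: "'h \<Rightarrow> ('h \<times> 'h \<Rightarrow>\<^sub>0 int) set" and \<epsilon>L :: "'h \<Rightarrow> 'l"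
    and R :: "('k, 'r) module" and sR :: "'r \<Rightarrow> 'h" and tR :: "'r \<Rightarrow> 'h"
    and \<Delta>R :: "'h \<Rightarrow> ('h \<times> 'h \<Rightarrow>\<^sub>0 int) set" and \<epsilon>R :: "'h \<Rightarrow> 'r"
    and S :: "'h \<Rightarrow> 'h" +
  assumes sL_\<epsilon>L_tR: "r \<in> carrier R \<Longrightarrow> sL (\<epsilon>L (tR r)) = tR r"
    and tL_\<epsilon>L_sR: "r \<in> carrier R \<Longrightarrow> tL (\<epsilon>L (sR r)) = sR r"
    and sR_\<epsilon>R_tL: "l \<in> carrier L \<Longrightarrow> sR (\<epsilon>R (tL l)) = tL l"
    and tR_\<epsilon>R_sL: "l \<in> carrier L \<Longrightarrow> tR (\<epsilon>R (sL l)) = sL l"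
    and mixed_coassociative_LR: "h \<in> carrier H \<Longrightarrow>
          tensor_eval (LR_tensor H L sL tL R sR tR)
            (\<lambda>(x, y). tensor_eval (LR_tensor H L sL tL R sR tR)
               (\<lambda>(x\<^sub>1, x\<^sub>2). LR_pure H L sL tL R sR tR x\<^sub>1 x\<^sub>2 y) (\<Delta>L x)) (\<Delta>R h)
        = tensor_eval (LR_tensor H L sL tL R sR tR)
            (\<lambda>(x, y). tensor_eval (LR_tensor H L sL tL R sR tR)
               (\<lambda>(y\<^sub>1, y\<^sub>2). LR_pure H L sL tL R sR tR x y\<^sub>1 y\<^sub>2) (\<Delta>R y)) (\<Delta>L h)"
    and mixed_coassociative_RL: "h \<in> carrier H \<Longrightarrow>
          tensor_eval (RL_tensor H L sL tL R sR tR)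
            (\<lambda>(x, y). tensor_eval (RL_tensor H L sL tL R sR tR)
               (\<lambda>(x\<^sub>1, x\<^sub>2). RL_pure H L sL tL R sR tR x\<^sub>1 x\<^sub>2 y) (\<Delta>R x)) (\<Delta>L h)
        = tensor_eval (RL_tensor H L sL tL R sR tR)
            (\<lambda>(x, y). tensor_eval (RL_tensor H L sL tL R sR tR)
               (\<lambda>(y\<^sub>1, y\<^sub>2). RL_pure H L sL tL R sR tR x y\<^sub>1 y\<^sub>2) (\<Delta>L y)) (\<Delta>R h)"
    and antipode_hom: "S \<in> hom (add_monoid H) (add_monoid H)"
    and antipode_smult: "\<lbrakk>c \<in> carrier K; h \<in> carrier H\<rbrakk> \<Longrightarrow> S (c \<odot>\<^bsub>H\<^esub> h) = c \<odot>\<^bsub>H\<^esub> S h"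
    and antipode_base: "\<lbrakk>l \<in> carrier L; r \<in> carrier R; h \<in> carrier H\<rbrakk> \<Longrightarrow>
          S (tL l \<otimes>\<^bsub>H\<^esub> h \<otimes>\<^bsub>H\<^esub> tR r) = sR r \<otimes>\<^bsub>H\<^esub> S h \<otimes>\<^bsub>H\<^esub> sL l"
    and antipode_left: "h \<in> carrier H \<Longrightarrow>
          tensor_evals_to (add_monoid H) (\<lambda>(x, y). S x \<otimes>\<^bsub>H\<^esub> y) (\<Delta>L h) (sR (\<epsilon>R h))"
    and antipode_right: "h \<in> carrier H \<Longrightarrow>
          tensor_evals_to (add_monoid H) (\<lambda>(x, y). x \<otimes>\<^bsub>H\<^esub> S y) (\<Delta>R h) (sL (\<epsilon>L h))"


section \<open>Module algebras and equivariant modules\<close>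

locale module_algebra = kalgebra K A + left_module K H A act
  for K :: "('k, 'x) ring_scheme" and H :: "('k, 'h) module"
    and sL :: "'l \<Rightarrow> 'h" and tL :: "'l \<Rightarrow> 'h"
    and \<Delta>L :: "'h \<Rightarrow> ('h \<times> 'h \<Rightarrow>\<^sub>0 int) set" and \<epsilon>L :: "'h \<Rightarrow> 'l"
    and A :: "('k, 'a) module" and act :: "'h \<Rightarrow> 'a \<Rightarrow> 'a" +
  assumes act_product: "\<lbrakk>h \<in> carrier H; a \<in> carrier A; b \<in> carrier A\<rbrakk> \<Longrightarrow>
        tensor_evals_to (add_monoid A) (\<lambda>(x, y). act x a \<otimes>\<^bsub>A\<^esub> act y b) (\<Delta>L h) (act h (a \<otimes>\<^bsub>A\<^esub> b))"
    and act_unit_source: "h \<in> carrier H \<Longrightarrow> act h \<one>\<^bsub>A\<^esub> = act (sL (\<epsilon>L h)) \<one>\<^bsub>A\<^esub>"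
    and act_unit_target: "h \<in> carrier H \<Longrightarrow> act h \<one>\<^bsub>A\<^esub> = act (tL (\<epsilon>L h)) \<one>\<^bsub>A\<^esub>"

record ('k, 'm, 'h, 'a) eqmod = "('k, 'm) module" +
  hact :: "'h \<Rightarrow> 'm \<Rightarrow> 'm"
  ract :: "'m \<Rightarrow> 'a \<Rightarrow> 'm"

definition equivariant_module ::
    "('k, 'x) ring_scheme \<Rightarrow> ('k, 'h) module \<Rightarrow> ('h \<Rightarrow> ('h \<times> 'h \<Rightarrow>\<^sub>0 int) set) \<Rightarrow>
     ('k, 'a) module \<Rightarrow> ('h \<Rightarrow> 'a \<Rightarrow> 'a) \<Rightarrow> ('k, 'm, 'h, 'a) eqmod \<Rightarrow> bool" where
  "equivariant_module K H \<Delta>L A act X \<longleftrightarrow>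
     left_module K H X (hact X) \<and> right_module K A X (ract X) \<and>
     (\<forall>h\<in>carrier H. \<forall>x\<in>carrier X. \<forall>a\<in>carrier A.
        tensor_evals_to (add_monoid X) (\<lambda>(h\<^sub>1, h\<^sub>2). ract X (hact X h\<^sub>1 x) (act h\<^sub>2 a)) (\<Delta>L h)
          (hact X h (ract X x a)))"


section \<open>Linear categories with an action of a bialgebroid\<close>

text \<open>\<open>Comp C X Y Z f g\<close> is the composite \<open>f \<circ> g\<close> of \<open>g : X \<rightarrow> Y\<close> and \<open>f : Y \<rightarrow> Z\<close>.
  Of the module record \<open>Mor C X Y\<close>, the ring-only fields \<open>mult\<close> and \<open>one\<close> are irrelevant.\<close>

record ('k, 'o, 'f) lincat =
  Obj :: "'o set"
  Mor :: "'o \<Rightarrow> 'o \<Rightarrow> ('k, 'f) module"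
  Ident :: "'o \<Rightarrow> 'f"
  Comp :: "'o \<Rightarrow> 'o \<Rightarrow> 'o \<Rightarrow> 'f \<Rightarrow> 'f \<Rightarrow> 'f"

locale linear_category =
  fixes K :: "('k, 'x) ring_scheme" and C :: "('k, 'o, 'f) lincat"
  assumes Mor_module: "\<lbrakk>X \<in> Obj C; Y \<in> Obj C\<rbrakk> \<Longrightarrow> Module.module K (Mor C X Y)"
    and Ident_closed: "X \<in> Obj C \<Longrightarrow> Ident C X \<in> carrier (Mor C X X)"
    and Comp_closed: "\<lbrakk>X \<in> Obj C; Y \<in> Obj C; Z \<in> Obj C; f \<in> carrier (Mor C Y Z);
          g \<in> carrier (Mor C X Y)\<rbrakk> \<Longrightarrow> Comp C X Y Z f g \<in> carrier (Mor C X Z)"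
    and Comp_assoc: "\<lbrakk>W \<in> Obj C; X \<in> Obj C; Y \<in> Obj C; Z \<in> Obj C; f \<in> carrier (Mor C Y Z);
          g \<in> carrier (Mor C X Y); h \<in> carrier (Mor C W X)\<rbrakk> \<Longrightarrow>
          Comp C W X Z (Comp C X Y Z f g) h = Comp C W Y Z f (Comp C W X Y g h)"
    and Comp_Ident_left: "\<lbrakk>X \<in> Obj C; Y \<in> Obj C; f \<in> carrier (Mor C X Y)\<rbrakk> \<Longrightarrow>
          Comp C X Y Y (Ident C Y) f = f"
    and Comp_Ident_right: "\<lbrakk>X \<in> Obj C; Y \<in> Obj C; f \<in> carrier (Mor C X Y)\<rbrakk> \<Longrightarrow>
          Comp C X X Y f (Ident C X) = f"
    and Comp_add_left: "\<lbrakk>X \<in> Obj C; Y \<in> Obj C; Z \<in> Obj C; f \<in> carrier (Mor C Y Z);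
          f' \<in> carrier (Mor C Y Z); g \<in> carrier (Mor C X Y)\<rbrakk> \<Longrightarrow>
          Comp C X Y Z (f \<oplus>\<^bsub>Mor C Y Z\<^esub> f') g = Comp C X Y Z f g \<oplus>\<^bsub>Mor C X Z\<^esub> Comp C X Y Z f' g"
    and Comp_add_right: "\<lbrakk>X \<in> Obj C; Y \<in> Obj C; Z \<in> Obj C; f \<in> carrier (Mor C Y Z);
          g \<in> carrier (Mor C X Y); g' \<in> carrier (Mor C X Y)\<rbrakk> \<Longrightarrow>
          Comp C X Y Z f (g \<oplus>\<^bsub>Mor C X Y\<^esub> g') = Comp C X Y Z f g \<oplus>\<^bsub>Mor C X Z\<^esub> Comp C X Y Z f g'"
    and Comp_smult_left: "\<lbrakk>X \<in> Obj C; Y \<in> Obj C; Z \<in> Obj C; c \<in> carrier K;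
          f \<in> carrier (Mor C Y Z); g \<in> carrier (Mor C X Y)\<rbrakk> \<Longrightarrow>
          Comp C X Y Z (c \<odot>\<^bsub>Mor C Y Z\<^esub> f) g = c \<odot>\<^bsub>Mor C X Z\<^esub> Comp C X Y Z f g"
    and Comp_smult_right: "\<lbrakk>X \<in> Obj C; Y \<in> Obj C; Z \<in> Obj C; c \<in> carrier K;
          f \<in> carrier (Mor C Y Z); g \<in> carrier (Mor C X Y)\<rbrakk> \<Longrightarrow>
          Comp C X Y Z f (c \<odot>\<^bsub>Mor C X Y\<^esub> g) = c \<odot>\<^bsub>Mor C X Z\<^esub> Comp C X Y Z f g"

text \<open>\<open>act X Y h f\<close> is the action of \<open>h\<close> on \<open>f : X \<rightarrow> Y\<close>. The inherited bimodule structure is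
  \<open>l \<cdot> f = s\<^sub>L(l) f\<close>, \<open>f \<cdot> l = t\<^sub>L(l) f\<close>.\<close>

locale H_category = linear_category K C
  for K :: "('k, 'x) ring_scheme" and H :: "('k, 'h) module" and L :: "('k, 'l) module"
    and sL :: "'l \<Rightarrow> 'h" and tL :: "'l \<Rightarrow> 'h"
    and \<Delta>L :: "'h \<Rightarrow> ('h \<times> 'h \<Rightarrow>\<^sub>0 int) set" and \<epsilon>L :: "'h \<Rightarrow> 'l"
    and C :: "('k, 'o, 'f) lincat" and act :: "'o \<Rightarrow> 'o \<Rightarrow> 'h \<Rightarrow> 'f \<Rightarrow> 'f" +
  assumes Mor_left_module: "\<lbrakk>X \<in> Obj C; Y \<in> Obj C\<rbrakk> \<Longrightarrow> left_module K H (Mor C X Y) (act X Y)"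
    and Mor_bimodule: "\<lbrakk>X \<in> Obj C; Y \<in> Obj C\<rbrakk> \<Longrightarrow>
          bimodule L (Mor C X Y) (\<lambda>l f. act X Y (sL l) f) (\<lambda>f l. act X Y (tL l) f)"
    and Ident_central: "\<lbrakk>X \<in> Obj C; l \<in> carrier L\<rbrakk> \<Longrightarrow>
          act X X (sL l) (Ident C X) = act X X (tL l) (Ident C X)"
    and act_Ident_source: "\<lbrakk>X \<in> Obj C; h \<in> carrier H\<rbrakk> \<Longrightarrow>
          act X X h (Ident C X) = act X X (sL (\<epsilon>L h)) (Ident C X)"
    and act_Ident_target: "\<lbrakk>X \<in> Obj C; h \<in> carrier H\<rbrakk> \<Longrightarrow>
          act X X h (Ident C X) = act X X (tL (\<epsilon>L h)) (Ident C X)"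
    and act_Comp: "\<lbrakk>X \<in> Obj C; Y \<in> Obj C; Z \<in> Obj C; h \<in> carrier H; f \<in> carrier (Mor C Y Z);
          g \<in> carrier (Mor C X Y)\<rbrakk> \<Longrightarrow>
          tensor_evals_to (add_monoid (Mor C X Z))
            (\<lambda>(h\<^sub>1, h\<^sub>2). Comp C X Y Z (act Y Z h\<^sub>1 f) (act X Y h\<^sub>2 g)) (\<Delta>L h)
            (act X Z h (Comp C X Y Z f g))"


section \<open>The category of finitely generated equivariant modules\<close>

text \<open>Morphisms are functions on the carrier, extended by \<open>undefined\<close> outside of it.
  They are then automatically \<open>k\<close>-linear.\<close>

definition module_hom_set ::
    "('k, 'a) module \<Rightarrow> ('k, 'm, 'h, 'a) eqmod \<Rightarrow> ('k, 'm, 'h, 'a) eqmod \<Rightarrow> ('m \<Rightarrow> 'm) set" where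
  "module_hom_set A X Y =
     {f \<in> carrier X \<rightarrow>\<^sub>E carrier Y.
        (\<forall>x\<in>carrier X. \<forall>x'\<in>carrier X. f (x \<oplus>\<^bsub>X\<^esub> x') = f x \<oplus>\<^bsub>Y\<^esub> f x') \<and>
        (\<forall>x\<in>carrier X. \<forall>a\<in>carrier A. f (ract X x a) = ract Y (f x) a)}"

definition module_hom ::
    "('k, 'a) module \<Rightarrow> ('k, 'm, 'h, 'a) eqmod \<Rightarrow> ('k, 'm, 'h, 'a) eqmod \<Rightarrow> ('k, 'm \<Rightarrow> 'm) module" where
  "module_hom A X Y =
     \<lparr>carrier = module_hom_set A X Y, mult = undefined, one = undefined,
      ring.zero = (\<lambda>x\<in>carrier X. \<zero>\<^bsub>Y\<^esub>), ring.add = (\<lambda>f g. \<lambda>x\<in>carrier X. f x \<oplus>\<^bsub>Y\<^esub> g x),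
      smult = (\<lambda>c f. \<lambda>x\<in>carrier X. c \<odot>\<^bsub>Y\<^esub> f x)\<rparr>"

definition fg_equivariant_modules ::
    "('k, 'x) ring_scheme \<Rightarrow> ('k, 'h) module \<Rightarrow> ('h \<Rightarrow> ('h \<times> 'h \<Rightarrow>\<^sub>0 int) set) \<Rightarrow>
     ('k, 'a) module \<Rightarrow> ('h \<Rightarrow> 'a \<Rightarrow> 'a) \<Rightarrow> ('k, ('k, 'm, 'h, 'a) eqmod, 'm \<Rightarrow> 'm) lincat" where
  "fg_equivariant_modules K H \<Delta>L A act =
     \<lparr>Obj = {X. equivariant_module K H \<Delta>L A act X \<and> finitely_generated_right A X (ract X)},
      Mor = module_hom A,
      Ident = (\<lambda>X. \<lambda>x\<in>carrier X. x),
      Comp = (\<lambda>X Y Z f g. compose (carrier X) f g)\<rparr>"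

text \<open>\<open>(h f)(x) = h\<^sup>(\<^sup>1\<^sup>) f(S(h\<^sup>(\<^sup>2\<^sup>)) x)\<close>, where the Sweedler indices are those of the right coproduct
  \<open>\<Delta>\<^sub>R\<close>. The expression is balanced over \<open>R\<close>, but in general not over \<open>L\<close>, so that the left coproduct
  cannot be used. Even when \<open>L = R = k\<close> the left coproduct would give the wrong formula: a group
  algebra \<open>k[G]\<close> with \<open>\<Delta>\<^sub>L(g) = g \<otimes> g\<close>, \<open>\<epsilon>\<^sub>L(g) = 1\<close> and a character \<open>\<sigma>\<close> is a Hopf algebroid with
  \<open>S(g) = \<sigma>(g) g\<^sup>-\<^sup>1\<close>, \<open>\<Delta>\<^sub>R(g) = \<sigma>(g)\<^sup>-\<^sup>1 g \<otimes> g\<close>, \<open>\<epsilon>\<^sub>R(g) = \<sigma>(g)\<close>, and \<open>g S(g) = \<sigma>(g)\<close> differs from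
  \<open>\<epsilon>\<^sub>L(g)\<close>, contradicting \<open>act_Ident_source\<close>.\<close>

definition hom_action_summand ::
    "('h \<Rightarrow> 'h) \<Rightarrow> ('k, 'm, 'h, 'a) eqmod \<Rightarrow> ('k, 'm, 'h, 'a) eqmod \<Rightarrow> ('m \<Rightarrow> 'm) \<Rightarrow> 'm \<Rightarrow> 'h \<times> 'h \<Rightarrow> 'm"
  where "hom_action_summand S X Y f x = (\<lambda>(h\<^sub>1, h\<^sub>2). hact Y h\<^sub>1 (f (hact X (S h\<^sub>2) x)))"

definition hom_action ::
    "('h \<Rightarrow> ('h \<times> 'h \<Rightarrow>\<^sub>0 int) set) \<Rightarrow> ('h \<Rightarrow> 'h) \<Rightarrow> ('k, 'm, 'h, 'a) eqmod \<Rightarrow>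
     ('k, 'm, 'h, 'a) eqmod \<Rightarrow> 'h \<Rightarrow> ('m \<Rightarrow> 'm) \<Rightarrow> 'm \<Rightarrow> 'm" where
  "hom_action \<Delta>R S X Y h f =
     (\<lambda>x\<in>carrier X. tensor_eval (add_monoid Y) (hom_action_summand S X Y f x) (\<Delta>R h))"

end

theory Submission
  imports Defs
begin

text \<open>
  The map \<open>f \<mapsto> h\<^sup>1 f(S(h\<^sup>2) -)\<close>, with Sweedler indices of \<open>\<Delta>\<^sub>R\<close> written above and those of
  \<open>\<Delta>\<^sub>L\<close> below, is well defined because an \<open>A\<close>-linear map commutes with \<open>s\<^sub>R(r) = t\<^sub>L(l)\<close>, which acts as
  right multiplication by \<open>t\<^sub>L(l) 1 \<in> A\<close>. Everything else is a consequence of three identities, each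
  of which is proved by moving between \<open>\<Delta>\<^sub>L\<close> and \<open>\<Delta>\<^sub>R\<close> with the mixed coassociativity laws:
  the antipode reverses products; \<open>(h y) a = h\<^sup>1 (y (S(h\<^sup>2) a))\<close>; and
  \<open>(k\<^sub>1 f)(k\<^sub>2 y) = k (f y)\<close>. The last one gives \<open>h (f g) = (h\<^sub>1 f)(h\<^sub>2 g)\<close> at once, and together with
  the second one it gives the \<open>A\<close>-linearity of \<open>h f\<close>, by inserting \<open>h = t\<^sub>L(\<epsilon>\<^sub>L(h\<^sub>2)) h\<^sub>1\<close> into
  \<open>(h f)(x a)\<close>.
\<close>

section \<open>Evaluation of formal sums\<close>

text \<open>The two antipode laws pair \<open>S\<close> with different coproducts:
  \<open>S x \<cdot> y\<close> is summed over \<open>\<Delta>L\<close>, but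
  \<open>x \<cdot> S y\<close> over \<open>\<Delta>R\<close>. Cancelling an antipode that the other
  law has introduced therefore forces a change of coproduct. Such a change is legitimate only for
  integrands balanced over \<open>L\<close> in one pair of variables and over \<open>R\<close> in
  the other, so most computations begin with a balance check. The two bases meet because
  \<open>sR\<close> and \<open>tL\<close> have the same image in \<open>H\<close>, and so do
  \<open>tR\<close> and \<open>sL\<close>: elements of either base have known pure coproducts for
  both structures.

  The axioms control \<open>S\<close> only on some multiplications by base elements, so its
  antimultiplicativity must be derived before the action can satisfy \<open>act_mult\<close>. A
  further obstacle is that products of coproducts exist only on representatives. Sweedler sums are
  therefore evaluated at one chosen representative, where additive maps may be moved freely; balance
  is invoked where an identity between tensors is used.\<close>

context comm_group
begin

text \<open>Keys outside the support have exponent 0. The freedom matters in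
  \<open>formal_eval_hom\<close>, where cancellation can make the support of \<open>u + v\<close>
  smaller than the union of the two supports.\<close>

lemma formal_eval_superset:
  assumes "Poly_Mapping.keys u \<subseteq> F" "finite F" "\<phi> \<in> F \<rightarrow> carrier G"
  shows "formal_eval G \<phi> u = finprod G (\<lambda>x. \<phi> x [^] Poly_Mapping.lookup u x) F"
  unfolding formal_eval_def
  using assms by (intro finprod_mono_neutral_cong_left) (auto simp: in_keys_iff)

lemma formal_eval_closed:
  assumes "\<phi> \<in> Poly_Mapping.keys u \<rightarrow> carrier G"
  shows "formal_eval G \<phi> u \<in> carrier G"
  unfolding formal_eval_def using assms by (intro finprod_closed) auto

lemma formal_eval_cong:
  assumes "\<And>x. x \<in> Poly_Mapping.keys u \<Longrightarrow> \<phi> x = \<psi> x" "\<psi> \<in> Poly_Mapping.keys u \<rightarrow> carrier G"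
  shows "formal_eval G \<phi> u = formal_eval G \<psi> u"
  unfolding formal_eval_def using assms by (intro finprod_cong') auto

lemma formal_eval_frag_of:
  assumes "\<phi> x \<in> carrier G"
  shows "formal_eval G \<phi> (frag_of x) = \<phi> x"
  using assms by (simp add: formal_eval_def keys_frag_of)

lemma formal_eval_hom:
  assumes "\<phi> \<in> X \<rightarrow> carrier G"
  shows "formal_eval G \<phi> \<in> hom (free_Abelian_group X) G"
proof (rule homI)
  fix u v
  assume "u \<in> carrier (free_Abelian_group X)" "v \<in> carrier (free_Abelian_group X)"
  then have u: "Poly_Mapping.keys u \<subseteq> X" and v: "Poly_Mapping.keys v \<subseteq> X" by auto
  let ?F = "Poly_Mapping.keys u \<union> Poly_Mapping.keys v"
  have F: "finite ?F" "\<phi> \<in> ?F \<rightarrow> carrier G" using assms u v by auto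
  have "formal_eval G \<phi> (u + v) = finprod G (\<lambda>x. \<phi> x [^] Poly_Mapping.lookup (u + v) x) ?F"
    using F by (intro formal_eval_superset) (auto dest: subsetD [OF keys_add])
  also have "\<dots> = finprod G (\<lambda>x. \<phi> x [^] Poly_Mapping.lookup u x \<otimes> \<phi> x [^] Poly_Mapping.lookup v x) ?F"
    using F by (intro finprod_cong') (auto simp: lookup_add int_pow_mult dest: funcset_mem)
  also have "\<dots> = finprod G (\<lambda>x. \<phi> x [^] Poly_Mapping.lookup u x) ?F
      \<otimes> finprod G (\<lambda>x. \<phi> x [^] Poly_Mapping.lookup v x) ?F"
    using F by (intro finprod_multf) auto
  also have "\<dots> = formal_eval G \<phi> u \<otimes> formal_eval G \<phi> v"
    using F by (simp add: formal_eval_superset [of _ ?F])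
  finally show "formal_eval G \<phi> (u \<otimes>\<^bsub>free_Abelian_group X\<^esub> v) = formal_eval G \<phi> u \<otimes> formal_eval G \<phi> v"
    by simp
qed (use assms in \<open>auto intro!: formal_eval_closed\<close>)

lemma formal_eval_group_hom:
  assumes "\<phi> \<in> X \<rightarrow> carrier G"
  shows "group_hom (free_Abelian_group X) G (formal_eval G \<phi>)"
  using formal_eval_hom [OF assms] by (simp add: group_hom_def group_hom_axioms_def is_group)

lemma formal_eval_0: "formal_eval G \<phi> 0 = \<one>"
  by (simp add: formal_eval_def)

lemma formal_eval_diff:
  assumes "\<phi> \<in> Poly_Mapping.keys u \<union> Poly_Mapping.keys v \<rightarrow> carrier G"
  shows "formal_eval G \<phi> (u - v) = formal_eval G \<phi> u \<otimes> inv formal_eval G \<phi> v"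
proof -
  interpret e: group_hom "free_Abelian_group (Poly_Mapping.keys u \<union> Poly_Mapping.keys v)" G "formal_eval G \<phi>"
    by (rule formal_eval_group_hom [OF assms])
  show ?thesis
    using e.hom_mult [of u "- v"] e.hom_inv [of v] by simp
qed

lemma formal_eval_comp:
  assumes G': "comm_group G'" and f: "f \<in> hom G G'" and \<phi>: "\<phi> \<in> Poly_Mapping.keys u \<rightarrow> carrier G"
  shows "f (formal_eval G \<phi> u) = formal_eval G' (\<lambda>x. f (\<phi> x)) u"
proof -
  interpret G': comm_group G' by (rule G')
  interpret f: group_hom G G' f
    using f by (simp add: group_hom_def group_hom_axioms_def is_group G'.is_group)
  \<comment> \<open>The induction stays among formal sums supported in \<open>keys u\<close>,
    because \<open>\<phi>\<close> is known to take values in \<open>G\<close> only there.\<close>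
  have "Poly_Mapping.keys v \<subseteq> Poly_Mapping.keys u \<Longrightarrow>
      f (formal_eval G \<phi> v) = formal_eval G' (\<lambda>x. f (\<phi> x)) v" for v
  proof (induction rule: free_Abelian_group_induct [consumes 1, case_names zero diff gen])
    case zero
    show ?case by (simp add: formal_eval_0 G'.formal_eval_0)
  next
    case (diff v w)
    have "\<phi> \<in> Poly_Mapping.keys v \<union> Poly_Mapping.keys w \<rightarrow> carrier G"
      using diff \<phi> by auto
    moreover from this have "(\<lambda>x. f (\<phi> x)) \<in> Poly_Mapping.keys v \<union> Poly_Mapping.keys w \<rightarrow> carrier G'"
      by (auto dest: funcset_mem)
    ultimately show ?case
      using diff by (simp add: formal_eval_diff G'.formal_eval_diff formal_eval_closed)
  next
    case (gen a)
    then show ?case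
      using \<phi> by (simp add: formal_eval_frag_of G'.formal_eval_frag_of Pi_iff)
  qed
  then show ?thesis by blast
qed

lemma formal_eval_mult:
  assumes "\<phi> \<in> Poly_Mapping.keys u \<rightarrow> carrier G" "\<psi> \<in> Poly_Mapping.keys u \<rightarrow> carrier G"
  shows "formal_eval G (\<lambda>x. \<phi> x \<otimes> \<psi> x) u = formal_eval G \<phi> u \<otimes> formal_eval G \<psi> u"
proof -
  have "formal_eval G (\<lambda>x. \<phi> x \<otimes> \<psi> x) u
      = finprod G (\<lambda>x. \<phi> x [^] Poly_Mapping.lookup u x \<otimes> \<psi> x [^] Poly_Mapping.lookup u x) (Poly_Mapping.keys u)"
    unfolding formal_eval_def using assms by (intro finprod_cong') (auto simp: int_pow_distrib Pi_iff)
  also have "\<dots> = formal_eval G \<phi> u \<otimes> formal_eval G \<psi> u"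
    unfolding formal_eval_def using assms by (intro finprod_multf) auto
  finally show ?thesis .
qed

lemma formal_eval_swap:
  assumes \<phi>: "\<And>x y. x \<in> Poly_Mapping.keys u \<Longrightarrow> y \<in> Poly_Mapping.keys v \<Longrightarrow> \<phi> x y \<in> carrier G"
  shows "formal_eval G (\<lambda>x. formal_eval G (\<lambda>y. \<phi> x y) v) u
       = formal_eval G (\<lambda>y. formal_eval G (\<lambda>x. \<phi> x y) u) v"
proof -
  let ?v = "Poly_Mapping.keys v"
  have "Poly_Mapping.keys w \<subseteq> Poly_Mapping.keys u \<Longrightarrow>
     formal_eval G (\<lambda>x. formal_eval G (\<lambda>y. \<phi> x y) v) w
       = formal_eval G (\<lambda>y. formal_eval G (\<lambda>x. \<phi> x y) w) v" for w
  proof (induction rule: free_Abelian_group_induct [consumes 1, case_names zero diff gen])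
    case zero
    have "formal_eval G (\<lambda>y. \<one>) v = \<one>"
      by (simp add: formal_eval_def)
    then show ?case by (simp add: formal_eval_0)
  next
    case (diff w w')
    let ?a = "\<lambda>y. formal_eval G (\<lambda>x. \<phi> x y) w" and ?b = "\<lambda>y. formal_eval G (\<lambda>x. \<phi> x y) w'"
    have ab: "?a \<in> ?v \<rightarrow> carrier G" "?b \<in> ?v \<rightarrow> carrier G" "(\<lambda>y. inv ?b y) \<in> ?v \<rightarrow> carrier G"
      using diff by (auto intro!: formal_eval_closed inv_closed \<phi>)
    \<comment> \<open>Inversion is an endomorphism because \<open>G\<close> is commutative, so it
      passes through the evaluation.\<close>
    have inv: "inv formal_eval G ?b v = formal_eval G (\<lambda>y. inv ?b y) v"
      using ab(2) by (intro formal_eval_comp comm_group_axioms) (auto simp: hom_def inv_mult)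
    have "formal_eval G (\<lambda>x. formal_eval G (\<phi> x) v) (w - w')
       = formal_eval G (\<lambda>x. formal_eval G (\<phi> x) v) w \<otimes> inv formal_eval G (\<lambda>x. formal_eval G (\<phi> x) v) w'"
      using diff by (intro formal_eval_diff) (auto intro!: formal_eval_closed \<phi>)
    also have "\<dots> = formal_eval G (\<lambda>y. ?a y \<otimes> inv ?b y) v"
      using ab diff by (simp add: formal_eval_mult inv)
    also have "\<dots> = formal_eval G (\<lambda>y. formal_eval G (\<lambda>x. \<phi> x y) (w - w')) v"
    proof (rule formal_eval_cong)
      fix y assume "y \<in> ?v"
      then show "?a y \<otimes> inv ?b y = formal_eval G (\<lambda>x. \<phi> x y) (w - w')"
        using diff by (intro formal_eval_diff [symmetric]) (auto intro!: \<phi>)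
    next
      have "Poly_Mapping.keys (w - w') \<subseteq> Poly_Mapping.keys u"
        using diff keys_diff [of w w'] by blast
      then show "(\<lambda>y. formal_eval G (\<lambda>x. \<phi> x y) (w - w')) \<in> ?v \<rightarrow> carrier G"
        by (intro Pi_I formal_eval_closed \<phi>) auto
    qed
    finally show ?case .
  next
    case (gen a)
    have "formal_eval G (\<lambda>x. formal_eval G (\<phi> x) v) (frag_of a) = formal_eval G (\<phi> a) v"
      using gen by (intro formal_eval_frag_of formal_eval_closed) (auto intro!: \<phi>)
    also have "\<dots> = formal_eval G (\<lambda>y. formal_eval G (\<lambda>x. \<phi> x y) (frag_of a)) v"
      using gen by (intro formal_eval_cong)
        (auto simp: formal_eval_frag_of \<phi> keys_frag_of intro!: formal_eval_closed \<phi>)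
    finally show ?case .
  qed
  then show ?thesis by blast
qed

end

section \<open>Abelian groups given by generators and relations\<close>

text \<open>The second disjunct makes \<open>keys_rep\<close> hold for all \<open>z\<close>.\<close>

definition rep :: "'a set \<Rightarrow> ('a \<Rightarrow>\<^sub>0 int) set \<Rightarrow> ('a \<Rightarrow>\<^sub>0 int)" where
  "rep X z = (SOME u. Poly_Mapping.keys u \<subseteq> X \<and> (u \<in> z \<or> (\<forall>v\<in>z. \<not> Poly_Mapping.keys v \<subseteq> X)))"

lemma keys_rep: "Poly_Mapping.keys (rep X z) \<subseteq> X"
proof -
  have "\<exists>u. Poly_Mapping.keys u \<subseteq> X \<and> (u \<in> z \<or> (\<forall>v\<in>z. \<not> Poly_Mapping.keys v \<subseteq> X))"
    by (metis empty_subsetI keys_zero)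
  then show ?thesis unfolding rep_def by (rule someI2_ex) simp
qed

lemma rep_in:
  assumes "u \<in> z" "Poly_Mapping.keys u \<subseteq> X"
  shows "rep X z \<in> z"
  unfolding rep_def by (rule someI2 [of _ u]) (use assms in auto)

locale presentation =
  fixes X :: "'a set" and E :: "('a \<Rightarrow>\<^sub>0 int) set"
  assumes relators: "E \<subseteq> carrier (free_Abelian_group X)"
begin

abbreviation "F \<equiv> free_Abelian_group X"
abbreviation "N \<equiv> generate F E"
abbreviation "Q \<equiv> presented_group X E"

sublocale F: comm_group F by (rule abelian_free_Abelian_group)

lemma normal_relations: "N \<lhd> F"
  by (intro F.normal_iff_subgroup [THEN iffD2] F.generate_is_subgroup relators)

sublocale N: normal N F by (rule normal_relations)

sublocale Q: comm_group Q
  unfolding presented_group_def by (rule F.abelian_FactGroup [OF N.subgroup_axioms])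

lemma class_hom: "presented_class X E \<in> hom F Q"
proof (rule homI)
  fix x y assume "x \<in> carrier F" "y \<in> carrier F"
  then show "presented_class X E (x \<otimes>\<^bsub>F\<^esub> y) = presented_class X E x \<otimes>\<^bsub>Q\<^esub> presented_class X E y"
    unfolding presented_class_def presented_group_def mult_FactGroup by (rule N.rcos_sum [symmetric])
next
  fix x assume "x \<in> carrier F"
  then show "presented_class X E x \<in> carrier Q"
    unfolding presented_class_def presented_group_def carrier_FactGroup by (rule imageI)
qed

lemma class_closed: "Poly_Mapping.keys u \<subseteq> X \<Longrightarrow> presented_class X E u \<in> carrier Q"
  using class_hom by (auto simp: hom_def Pi_iff)

lemma in_class: "Poly_Mapping.keys u \<subseteq> X \<Longrightarrow> u \<in> presented_class X E u"
  unfolding presented_class_def by (rule F.rcos_self [OF _ N.subgroup_axioms]) simp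

lemma mem_presented:
  assumes z: "z \<in> carrier Q" and u: "u \<in> z"
  shows "Poly_Mapping.keys u \<subseteq> X" "z = presented_class X E u"
proof -
  obtain v where v: "v \<in> carrier F" "z = N #>\<^bsub>F\<^esub> v"
    using z unfolding presented_group_def carrier_FactGroup by auto
  have "u \<in> carrier F"
    using F.r_coset_subset_G [OF N.subset v(1)] u v(2) by blast
  then show "Poly_Mapping.keys u \<subseteq> X" by simp
  show "z = presented_class X E u"
    unfolding presented_class_def v(2)
    by (rule F.repr_independence [OF _ v(1) N.subgroup_axioms]) (use u v in simp)
qed

lemma rep_mem:
  assumes "z \<in> carrier Q"
  shows "rep X z \<in> z"
proof -
  obtain v where v: "v \<in> carrier F" "z = N #>\<^bsub>F\<^esub> v"
    using assms unfolding presented_group_def carrier_FactGroup by blast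
  have "v \<in> z" unfolding v(2) by (rule F.rcos_self [OF v(1) N.subgroup_axioms])
  then show ?thesis using mem_presented(1) [OF assms] by (blast intro: rep_in)
qed

lemma class_diff:
  assumes "Poly_Mapping.keys u \<subseteq> X" "Poly_Mapping.keys v \<subseteq> X"
  shows "presented_class X E (u - v) = presented_class X E u \<otimes>\<^bsub>Q\<^esub> inv\<^bsub>Q\<^esub> presented_class X E v"
proof -
  interpret c: group_hom F Q "presented_class X E"
    using class_hom by (simp add: group_hom_def group_hom_axioms_def F.is_group Q.is_group)
  show ?thesis
    using assms c.hom_mult [of u "- v"] c.hom_inv [of v] by simp
qed

lemma class_relator:
  assumes "e \<in> E"
  shows "presented_class X E e = \<one>\<^bsub>Q\<^esub>"
  unfolding presented_class_def presented_group_def one_FactGroup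
  using assms relators by (intro F.coset_join2 [OF _ N.subgroup_axioms] generate.incl) blast+

lemma class_eq:
  assumes "frag_of x - frag_of y \<in> E" "x \<in> X" "y \<in> X"
  shows "presented_class X E (frag_of x) = presented_class X E (frag_of y)"
proof -
  have *: "presented_class X E (frag_of x) \<in> carrier Q" "presented_class X E (frag_of y) \<in> carrier Q"
    using assms by (simp_all add: class_closed keys_frag_of)
  have "presented_class X E (frag_of x) \<otimes>\<^bsub>Q\<^esub> inv\<^bsub>Q\<^esub> presented_class X E (frag_of y) = \<one>\<^bsub>Q\<^esub>"
    using class_relator [OF assms(1)] assms by (simp add: class_diff keys_frag_of)
  with * show ?thesis
    by (metis Q.inv_closed Q.inv_equality Q.inv_inv)
qed

lemma class_eq_mult:
  assumes "frag_of x - frag_of y - frag_of z \<in> E" "x \<in> X" "y \<in> X" "z \<in> X"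
  shows "presented_class X E (frag_of x)
       = presented_class X E (frag_of y) \<otimes>\<^bsub>Q\<^esub> presented_class X E (frag_of z)"
proof -
  let ?c = "\<lambda>x. presented_class X E (frag_of x)"
  have *: "?c x \<in> carrier Q" "?c y \<in> carrier Q" "?c z \<in> carrier Q"
    using assms by (simp_all add: class_closed keys_frag_of)
  have "Poly_Mapping.keys (frag_of x - frag_of y) \<subseteq> X"
    using keys_diff [of "frag_of x" "frag_of y"] assms by (auto simp: keys_frag_of)
  then have "?c x \<otimes>\<^bsub>Q\<^esub> inv\<^bsub>Q\<^esub> ?c y \<otimes>\<^bsub>Q\<^esub> inv\<^bsub>Q\<^esub> ?c z = \<one>\<^bsub>Q\<^esub>"
    using class_relator [OF assms(1)] assms by (simp add: class_diff keys_frag_of)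
  then have "?c x \<otimes>\<^bsub>Q\<^esub> inv\<^bsub>Q\<^esub> (?c y \<otimes>\<^bsub>Q\<^esub> ?c z) = \<one>\<^bsub>Q\<^esub>"
    using * by (simp add: Q.inv_mult Q.m_assoc)
  with * show ?thesis
    by (metis Q.inv_closed Q.inv_equality Q.inv_inv Q.m_closed)
qed

end

text \<open>The data of the universal property. Since \<open>\<phi>\<close> kills the relators,
  evaluation is constant on each coset, and the choice made by \<open>rep\<close> does not influence
  it.\<close>

locale presentation_hom = presentation X E + G: comm_group G
  for X :: "'a set" and E and G :: "('g, 'y) monoid_scheme" +
  fixes \<phi> :: "'a \<Rightarrow> 'g"
  assumes \<phi>_closed: "\<phi> \<in> X \<rightarrow> carrier G"
    and \<phi>_relators: "e \<in> E \<Longrightarrow> formal_eval G \<phi> e = \<one>\<^bsub>G\<^esub>"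
begin

sublocale e: group_hom F G "formal_eval G \<phi>"
  by (rule G.formal_eval_group_hom [OF \<phi>_closed])

lemma formal_eval_relation: "n \<in> N \<Longrightarrow> formal_eval G \<phi> n = \<one>\<^bsub>G\<^esub>"
proof (induction rule: generate.induct)
  case one
  show ?case by (rule e.hom_one)
next
  case (incl h)
  then show ?case by (rule \<phi>_relators)
next
  case (inv h)
  then have "h \<in> carrier F" using relators by blast
  then have "formal_eval G \<phi> (inv\<^bsub>F\<^esub> h) = inv\<^bsub>G\<^esub> formal_eval G \<phi> h" by (rule e.hom_inv)
  then show ?case by (simp add: \<phi>_relators inv)
next
  case (eng h k)
  have "h \<in> carrier F" "k \<in> carrier F"
    using eng F.generate_in_carrier relators by blast+
  then have "formal_eval G \<phi> (h \<otimes>\<^bsub>F\<^esub> k) = formal_eval G \<phi> h \<otimes>\<^bsub>G\<^esub> formal_eval G \<phi> k"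
    by (rule e.hom_mult)
  then show ?case by (simp add: eng.IH)
qed

lemma formal_eval_unique:
  assumes "z \<in> carrier Q" "u \<in> z" "v \<in> z"
  shows "formal_eval G \<phi> u = formal_eval G \<phi> v"
proof -
  have "u \<in> N #>\<^bsub>F\<^esub> v"
    using assms mem_presented(2) [of z v] by (simp add: presented_class_def)
  then obtain n where n: "n \<in> N" "u = n \<otimes>\<^bsub>F\<^esub> v" by (auto simp: r_coset_def)
  have "n \<in> carrier F" "v \<in> carrier F"
    using n F.generate_in_carrier relators mem_presented(1) [OF assms(1,3)] by auto
  then have "formal_eval G \<phi> u = formal_eval G \<phi> n \<otimes>\<^bsub>G\<^esub> formal_eval G \<phi> v"
    unfolding n(2) by (rule e.hom_mult)
  then show ?thesis
    using n \<open>v \<in> carrier F\<close> by (simp add: formal_eval_relation)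
qed

lemma formal_eval_rep:
  assumes "z \<in> carrier Q" "u \<in> z"
  shows "formal_eval G \<phi> u = formal_eval G \<phi> (rep X z)"
  by (rule formal_eval_unique [OF assms rep_mem [OF assms(1)]])

lemma formal_eval_rep_hom: "(\<lambda>z. formal_eval G \<phi> (rep X z)) \<in> hom Q G"
proof (rule homI)
  fix z w assume z: "z \<in> carrier Q" and w: "w \<in> carrier Q"
  let ?u = "rep X z" and ?v = "rep X w"
  have "z \<otimes>\<^bsub>Q\<^esub> w = presented_class X E ?u \<otimes>\<^bsub>Q\<^esub> presented_class X E ?v"
    using z w mem_presented(2) rep_mem by metis
  also have "\<dots> = presented_class X E (?u + ?v)"
    using hom_mult [OF class_hom, of ?u ?v] by (simp add: keys_rep)
  finally have "?u + ?v \<in> z \<otimes>\<^bsub>Q\<^esub> w"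
    using in_class [of "?u + ?v"] keys_add [of ?u ?v] keys_rep [of X z] keys_rep [of X w] by auto
  then have "formal_eval G \<phi> (rep X (z \<otimes>\<^bsub>Q\<^esub> w)) = formal_eval G \<phi> (?u + ?v)"
    using z w by (intro formal_eval_rep [symmetric]) auto
  then show "formal_eval G \<phi> (rep X (z \<otimes>\<^bsub>Q\<^esub> w)) = formal_eval G \<phi> ?u \<otimes>\<^bsub>G\<^esub> formal_eval G \<phi> ?v"
    using e.hom_mult [of ?u ?v] by (simp add: keys_rep)
next
  fix z
  show "formal_eval G \<phi> (rep X z) \<in> carrier G"
    using keys_rep [of X z] \<phi>_closed by (intro G.formal_eval_closed) auto
qed

lemma formal_eval_rep_class:
  assumes "x \<in> X"
  shows "formal_eval G \<phi> (rep X (presented_class X E (frag_of x))) = \<phi> x"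
proof -
  have "Poly_Mapping.keys (frag_of x) \<subseteq> X" using assms by (simp add: keys_frag_of)
  then have "formal_eval G \<phi> (rep X (presented_class X E (frag_of x))) = formal_eval G \<phi> (frag_of x)"
    by (intro formal_eval_rep [symmetric] class_closed in_class)
  also have "\<dots> = \<phi> x" using assms \<phi>_closed by (intro G.formal_eval_frag_of) auto
  finally show ?thesis .
qed

lemma tensor_evals_to_rep:
  assumes "z \<in> carrier Q"
  shows "tensor_evals_to G \<phi> z (formal_eval G \<phi> (rep X z))"
  unfolding tensor_evals_to_def by (intro ballI formal_eval_rep assms)

lemma tensor_eval_rep:
  assumes "z \<in> carrier Q"
  shows "tensor_eval G \<phi> z = formal_eval G \<phi> (rep X z)"
  unfolding tensor_eval_def
proof (rule the_equality)
  show "tensor_evals_to G \<phi> z (formal_eval G \<phi> (rep X z))"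
    by (rule tensor_evals_to_rep [OF assms])
  \<comment> \<open>A coset is nonempty, as \<open>rep\<close> witnesses, so at most one value is
    possible.\<close>
  show "y = formal_eval G \<phi> (rep X z)" if "tensor_evals_to G \<phi> z y" for y
    using that rep_mem [OF assms] by (simp add: tensor_evals_to_def)
qed

end

section \<open>Sweedler sums\<close>

text \<open>Restricting \<open>\<phi>\<close> frees \<open>sweedler_cong\<close> of closure conditions, so that it can serve as a
  congruence rule of the simplifier.\<close>

definition sweedler ::
    "'m set \<Rightarrow> 'n set \<Rightarrow> ('g, 'x) monoid_scheme \<Rightarrow> ('m \<Rightarrow> 'n \<Rightarrow> 'g) \<Rightarrow> ('m \<times> 'n \<Rightarrow>\<^sub>0 int) set \<Rightarrow> 'g" where
  "sweedler U V G \<phi> z = formal_eval G (restrict (\<lambda>(x, y). \<phi> x y) (U \<times> V)) (rep (U \<times> V) z)"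

lemma sweedler_cong:
  assumes "\<And>x y. x \<in> U \<Longrightarrow> y \<in> V \<Longrightarrow> \<phi> x y = \<psi> x y"
  shows "sweedler U V G \<phi> z = sweedler U V G \<psi> z"
proof -
  have "restrict (\<lambda>(x, y). \<phi> x y) (U \<times> V) = restrict (\<lambda>(x, y). \<psi> x y) (U \<times> V)"
    using assms by (intro restrict_ext) auto
  then show ?thesis unfolding sweedler_def by (rule arg_cong)
qed

lemma rep_Times_D:
  assumes "(x, y) \<in> Poly_Mapping.keys (rep (U \<times> V) z)"
  shows "x \<in> U" "y \<in> V"
  using assms keys_rep [of "U \<times> V" z] by auto

context comm_group
begin

lemma sweedler_eq:
  assumes "\<And>x y. x \<in> U \<Longrightarrow> y \<in> V \<Longrightarrow> \<phi> x y \<in> carrier G"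
  shows "sweedler U V G \<phi> z = formal_eval G (\<lambda>(x, y). \<phi> x y) (rep (U \<times> V) z)"
  unfolding sweedler_def using keys_rep [of "U \<times> V" z]
  by (intro formal_eval_cong) (auto intro: assms)

lemma sweedler_closed:
  assumes \<phi>: "\<And>x y. x \<in> U \<Longrightarrow> y \<in> V \<Longrightarrow> \<phi> x y \<in> carrier G"
  shows "sweedler U V G \<phi> z \<in> carrier G"
proof -
  have "formal_eval G (\<lambda>(x, y). \<phi> x y) (rep (U \<times> V) z) \<in> carrier G"
    by (rule formal_eval_closed) (auto dest: rep_Times_D intro: \<phi>)
  then show ?thesis by (simp add: sweedler_eq \<phi>)
qed

lemma sweedler_mult:
  assumes \<phi>: "\<And>x y. x \<in> U \<Longrightarrow> y \<in> V \<Longrightarrow> \<phi> x y \<in> carrier G"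
    and \<psi>: "\<And>x y. x \<in> U \<Longrightarrow> y \<in> V \<Longrightarrow> \<psi> x y \<in> carrier G"
  shows "sweedler U V G (\<lambda>x y. \<phi> x y \<otimes> \<psi> x y) z = sweedler U V G \<phi> z \<otimes> sweedler U V G \<psi> z"
proof -
  have "formal_eval G (\<lambda>p. (case p of (x, y) \<Rightarrow> \<phi> x y) \<otimes> (case p of (x, y) \<Rightarrow> \<psi> x y)) (rep (U \<times> V) z)
    = formal_eval G (\<lambda>(x, y). \<phi> x y) (rep (U \<times> V) z) \<otimes> formal_eval G (\<lambda>(x, y). \<psi> x y) (rep (U \<times> V) z)"
    by (rule formal_eval_mult) (auto dest: rep_Times_D intro: \<phi> \<psi>)
  moreover have "(\<lambda>p. (case p of (x, y) \<Rightarrow> \<phi> x y) \<otimes> (case p of (x, y) \<Rightarrow> \<psi> x y)) = (\<lambda>(x, y). \<phi> x y \<otimes> \<psi> x y)"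
    by (simp add: fun_eq_iff)
  ultimately show ?thesis by (simp add: sweedler_eq \<phi> \<psi>)
qed

lemma sweedler_comp:
  assumes G': "comm_group G'" and f: "f \<in> hom G G'"
    and \<phi>: "\<And>x y. x \<in> U \<Longrightarrow> y \<in> V \<Longrightarrow> \<phi> x y \<in> carrier G"
  shows "f (sweedler U V G \<phi> z) = sweedler U V G' (\<lambda>x y. f (\<phi> x y)) z"
proof -
  have "f (formal_eval G (\<lambda>(x, y). \<phi> x y) (rep (U \<times> V) z))
     = formal_eval G' (\<lambda>p. f (case p of (x, y) \<Rightarrow> \<phi> x y)) (rep (U \<times> V) z)"
    by (rule formal_eval_comp [OF G' f]) (auto dest: rep_Times_D intro: \<phi>)
  moreover have "(\<lambda>p. f (case p of (x, y) \<Rightarrow> \<phi> x y)) = (\<lambda>(x, y). f (\<phi> x y))"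
    by (simp add: fun_eq_iff)
  ultimately show ?thesis
    using hom_in_carrier [OF f] by (simp add: sweedler_eq comm_group.sweedler_eq [OF G'] \<phi>)
qed

lemma sweedler_swap:
  assumes \<phi>: "\<And>x y x' y'. x \<in> U \<Longrightarrow> y \<in> V \<Longrightarrow> x' \<in> U' \<Longrightarrow> y' \<in> V' \<Longrightarrow> \<phi> x y x' y' \<in> carrier G"
  shows "sweedler U V G (\<lambda>x y. sweedler U' V' G (\<lambda>x' y'. \<phi> x y x' y') w) z
       = sweedler U' V' G (\<lambda>x' y'. sweedler U V G (\<lambda>x y. \<phi> x y x' y') z) w"
proof -
  \<comment> \<open>Stated for fresh sets and types, so that it unfolds both sides of the claim, in
    which the two index pairs are interchanged.\<close>
  have *: "sweedler U V G (\<lambda>x y. sweedler U' V' G (\<phi> x y) w) z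
      = formal_eval G (\<lambda>(x, y). formal_eval G (\<lambda>(x', y'). \<phi> x y x' y') (rep (U' \<times> V') w)) (rep (U \<times> V) z)"
    if "\<And>x y x' y'. x \<in> U \<Longrightarrow> y \<in> V \<Longrightarrow> x' \<in> U' \<Longrightarrow> y' \<in> V' \<Longrightarrow> \<phi> x y x' y' \<in> carrier G"
    for U :: "'u set" and V :: "'v set" and U' :: "'w set" and V' :: "'t set" and \<phi> z w
  proof -
    have "sweedler U V G (\<lambda>x y. sweedler U' V' G (\<phi> x y) w) z
       = sweedler U V G (\<lambda>x y. formal_eval G (\<lambda>(x', y'). \<phi> x y x' y') (rep (U' \<times> V') w)) z"
      by (intro sweedler_cong sweedler_eq that)
    also have "\<dots> = formal_eval G (\<lambda>(x, y). formal_eval G (\<lambda>(x', y'). \<phi> x y x' y') (rep (U' \<times> V') w)) (rep (U \<times> V) z)"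
    proof (rule sweedler_eq)
      fix x y assume "x \<in> U" "y \<in> V"
      then show "formal_eval G (\<lambda>(x', y'). \<phi> x y x' y') (rep (U' \<times> V') w) \<in> carrier G"
        by (intro formal_eval_closed) (auto dest: rep_Times_D intro: that)
    qed
    finally show ?thesis .
  qed
  let ?\<phi> = "\<lambda>p q. \<phi> (fst p) (snd p) (fst q) (snd q)"
  have "formal_eval G (\<lambda>p. formal_eval G (\<lambda>q. ?\<phi> p q) (rep (U' \<times> V') w)) (rep (U \<times> V) z)
     = formal_eval G (\<lambda>q. formal_eval G (\<lambda>p. ?\<phi> p q) (rep (U \<times> V) z)) (rep (U' \<times> V') w)"
  proof (rule formal_eval_swap)
    fix p q assume "p \<in> Poly_Mapping.keys (rep (U \<times> V) z)" "q \<in> Poly_Mapping.keys (rep (U' \<times> V') w)"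
    then have "p \<in> U \<times> V" "q \<in> U' \<times> V'"
      by (auto dest!: subsetD [OF keys_rep])
    then show "?\<phi> p q \<in> carrier G" by (auto intro: \<phi>)
  qed
  then show ?thesis
    by (simp add: * \<phi> case_prod_unfold)
qed

end

section \<open>Balanced maps and the universal property of the tensor product\<close>

definition balanced ::
    "('m, 'x) ring_scheme \<Rightarrow> ('n, 'y) ring_scheme \<Rightarrow> ('b, 'z) ring_scheme \<Rightarrow>
     ('m \<Rightarrow> 'b \<Rightarrow> 'm) \<Rightarrow> ('b \<Rightarrow> 'n \<Rightarrow> 'n) \<Rightarrow> ('g, 'w) monoid_scheme \<Rightarrow> ('m \<Rightarrow> 'n \<Rightarrow> 'g) \<Rightarrow> bool" where
  "balanced M N B r l G \<phi> \<longleftrightarrow>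
     (\<forall>m\<in>carrier M. \<forall>n\<in>carrier N. \<phi> m n \<in> carrier G) \<and>
     (\<forall>m\<in>carrier M. \<forall>m'\<in>carrier M. \<forall>n\<in>carrier N. \<phi> (m \<oplus>\<^bsub>M\<^esub> m') n = \<phi> m n \<otimes>\<^bsub>G\<^esub> \<phi> m' n) \<and>
     (\<forall>m\<in>carrier M. \<forall>n\<in>carrier N. \<forall>n'\<in>carrier N. \<phi> m (n \<oplus>\<^bsub>N\<^esub> n') = \<phi> m n \<otimes>\<^bsub>G\<^esub> \<phi> m n') \<and>
     (\<forall>m\<in>carrier M. \<forall>b\<in>carrier B. \<forall>n\<in>carrier N. \<phi> (r m b) n = \<phi> m (l b n))"

lemma balanced_closed:
  "balanced M N B r l G \<phi> \<Longrightarrow> m \<in> carrier M \<Longrightarrow> n \<in> carrier N \<Longrightarrow> \<phi> m n \<in> carrier G"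
  by (simp add: balanced_def)

text \<open>Organised by adjacent pairs, so that fixing an outer variable leaves a
  \<open>balanced\<close> map at once; additivity in the middle variable thus occurs in both
  halves.\<close>

definition tri_balanced ::
    "('m, 'x) ring_scheme \<Rightarrow> ('n, 'y) ring_scheme \<Rightarrow> ('p, 'z) ring_scheme \<Rightarrow>
     ('b, 'v) ring_scheme \<Rightarrow> ('m \<Rightarrow> 'b \<Rightarrow> 'm) \<Rightarrow> ('b \<Rightarrow> 'n \<Rightarrow> 'n) \<Rightarrow>
     ('c, 'w) ring_scheme \<Rightarrow> ('n \<Rightarrow> 'c \<Rightarrow> 'n) \<Rightarrow> ('c \<Rightarrow> 'p \<Rightarrow> 'p) \<Rightarrow>
     ('g, 'u) monoid_scheme \<Rightarrow> ('m \<Rightarrow> 'n \<Rightarrow> 'p \<Rightarrow> 'g) \<Rightarrow> bool" where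
  "tri_balanced M N P B rB lB C rC lC G \<psi> \<longleftrightarrow>
     (\<forall>p\<in>carrier P. balanced M N B rB lB G (\<lambda>m n. \<psi> m n p)) \<and>
     (\<forall>m\<in>carrier M. balanced N P C rC lC G (\<psi> m))"

locale tensor_product = M: abelian_group M + N: abelian_group N
  for M :: "('m, 'x) ring_scheme" and N :: "('n, 'y) ring_scheme" +
  fixes B :: "('b, 'z) ring_scheme" and r :: "'m \<Rightarrow> 'b \<Rightarrow> 'm" and l :: "'b \<Rightarrow> 'n \<Rightarrow> 'n"
  assumes right_closed: "\<lbrakk>m \<in> carrier M; b \<in> carrier B\<rbrakk> \<Longrightarrow> r m b \<in> carrier M"
    and left_closed: "\<lbrakk>b \<in> carrier B; n \<in> carrier N\<rbrakk> \<Longrightarrow> l b n \<in> carrier N"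
begin

sublocale presentation "carrier M \<times> carrier N" "tensor_relators M N B r l"
proof
  have "Poly_Mapping.keys (frag_of p - frag_of q) \<subseteq> carrier M \<times> carrier N"
    if "p \<in> carrier M \<times> carrier N" "q \<in> carrier M \<times> carrier N" for p q
    using keys_diff [of "frag_of p" "frag_of q"] that by (auto simp: keys_frag_of)
  moreover have "Poly_Mapping.keys (frag_of p - frag_of q - frag_of s) \<subseteq> carrier M \<times> carrier N"
    if "p \<in> carrier M \<times> carrier N" "q \<in> carrier M \<times> carrier N" "s \<in> carrier M \<times> carrier N" for p q s
    using keys_diff [of "frag_of p - frag_of q" "frag_of s"] keys_diff [of "frag_of p" "frag_of q"] that
    by (auto simp: keys_frag_of)
  ultimately show "tensor_relators M N B r l \<subseteq> carrier (free_Abelian_group (carrier M \<times> carrier N))"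
    unfolding tensor_relators_def by (safe; simp add: right_closed left_closed)
qed

lemma presentation_hom:
  assumes G: "comm_group G" and \<phi>: "balanced M N B r l G \<phi>"
  shows "presentation_hom (carrier M \<times> carrier N) (tensor_relators M N B r l) G (\<lambda>(x, y). \<phi> x y)"
proof -
  interpret G: comm_group G by (rule G)
  let ?e = "formal_eval G (\<lambda>(x, y). \<phi> x y)"
  have [simp]: "?e (frag_of (m, n)) = \<phi> m n" if "m \<in> carrier M" "n \<in> carrier N" for m n
    using \<phi> that by (subst G.formal_eval_frag_of) (auto simp: balanced_def)
  have 2: "?e (frag_of p - frag_of q) = ?e (frag_of p) \<otimes>\<^bsub>G\<^esub> inv\<^bsub>G\<^esub> ?e (frag_of q)"
    if "p \<in> carrier M \<times> carrier N" "q \<in> carrier M \<times> carrier N" for p q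
    using that by (intro G.formal_eval_diff) (auto simp: keys_frag_of balanced_closed [OF \<phi>])
  have 3: "?e (frag_of p - frag_of q - frag_of s)
       = ?e (frag_of p) \<otimes>\<^bsub>G\<^esub> inv\<^bsub>G\<^esub> ?e (frag_of q) \<otimes>\<^bsub>G\<^esub> inv\<^bsub>G\<^esub> ?e (frag_of s)"
    if "p \<in> carrier M \<times> carrier N" "q \<in> carrier M \<times> carrier N" "s \<in> carrier M \<times> carrier N" for p q s
  proof -
    have "?e (frag_of p - frag_of q - frag_of s) = ?e (frag_of p - frag_of q) \<otimes>\<^bsub>G\<^esub> inv\<^bsub>G\<^esub> ?e (frag_of s)"
      using that keys_diff [of "frag_of p" "frag_of q"]
      by (intro G.formal_eval_diff) (auto simp: keys_frag_of balanced_closed [OF \<phi>])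
    then show ?thesis using 2 that by simp
  qed
  \<comment> \<open>An additivity relator evaluates to this product once the matching clause of
    \<open>balanced\<close> has split its first term.\<close>
  have cancel: "a \<otimes>\<^bsub>G\<^esub> b \<otimes>\<^bsub>G\<^esub> inv\<^bsub>G\<^esub> a \<otimes>\<^bsub>G\<^esub> inv\<^bsub>G\<^esub> b = \<one>\<^bsub>G\<^esub>" if "a \<in> carrier G" "b \<in> carrier G" for a b
    using that by (simp add: G.m_assoc G.m_lcomm [of b])
  show ?thesis
  proof
    show "(\<lambda>(x, y). \<phi> x y) \<in> carrier M \<times> carrier N \<rightarrow> carrier G"
      using balanced_closed [OF \<phi>] by auto
    show "?e e = \<one>\<^bsub>G\<^esub>" if "e \<in> tensor_relators M N B r l" for e
      using that \<phi> unfolding tensor_relators_def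
      by (elim UnE CollectE exE conjE) (simp_all add: 2 3 right_closed left_closed balanced_def cancel)
  qed
qed

context
  fixes G :: "('g, 'w) monoid_scheme" and \<phi>
  assumes G: "comm_group G" and \<phi>: "balanced M N B r l G \<phi>"
begin

interpretation presentation_hom "carrier M \<times> carrier N" "tensor_relators M N B r l" G "\<lambda>(x, y). \<phi> x y"
  by (rule presentation_hom [OF G \<phi>])

lemma sweedler_rep: "sweedler (carrier M) (carrier N) G \<phi> z
    = formal_eval G (\<lambda>(x, y). \<phi> x y) (rep (carrier M \<times> carrier N) z)"
  by (rule G.sweedler_eq) (rule balanced_closed [OF \<phi>])

lemma sweedler_hom: "sweedler (carrier M) (carrier N) G \<phi> \<in> hom (tensor M N B r l) G"
  using formal_eval_rep_hom unfolding sweedler_rep [abs_def] tensor_def .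

lemma sweedler_pure:
  "m \<in> carrier M \<Longrightarrow> n \<in> carrier N \<Longrightarrow> sweedler (carrier M) (carrier N) G \<phi> (pure M N B r l m n) = \<phi> m n"
  using formal_eval_rep_class [of "(m, n)"] unfolding sweedler_rep pure_def by simp

lemma tensor_evals_to_sweedler:
  "z \<in> carrier (tensor M N B r l) \<Longrightarrow>
     tensor_evals_to G (\<lambda>(x, y). \<phi> x y) z (sweedler (carrier M) (carrier N) G \<phi> z)"
  using tensor_evals_to_rep unfolding sweedler_rep tensor_def .

lemma tensor_eval_sweedler:
  "z \<in> carrier (tensor M N B r l) \<Longrightarrow>
     tensor_eval G (\<lambda>(x, y). \<phi> x y) z = sweedler (carrier M) (carrier N) G \<phi> z"
  using tensor_eval_rep unfolding sweedler_rep tensor_def .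

end

lemma tensor_comm_group: "comm_group (tensor M N B r l)"
  unfolding tensor_def by (rule Q.comm_group_axioms)

text \<open>The assertion speaks of every representative of \<open>z\<close>, in particular of the
  one chosen by \<open>rep\<close>, and so takes the place of a balance check. This is how the
  Sweedler-style axioms enter the calculus.\<close>

lemma sweedler_evals_toD:
  assumes "z \<in> carrier (tensor M N B r l)" "comm_group G"
    and "\<And>m n. m \<in> carrier M \<Longrightarrow> n \<in> carrier N \<Longrightarrow> \<phi> m n \<in> carrier G"
    and "tensor_evals_to G (\<lambda>(x, y). \<phi> x y) z y"
  shows "sweedler (carrier M) (carrier N) G \<phi> z = y"
proof -
  have "sweedler (carrier M) (carrier N) G \<phi> z
     = formal_eval G (\<lambda>(x, y). \<phi> x y) (rep (carrier M \<times> carrier N) z)"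
    by (rule comm_group.sweedler_eq) (use assms in auto)
  also have "\<dots> = y"
    using assms(1,4) rep_mem unfolding tensor_evals_to_def tensor_def by blast
  finally show ?thesis .
qed

lemma pure_closed: "m \<in> carrier M \<Longrightarrow> n \<in> carrier N \<Longrightarrow> pure M N B r l m n \<in> carrier (tensor M N B r l)"
  unfolding pure_def tensor_def by (rule class_closed) (simp add: keys_frag_of)

lemma pure_balanced: "balanced M N B r l (tensor M N B r l) (pure M N B r l)"
  unfolding balanced_def
proof (intro conjI ballI)
  fix m n m' assume *: "m \<in> carrier M" "m' \<in> carrier M" "n \<in> carrier N"
  show "pure M N B r l (m \<oplus>\<^bsub>M\<^esub> m') n
      = pure M N B r l m n \<otimes>\<^bsub>tensor M N B r l\<^esub> pure M N B r l m' n"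
    unfolding pure_def tensor_def
    by (rule class_eq_mult) (use * in \<open>auto simp: keys_frag_of tensor_relators_def\<close>)
next
  fix m n n' assume *: "m \<in> carrier M" "n \<in> carrier N" "n' \<in> carrier N"
  show "pure M N B r l m (n \<oplus>\<^bsub>N\<^esub> n')
      = pure M N B r l m n \<otimes>\<^bsub>tensor M N B r l\<^esub> pure M N B r l m n'"
    unfolding pure_def tensor_def
    by (rule class_eq_mult) (use * in \<open>auto simp: keys_frag_of tensor_relators_def\<close>)
next
  fix m b n assume *: "m \<in> carrier M" "b \<in> carrier B" "n \<in> carrier N"
  show "pure M N B r l (r m b) n = pure M N B r l m (l b n)"
    unfolding pure_def
    by (rule class_eq) (use * in \<open>auto simp: keys_frag_of tensor_relators_def left_closed right_closed\<close>)
qed (rule pure_closed)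

end

section \<open>Triple tensor products and iterated coproducts\<close>

locale tensor3_product = MN: tensor_product M N B rB lB + NP: tensor_product N P C rC lC
  for M :: "('m, 'x) ring_scheme" and N :: "('n, 'y) ring_scheme" and P :: "('p, 'z) ring_scheme"
    and B :: "('b, 'v) ring_scheme" and rB :: "'m \<Rightarrow> 'b \<Rightarrow> 'm" and lB :: "'b \<Rightarrow> 'n \<Rightarrow> 'n"
    and C :: "('c, 'w) ring_scheme" and rC :: "'n \<Rightarrow> 'c \<Rightarrow> 'n" and lC :: "'c \<Rightarrow> 'p \<Rightarrow> 'p"
begin

abbreviation "X3 \<equiv> carrier M \<times> carrier N \<times> carrier P"
abbreviation "E3 \<equiv> tensor3_relators M N P B rB lB C rC lC"
abbreviation "T3 \<equiv> tensor3 M N P B rB lB C rC lC"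
abbreviation "p3 \<equiv> pure3 M N P B rB lB C rC lC"

sublocale T: presentation X3 E3
proof
  have "Poly_Mapping.keys (frag_of p - frag_of q) \<subseteq> X3" if "p \<in> X3" "q \<in> X3" for p q
    using keys_diff [of "frag_of p" "frag_of q"] that by (auto simp: keys_frag_of)
  moreover have "Poly_Mapping.keys (frag_of p - frag_of q - frag_of s) \<subseteq> X3"
    if "p \<in> X3" "q \<in> X3" "s \<in> X3" for p q s
    using keys_diff [of "frag_of p - frag_of q" "frag_of s"] keys_diff [of "frag_of p" "frag_of q"] that
    by (auto simp: keys_frag_of)
  ultimately show "E3 \<subseteq> carrier (free_Abelian_group X3)"
    unfolding tensor3_relators_def
    by (safe; simp add: MN.right_closed MN.left_closed NP.right_closed NP.left_closed)
qed

lemma comm_group: "comm_group T3"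
  unfolding tensor3_def by (rule T.Q.comm_group_axioms)

lemma pure3_closed:
  "m \<in> carrier M \<Longrightarrow> n \<in> carrier N \<Longrightarrow> p \<in> carrier P \<Longrightarrow> p3 m n p \<in> carrier T3"
  unfolding pure3_def tensor3_def by (rule T.class_closed) (simp add: keys_frag_of)

lemma pure3_tri_balanced: "tri_balanced M N P B rB lB C rC lC T3 p3"
  unfolding tri_balanced_def balanced_def
proof (intro conjI ballI)
  fix m n p m' assume *: "m \<in> carrier M" "m' \<in> carrier M" "n \<in> carrier N" "p \<in> carrier P"
  show "p3 (m \<oplus>\<^bsub>M\<^esub> m') n p = p3 m n p \<otimes>\<^bsub>T3\<^esub> p3 m' n p"
    unfolding pure3_def tensor3_def
  proof (rule T.class_eq_mult)
    show "frag_of (m \<oplus>\<^bsub>M\<^esub> m', n, p) - frag_of (m, n, p) - frag_of (m', n, p) \<in> E3"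
      using * unfolding tensor3_relators_def by blast
  qed (use * in simp_all)
next
  fix m n p n' assume *: "m \<in> carrier M" "n' \<in> carrier N" "n \<in> carrier N" "p \<in> carrier P"
  show "p3 m (n \<oplus>\<^bsub>N\<^esub> n') p = p3 m n p \<otimes>\<^bsub>T3\<^esub> p3 m n' p"
    unfolding pure3_def tensor3_def
  proof (rule T.class_eq_mult)
    show "frag_of (m, n \<oplus>\<^bsub>N\<^esub> n', p) - frag_of (m, n, p) - frag_of (m, n', p) \<in> E3"
      using * unfolding tensor3_relators_def by blast
  qed (use * in simp_all)
  then show "p3 m (n \<oplus>\<^bsub>N\<^esub> n') p = p3 m n p \<otimes>\<^bsub>T3\<^esub> p3 m n' p" .
next
  fix m n p p' assume *: "m \<in> carrier M" "n \<in> carrier N" "p \<in> carrier P" "p' \<in> carrier P"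
  show "p3 m n (p \<oplus>\<^bsub>P\<^esub> p') = p3 m n p \<otimes>\<^bsub>T3\<^esub> p3 m n p'"
    unfolding pure3_def tensor3_def
  proof (rule T.class_eq_mult)
    show "frag_of (m, n, p \<oplus>\<^bsub>P\<^esub> p') - frag_of (m, n, p) - frag_of (m, n, p') \<in> E3"
      using * unfolding tensor3_relators_def by blast
  qed (use * in simp_all)
next
  fix m b n p assume *: "m \<in> carrier M" "b \<in> carrier B" "n \<in> carrier N" "p \<in> carrier P"
  show "p3 (rB m b) n p = p3 m (lB b n) p"
    unfolding pure3_def
  proof (rule T.class_eq)
    show "frag_of (rB m b, n, p) - frag_of (m, lB b n, p) \<in> E3"
      using * unfolding tensor3_relators_def by blast
  qed (use * in \<open>simp_all add: MN.left_closed MN.right_closed NP.left_closed NP.right_closed\<close>)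
next
  fix m c n p assume *: "m \<in> carrier M" "c \<in> carrier C" "n \<in> carrier N" "p \<in> carrier P"
  show "p3 m (rC n c) p = p3 m n (lC c p)"
    unfolding pure3_def
  proof (rule T.class_eq)
    show "frag_of (m, rC n c, p) - frag_of (m, n, lC c p) \<in> E3"
      using * unfolding tensor3_relators_def by blast
  qed (use * in \<open>simp_all add: MN.left_closed MN.right_closed NP.left_closed NP.right_closed\<close>)
qed (auto intro: pure3_closed)

text \<open>The universal property by which one equation in \<open>T3\<close> yields an equation for
  every integrand \<open>\<psi>\<close>: both sides are pushed along \<open>\<Psi>\<close>.\<close>

lemma tri_balanced_factor:
  assumes G: "comm_group G" and \<psi>: "tri_balanced M N P B rB lB C rC lC G \<psi>"
  obtains \<Psi> where "\<Psi> \<in> hom T3 G"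
    and "\<And>m n p. m \<in> carrier M \<Longrightarrow> n \<in> carrier N \<Longrightarrow> p \<in> carrier P \<Longrightarrow> \<Psi> (p3 m n p) = \<psi> m n p"
proof -
  interpret G: comm_group G by (rule G)
  let ?\<psi> = "\<lambda>(x, y, z). \<psi> x y z"
  let ?e = "formal_eval G ?\<psi>"
  have closed: "\<psi> m n p \<in> carrier G" if "m \<in> carrier M" "n \<in> carrier N" "p \<in> carrier P" for m n p
    using \<psi> that by (simp add: tri_balanced_def balanced_def)
  have [simp]: "?e (frag_of (m, n, p)) = \<psi> m n p" if "m \<in> carrier M" "n \<in> carrier N" "p \<in> carrier P" for m n p
    using closed that by (subst G.formal_eval_frag_of) auto
  have 2: "?e (frag_of p - frag_of q) = ?e (frag_of p) \<otimes>\<^bsub>G\<^esub> inv\<^bsub>G\<^esub> ?e (frag_of q)"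
    if "p \<in> X3" "q \<in> X3" for p q
    using that by (intro G.formal_eval_diff) (auto simp: keys_frag_of closed)
  have 3: "?e (frag_of p - frag_of q - frag_of s)
       = ?e (frag_of p) \<otimes>\<^bsub>G\<^esub> inv\<^bsub>G\<^esub> ?e (frag_of q) \<otimes>\<^bsub>G\<^esub> inv\<^bsub>G\<^esub> ?e (frag_of s)"
    if "p \<in> X3" "q \<in> X3" "s \<in> X3" for p q s
  proof -
    have "?e (frag_of p - frag_of q - frag_of s) = ?e (frag_of p - frag_of q) \<otimes>\<^bsub>G\<^esub> inv\<^bsub>G\<^esub> ?e (frag_of s)"
      using that keys_diff [of "frag_of p" "frag_of q"]
      by (intro G.formal_eval_diff) (auto simp: keys_frag_of closed)
    then show ?thesis using 2 that by simp
  qed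
  have cancel: "a \<otimes>\<^bsub>G\<^esub> b \<otimes>\<^bsub>G\<^esub> inv\<^bsub>G\<^esub> a \<otimes>\<^bsub>G\<^esub> inv\<^bsub>G\<^esub> b = \<one>\<^bsub>G\<^esub>" if "a \<in> carrier G" "b \<in> carrier G" for a b
    using that by (simp add: G.m_assoc G.m_lcomm [of b])
  interpret h: presentation_hom X3 E3 G ?\<psi>
  proof
    show "?\<psi> \<in> X3 \<rightarrow> carrier G" using closed by auto
    show "?e e = \<one>\<^bsub>G\<^esub>" if "e \<in> E3" for e
      using that \<psi> unfolding tensor3_relators_def
      by (elim UnE CollectE exE conjE)
        (simp_all add: 2 3 MN.right_closed MN.left_closed NP.right_closed NP.left_closed
          tri_balanced_def balanced_def cancel)
  qed
  show thesis
  proof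
    show "(\<lambda>z. ?e (rep X3 z)) \<in> hom T3 G"
      unfolding tensor3_def by (rule h.formal_eval_rep_hom)
    show "?e (rep X3 (p3 m n p)) = \<psi> m n p"
      if "m \<in> carrier M" "n \<in> carrier N" "p \<in> carrier P" for m n p
      using h.formal_eval_rep_class [of "(m, n, p)"] that unfolding pure3_def by simp
  qed
qed

end

context tensor_product
begin

text \<open>Change of variables. It turns an identity between tensors into an identity between sums
  with an arbitrary balanced integrand.\<close>

lemma sweedler_pure_sum:
  assumes G: "comm_group G" and \<phi>: "balanced M N B r l G \<phi>"
    and f: "\<And>x y. x \<in> U \<Longrightarrow> y \<in> V \<Longrightarrow> f x y \<in> carrier M" "\<And>x y. x \<in> U \<Longrightarrow> y \<in> V \<Longrightarrow> g x y \<in> carrier N"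
  shows "sweedler (carrier M) (carrier N) G \<phi> (sweedler U V (tensor M N B r l) (\<lambda>x y. pure M N B r l (f x y) (g x y)) z)
       = sweedler U V G (\<lambda>x y. \<phi> (f x y) (g x y)) z"
proof -
  interpret T: comm_group "tensor M N B r l" by (rule tensor_comm_group)
  have "sweedler (carrier M) (carrier N) G \<phi> (sweedler U V (tensor M N B r l) (\<lambda>x y. pure M N B r l (f x y) (g x y)) z)
      = sweedler U V G (\<lambda>x y. sweedler (carrier M) (carrier N) G \<phi> (pure M N B r l (f x y) (g x y))) z"
    by (rule T.sweedler_comp [OF G sweedler_hom [OF G \<phi>]]) (auto intro: pure_closed f)
  also have "\<dots> = sweedler U V G (\<lambda>x y. \<phi> (f x y) (g x y)) z"
    by (rule sweedler_cong) (simp add: sweedler_pure [OF G \<phi>] f)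
  finally show ?thesis .
qed

end

context tensor3_product
begin

context
  fixes G :: "('g, 'u) monoid_scheme" and \<Psi> \<psi>
  assumes G: "comm_group G" and \<Psi>: "\<Psi> \<in> hom T3 G"
    and \<Psi>_pure3: "\<And>m n p. m \<in> carrier M \<Longrightarrow> n \<in> carrier N \<Longrightarrow> p \<in> carrier P \<Longrightarrow> \<Psi> (p3 m n p) = \<psi> m n p"
begin

interpretation T3: comm_group T3 by (rule comm_group)

text \<open>The outer \<open>tensor_eval\<close> is meaningful only if the inner sum is balanced in
  \<open>q\<close> and \<open>p\<close>. That is \<open>compat\<close>: \<open>D\<close> respects
  the right action of \<open>C\<close>, as seen through \<open>p3\<close>. Keeping \<open>Q\<close>
  apart from \<open>M\<close> and \<open>N\<close> leaves room for the mixed case, where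
  \<open>D\<close> is the coproduct of one bialgebroid and \<open>rQ\<close> belongs to the
  other.\<close>

lemma nested_eval_left:
  assumes QP: "tensor_product Q P C rQ lC"
    and D: "D \<in> hom (add_monoid Q) (tensor M N B rB lB)"
    and compat: "\<And>q c p. q \<in> carrier Q \<Longrightarrow> c \<in> carrier C \<Longrightarrow> p \<in> carrier P \<Longrightarrow>
      sweedler (carrier M) (carrier N) T3 (\<lambda>m n. p3 m n p) (D (rQ q c))
    = sweedler (carrier M) (carrier N) T3 (\<lambda>m n. p3 m n (lC c p)) (D q)"
    and z: "z \<in> carrier (tensor Q P C rQ lC)"
  shows "\<Psi> (tensor_eval T3 (\<lambda>(q, p). tensor_eval T3 (\<lambda>(m, n). p3 m n p) (D q)) z)
    = sweedler (carrier Q) (carrier P) G (\<lambda>q p. sweedler (carrier M) (carrier N) G (\<lambda>m n. \<psi> m n p) (D q)) z"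
proof -
  interpret QP: tensor_product Q P C rQ lC by (rule QP)
  let ?F = "\<lambda>q p. tensor_eval T3 (\<lambda>(m, n). p3 m n p) (D q)"
  let ?F' = "\<lambda>q p. sweedler (carrier M) (carrier N) T3 (\<lambda>m n. p3 m n p) (D q)"
  have bal: "balanced M N B rB lB T3 (\<lambda>m n. p3 m n p)" if "p \<in> carrier P" for p
    using pure3_tri_balanced that by (simp add: tri_balanced_def)
  have D_closed: "D q \<in> carrier (tensor M N B rB lB)" if "q \<in> carrier Q" for q
    using hom_in_carrier [OF D] that by simp
  have F: "?F q p = ?F' q p" if "q \<in> carrier Q" "p \<in> carrier P" for q p
    by (rule MN.tensor_eval_sweedler [OF comm_group bal D_closed]) (use that in auto)
  have F_closed: "?F' q p \<in> carrier T3" if "q \<in> carrier Q" "p \<in> carrier P" for q p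
    by (rule T3.sweedler_closed) (use that in \<open>auto intro: pure3_closed\<close>)
  have F_balanced: "balanced Q P C rQ lC T3 ?F"
    unfolding balanced_def
  proof (intro conjI ballI)
    fix q q' p assume *: "q \<in> carrier Q" "q' \<in> carrier Q" "p \<in> carrier P"
    then have "?F' (q \<oplus>\<^bsub>Q\<^esub> q') p = ?F' q p \<otimes>\<^bsub>T3\<^esub> ?F' q' p"
      using hom_mult [OF D, of q q'] hom_mult [OF MN.sweedler_hom [OF comm_group bal]] D_closed
      by simp
    then show "?F (q \<oplus>\<^bsub>Q\<^esub> q') p = ?F q p \<otimes>\<^bsub>T3\<^esub> ?F q' p" using * by (simp add: F)
  next
    fix q p p' assume *: "q \<in> carrier Q" "p \<in> carrier P" "p' \<in> carrier P"
    have "?F' q (p \<oplus>\<^bsub>P\<^esub> p')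
       = sweedler (carrier M) (carrier N) T3 (\<lambda>m n. p3 m n p \<otimes>\<^bsub>T3\<^esub> p3 m n p') (D q)"
      by (rule sweedler_cong)
        (use * pure3_tri_balanced in \<open>simp add: tri_balanced_def balanced_def\<close>)
    also have "\<dots> = ?F' q p \<otimes>\<^bsub>T3\<^esub> ?F' q p'"
      by (rule T3.sweedler_mult) (use * in \<open>auto intro: pure3_closed\<close>)
    finally show "?F q (p \<oplus>\<^bsub>P\<^esub> p') = ?F q p \<otimes>\<^bsub>T3\<^esub> ?F q p'" using * by (simp add: F)
  next
    fix q c p assume *: "q \<in> carrier Q" "c \<in> carrier C" "p \<in> carrier P"
    then show "?F (rQ q c) p = ?F q (lC c p)"
      by (simp add: F QP.right_closed QP.left_closed compat)
  qed (simp add: F F_closed)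
  have "\<Psi> (tensor_eval T3 (\<lambda>(q, p). ?F q p) z) = \<Psi> (sweedler (carrier Q) (carrier P) T3 ?F' z)"
    by (simp add: QP.tensor_eval_sweedler [OF comm_group F_balanced z] F cong: sweedler_cong)
  also have "\<dots> = sweedler (carrier Q) (carrier P) G (\<lambda>q p. \<Psi> (?F' q p)) z"
    by (rule T3.sweedler_comp [OF G \<Psi> F_closed])
  also have "\<dots> = sweedler (carrier Q) (carrier P) G
      (\<lambda>q p. sweedler (carrier M) (carrier N) G (\<lambda>m n. \<psi> m n p) (D q)) z"
  proof (rule sweedler_cong)
    fix q p assume *: "q \<in> carrier Q" "p \<in> carrier P"
    have "\<Psi> (?F' q p) = sweedler (carrier M) (carrier N) G (\<lambda>m n. \<Psi> (p3 m n p)) (D q)"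
      by (rule T3.sweedler_comp [OF G \<Psi>]) (auto intro: pure3_closed *)
    also have "\<dots> = sweedler (carrier M) (carrier N) G (\<lambda>m n. \<psi> m n p) (D q)"
      by (rule sweedler_cong) (simp add: \<Psi>_pure3 *)
    finally show "\<Psi> (?F' q p) = sweedler (carrier M) (carrier N) G (\<lambda>m n. \<psi> m n p) (D q)" .
  qed
  finally show ?thesis .
qed

lemma nested_eval_right:
  assumes MQ: "tensor_product M Q B rB lQ"
    and D: "D \<in> hom (add_monoid Q) (tensor N P C rC lC)"
    and compat: "\<And>q b m. q \<in> carrier Q \<Longrightarrow> b \<in> carrier B \<Longrightarrow> m \<in> carrier M \<Longrightarrow>
      sweedler (carrier N) (carrier P) T3 (\<lambda>n p. p3 m n p) (D (lQ b q))
    = sweedler (carrier N) (carrier P) T3 (\<lambda>n p. p3 (rB m b) n p) (D q)"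
    and z: "z \<in> carrier (tensor M Q B rB lQ)"
  shows "\<Psi> (tensor_eval T3 (\<lambda>(m, q). tensor_eval T3 (\<lambda>(n, p). p3 m n p) (D q)) z)
    = sweedler (carrier M) (carrier Q) G (\<lambda>m q. sweedler (carrier N) (carrier P) G (\<lambda>n p. \<psi> m n p) (D q)) z"
proof -
  interpret MQ: tensor_product M Q B rB lQ by (rule MQ)
  let ?F = "\<lambda>m q. tensor_eval T3 (\<lambda>(n, p). p3 m n p) (D q)"
  let ?F' = "\<lambda>m q. sweedler (carrier N) (carrier P) T3 (\<lambda>n p. p3 m n p) (D q)"
  have bal: "balanced N P C rC lC T3 (\<lambda>n p. p3 m n p)" if "m \<in> carrier M" for m
    using pure3_tri_balanced that by (simp add: tri_balanced_def)
  have D_closed: "D q \<in> carrier (tensor N P C rC lC)" if "q \<in> carrier Q" for q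
    using hom_in_carrier [OF D] that by simp
  have F: "?F m q = ?F' m q" if "q \<in> carrier Q" "m \<in> carrier M" for q m
    by (rule NP.tensor_eval_sweedler [OF comm_group bal D_closed]) (use that in auto)
  have F_closed: "?F' m q \<in> carrier T3" if "m \<in> carrier M" "q \<in> carrier Q" for q m
    by (rule T3.sweedler_closed) (use that in \<open>auto intro: pure3_closed\<close>)
  have F_balanced: "balanced M Q B rB lQ T3 ?F"
    unfolding balanced_def
  proof (intro conjI ballI)
    fix m q q' assume *: "m \<in> carrier M" "q \<in> carrier Q" "q' \<in> carrier Q"
    then have "?F' m (q \<oplus>\<^bsub>Q\<^esub> q') = ?F' m q \<otimes>\<^bsub>T3\<^esub> ?F' m q'"
      using hom_mult [OF D, of q q'] hom_mult [OF NP.sweedler_hom [OF comm_group bal]] D_closed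
      by simp
    then show "?F m (q \<oplus>\<^bsub>Q\<^esub> q') = ?F m q \<otimes>\<^bsub>T3\<^esub> ?F m q'" using * by (simp add: F)
  next
    fix m m' q assume *: "m \<in> carrier M" "m' \<in> carrier M" "q \<in> carrier Q"
    have "?F' (m \<oplus>\<^bsub>M\<^esub> m') q
       = sweedler (carrier N) (carrier P) T3 (\<lambda>n p. p3 m n p \<otimes>\<^bsub>T3\<^esub> p3 m' n p) (D q)"
      by (rule sweedler_cong)
        (use * pure3_tri_balanced in \<open>simp add: tri_balanced_def balanced_def\<close>)
    also have "\<dots> = ?F' m q \<otimes>\<^bsub>T3\<^esub> ?F' m' q"
      by (rule T3.sweedler_mult) (use * in \<open>auto intro: pure3_closed\<close>)
    finally show "?F (m \<oplus>\<^bsub>M\<^esub> m') q = ?F m q \<otimes>\<^bsub>T3\<^esub> ?F m' q" using * by (simp add: F)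
  next
    fix m b q assume *: "m \<in> carrier M" "b \<in> carrier B" "q \<in> carrier Q"
    then show "?F (rB m b) q = ?F m (lQ b q)"
      by (simp add: F MQ.right_closed MQ.left_closed compat)
  qed (simp add: F F_closed)
  have "\<Psi> (tensor_eval T3 (\<lambda>(m, q). ?F m q) z) = \<Psi> (sweedler (carrier M) (carrier Q) T3 ?F' z)"
    by (simp add: MQ.tensor_eval_sweedler [OF comm_group F_balanced z] F cong: sweedler_cong)
  also have "\<dots> = sweedler (carrier M) (carrier Q) G (\<lambda>m q. \<Psi> (?F' m q)) z"
    by (rule T3.sweedler_comp [OF G \<Psi> F_closed])
  also have "\<dots> = sweedler (carrier M) (carrier Q) G
      (\<lambda>m q. sweedler (carrier N) (carrier P) G (\<lambda>n p. \<psi> m n p) (D q)) z"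
  proof (rule sweedler_cong)
    fix m q assume *: "m \<in> carrier M" "q \<in> carrier Q"
    have "\<Psi> (?F' m q) = sweedler (carrier N) (carrier P) G (\<lambda>n p. \<Psi> (p3 m n p)) (D q)"
      by (rule T3.sweedler_comp [OF G \<Psi>]) (auto intro: pure3_closed *)
    also have "\<dots> = sweedler (carrier N) (carrier P) G (\<lambda>n p. \<psi> m n p) (D q)"
      by (rule sweedler_cong) (simp add: \<Psi>_pure3 *)
    finally show "\<Psi> (?F' m q) = sweedler (carrier N) (carrier P) G (\<lambda>n p. \<psi> m n p) (D q)" .
  qed
  finally show ?thesis .
qed

end

end

section \<open>Sweedler calculus in a coring\<close>

context coring
begin

sublocale T: tensor_product C C B r l
  by unfold_locales (auto intro: l_closed r_closed)

sublocale TT: tensor3_product C C C B r l B r l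
  by unfold_locales

abbreviation "TC \<equiv> tensor C C B r l"
abbreviation "sw G \<phi> c \<equiv> sweedler (carrier C) (carrier C) G \<phi> (\<Delta> c)"
abbreviation "bal G \<phi> \<equiv> balanced C C B r l G \<phi>"

lemma comult_closed: "c \<in> carrier C \<Longrightarrow> \<Delta> c \<in> carrier TC"
  using hom_in_carrier [OF comult_hom] by simp

lemma sw_add:
  assumes "comm_group G" "bal G \<phi>" "c \<in> carrier C" "d \<in> carrier C"
  shows "sw G \<phi> (c \<oplus>\<^bsub>C\<^esub> d) = sw G \<phi> c \<otimes>\<^bsub>G\<^esub> sw G \<phi> d"
  using hom_mult [OF comult_hom, of c d] hom_mult [OF T.sweedler_hom [OF assms(1,2)]] assms(3,4)
  by (simp add: comult_closed)

lemma sw_pure_sum: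
  assumes G: "comm_group G" and \<phi>: "bal G \<phi>"
    and f: "\<And>x y. x \<in> carrier C \<Longrightarrow> y \<in> carrier C \<Longrightarrow> f x y \<in> carrier C"
      "\<And>x y. x \<in> carrier C \<Longrightarrow> y \<in> carrier C \<Longrightarrow> g x y \<in> carrier C"
    and c: "c \<in> carrier C" "tensor_evals_to TC (\<lambda>(x, y). pure C C B r l (f x y) (g x y)) (\<Delta> c) z"
  shows "sweedler (carrier C) (carrier C) G \<phi> z = sw G (\<lambda>x y. \<phi> (f x y) (g x y)) c"
proof -
  have "sw TC (\<lambda>x y. pure C C B r l (f x y) (g x y)) c = z"
    by (rule T.sweedler_evals_toD [OF comult_closed T.tensor_comm_group _ c(2)])
      (auto intro: T.pure_closed f c)
  moreover have "sweedler (carrier C) (carrier C) G \<phi> (sw TC (\<lambda>x y. pure C C B r l (f x y) (g x y)) c)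
      = sw G (\<lambda>x y. \<phi> (f x y) (g x y)) c"
    by (rule T.sweedler_pure_sum [OF G \<phi>]) (auto intro: f)
  ultimately show ?thesis by simp
qed

lemma sw_left:
  assumes "comm_group G" "bal G \<phi>" "b \<in> carrier B" "c \<in> carrier C"
  shows "sw G \<phi> (l b c) = sw G (\<lambda>x y. \<phi> (l b x) y) c"
  by (rule sw_pure_sum [OF assms(1,2)]) (use assms(3,4) comult_left l_closed in auto)

lemma sw_right:
  assumes "comm_group G" "bal G \<phi>" "b \<in> carrier B" "c \<in> carrier C"
  shows "sw G \<phi> (r c b) = sw G (\<lambda>x y. \<phi> x (r y b)) c"
  by (rule sw_pure_sum [OF assms(1,2)]) (use assms(3,4) comult_right r_closed in auto)

lemma additive_monoid: "comm_group (add_monoid C)"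
  by (rule M.a_comm_group)

lemma counit_closed: "c \<in> carrier C \<Longrightarrow> \<epsilon> c \<in> carrier B"
  using hom_in_carrier [OF counit_hom] by simp

lemma sw_counit_left: "c \<in> carrier C \<Longrightarrow> sw (add_monoid C) (\<lambda>x y. l (\<epsilon> x) y) c = c"
  by (rule T.sweedler_evals_toD [OF comult_closed additive_monoid _ counital_left])
    (auto intro: l_closed counit_closed)

lemma sw_counit_right: "c \<in> carrier C \<Longrightarrow> sw (add_monoid C) (\<lambda>x y. r x (\<epsilon> y)) c = c"
  by (rule T.sweedler_evals_toD [OF comult_closed additive_monoid _ counital_right])
    (auto intro: r_closed counit_closed)

lemma sw_coassoc:
  assumes G: "comm_group G" and \<psi>: "tri_balanced C C C B r l B r l G \<psi>" and c: "c \<in> carrier C"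
  shows "sw G (\<lambda>x y. sw G (\<lambda>x1 x2. \<psi> x1 x2 y) x) c = sw G (\<lambda>x y. sw G (\<lambda>y1 y2. \<psi> x y1 y2) y) c"
proof -
  obtain \<Psi> where \<Psi>: "\<Psi> \<in> hom TT.T3 G" "\<And>x y z. x \<in> carrier C \<Longrightarrow> y \<in> carrier C \<Longrightarrow>
      z \<in> carrier C \<Longrightarrow> \<Psi> (TT.p3 x y z) = \<psi> x y z"
    using TT.tri_balanced_factor [OF G \<psi>] by blast
  have p3: "bal TT.T3 (\<lambda>x y. TT.p3 x y z)" "bal TT.T3 (TT.p3 z)" if "z \<in> carrier C" for z
    using TT.pure3_tri_balanced that by (simp_all add: tri_balanced_def)
  \<comment> \<open>Linearity of the coproduct puts \<open>b\<close> on the second leg, and the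
    second tensor sign hands it over to \<open>p\<close>. The mirror image \<open>R\<close> moves it
    to \<open>m\<close> through the first leg.\<close>
  have L: "sw TT.T3 (\<lambda>m n. TT.p3 m n p) (r q b) = sw TT.T3 (\<lambda>m n. TT.p3 m n (l b p)) q"
    if "q \<in> carrier C" "b \<in> carrier B" "p \<in> carrier C" for q b p
    unfolding sw_right [OF TT.comm_group p3(1) [OF that(3)] that(2,1)]
    by (rule sweedler_cong) (use p3(2) that in \<open>simp add: balanced_def\<close>)
  have R: "sw TT.T3 (\<lambda>n p. TT.p3 m n p) (l b q) = sw TT.T3 (\<lambda>n p. TT.p3 (r m b) n p) q"
    if "q \<in> carrier C" "b \<in> carrier B" "m \<in> carrier C" for q b m
    unfolding sw_left [OF TT.comm_group p3(2) [OF that(3)] that(2,1)]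
    by (rule sweedler_cong) (use p3(1) that in \<open>simp add: balanced_def\<close>)
  show ?thesis
    using TT.nested_eval_left [OF G \<Psi> T.tensor_product_axioms comult_hom L comult_closed [OF c]]
      TT.nested_eval_right [OF G \<Psi> T.tensor_product_axioms comult_hom R comult_closed [OF c]]
      coassociative [OF c] by simp
qed

end

section \<open>Corings with a multiplicative coproduct\<close>

text \<open>Left and right bialgebroids differ in their bimodule actions, Takeuchi conditions and
  counit laws, but the unit and product rules of the coproduct have the same form. Their
  consequences are proved once here.\<close>

locale multiplicative_coring = coring B C l r \<Delta> \<epsilon> + ring C
  for B :: "('b, 'x) ring_scheme" and C :: "('c, 'y) ring_scheme" and l r \<Delta> \<epsilon> +
  assumes comult_one: "\<Delta> \<one>\<^bsub>C\<^esub> = pure C C B r l \<one>\<^bsub>C\<^esub> \<one>\<^bsub>C\<^esub>"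
    and comult_mult: "\<lbrakk>h \<in> carrier C; g \<in> carrier C; u \<in> \<Delta> h; v \<in> \<Delta> g\<rbrakk> \<Longrightarrow>
          \<Delta> (h \<otimes>\<^bsub>C\<^esub> g) =
            formal_eval (tensor C C B r l)
              (\<lambda>(x, y). formal_eval (tensor C C B r l)
                 (\<lambda>(x', y'). pure C C B r l (x \<otimes>\<^bsub>C\<^esub> x') (y \<otimes>\<^bsub>C\<^esub> y')) v) u"
begin

lemma frag_in_pure: "x \<in> carrier C \<Longrightarrow> y \<in> carrier C \<Longrightarrow> frag_of (x, y) \<in> pure C C B r l x y"
  unfolding pure_def by (rule T.in_class) (simp add: keys_frag_of)

text \<open>Linearity of \<open>\<Delta>\<close> is evaluated at the single-generator representative
  of \<open>\<Delta> 1\<close>. It yields the coproduct of \<open>sL b\<close> in the left and of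
  \<open>tR b\<close> in the right bialgebroid; the companion below yields those of
  \<open>tL b\<close> and \<open>sR b\<close>.\<close>

lemma comult_left_one:
  assumes "b \<in> carrier B"
  shows "\<Delta> (l b \<one>\<^bsub>C\<^esub>) = pure C C B r l (l b \<one>\<^bsub>C\<^esub>) \<one>\<^bsub>C\<^esub>"
proof -
  have "frag_of (\<one>\<^bsub>C\<^esub>, \<one>\<^bsub>C\<^esub>) \<in> \<Delta> \<one>\<^bsub>C\<^esub>" by (simp add: comult_one frag_in_pure)
  then have "formal_eval TC (\<lambda>(x, y). pure C C B r l (l b x) y) (frag_of (\<one>\<^bsub>C\<^esub>, \<one>\<^bsub>C\<^esub>)) = \<Delta> (l b \<one>\<^bsub>C\<^esub>)"
    using comult_left [OF assms one_closed] by (auto simp: tensor_evals_to_def)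
  then show ?thesis
    using assms by (subst (asm) comm_group.formal_eval_frag_of [OF T.tensor_comm_group])
      (auto intro: T.pure_closed l_closed)
qed

lemma comult_right_one:
  assumes "b \<in> carrier B"
  shows "\<Delta> (r \<one>\<^bsub>C\<^esub> b) = pure C C B r l \<one>\<^bsub>C\<^esub> (r \<one>\<^bsub>C\<^esub> b)"
proof -
  have "frag_of (\<one>\<^bsub>C\<^esub>, \<one>\<^bsub>C\<^esub>) \<in> \<Delta> \<one>\<^bsub>C\<^esub>" by (simp add: comult_one frag_in_pure)
  then have "formal_eval TC (\<lambda>(x, y). pure C C B r l x (r y b)) (frag_of (\<one>\<^bsub>C\<^esub>, \<one>\<^bsub>C\<^esub>)) = \<Delta> (r \<one>\<^bsub>C\<^esub> b)"
    using comult_right [OF assms one_closed] by (auto simp: tensor_evals_to_def)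
  then show ?thesis
    using assms by (subst (asm) comm_group.formal_eval_frag_of [OF T.tensor_comm_group])
      (auto intro: T.pure_closed r_closed)
qed

lemma sw_one:
  assumes "comm_group G" "bal G \<phi>"
  shows "sw G \<phi> \<one>\<^bsub>C\<^esub> = \<phi> \<one>\<^bsub>C\<^esub> \<one>\<^bsub>C\<^esub>"
  unfolding comult_one by (rule T.sweedler_pure [OF assms]) auto

context
  fixes G :: "('g, 'u) monoid_scheme" and \<phi>
  assumes G: "comm_group G" and \<phi>: "bal G \<phi>"
begin

interpretation G: comm_group G by (rule G)
interpretation TC: comm_group TC by (rule T.tensor_comm_group)

text \<open>The integrand need not be balanced in both pairs of variables, so arbitrary
  representatives \<open>u\<close> and \<open>v\<close> are kept, as \<open>comult_mult\<close>
  provides them. \<open>sw_mult\<close> takes those chosen by \<open>rep\<close>; a pure coproduct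
  allows a better choice.\<close>

lemma formal_eval_pure_mult:
  assumes h: "h \<in> carrier C" and g: "g \<in> carrier C" and u: "u \<in> \<Delta> h" and v: "v \<in> \<Delta> g"
  shows "sw G \<phi> (h \<otimes>\<^bsub>C\<^esub> g) =
    formal_eval G (\<lambda>(x, y). formal_eval G (\<lambda>(x', y'). \<phi> (x \<otimes>\<^bsub>C\<^esub> x') (y \<otimes>\<^bsub>C\<^esub> y')) v) u"
proof -
  let ?p = "\<lambda>q q'. pure C C B r l (fst q \<otimes>\<^bsub>C\<^esub> fst q') (snd q \<otimes>\<^bsub>C\<^esub> snd q')"
  have uv: "Poly_Mapping.keys u \<subseteq> carrier C \<times> carrier C" "Poly_Mapping.keys v \<subseteq> carrier C \<times> carrier C"
    using T.mem_presented(1) comult_closed h g u v unfolding tensor_def by blast+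
  have p: "?p q q' \<in> carrier TC" if "q \<in> Poly_Mapping.keys u" "q' \<in> Poly_Mapping.keys v" for q q'
    using that uv by (intro T.pure_closed m_closed) auto
  have hom: "sweedler (carrier C) (carrier C) G \<phi> \<in> hom TC G" by (rule T.sweedler_hom [OF G \<phi>])
  have \<phi>_p: "sweedler (carrier C) (carrier C) G \<phi> (?p q q') = \<phi> (fst q \<otimes>\<^bsub>C\<^esub> fst q') (snd q \<otimes>\<^bsub>C\<^esub> snd q')"
    if "q \<in> Poly_Mapping.keys u" "q' \<in> Poly_Mapping.keys v" for q q'
    using that uv by (intro T.sweedler_pure [OF G \<phi>] m_closed) auto
  have \<phi>_closed: "\<phi> (fst q \<otimes>\<^bsub>C\<^esub> fst q') (snd q \<otimes>\<^bsub>C\<^esub> snd q') \<in> carrier G"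
    if "q \<in> Poly_Mapping.keys u" "q' \<in> Poly_Mapping.keys v" for q q'
    using that uv by (intro balanced_closed [OF \<phi>] m_closed) auto
  have "\<Delta> (h \<otimes>\<^bsub>C\<^esub> g) = formal_eval TC (\<lambda>q. formal_eval TC (?p q) v) u"
    by (simp add: comult_mult [OF h g u v] case_prod_unfold)
  then have "sw G \<phi> (h \<otimes>\<^bsub>C\<^esub> g)
      = formal_eval G (\<lambda>q. sweedler (carrier C) (carrier C) G \<phi> (formal_eval TC (?p q) v)) u"
    using p by (simp add: TC.formal_eval_comp [OF G hom] TC.formal_eval_closed)
  also have "\<dots> = formal_eval G (\<lambda>q. formal_eval G (\<lambda>q'. \<phi> (fst q \<otimes>\<^bsub>C\<^esub> fst q') (snd q \<otimes>\<^bsub>C\<^esub> snd q')) v) u"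
  proof (rule G.formal_eval_cong)
    fix q assume q: "q \<in> Poly_Mapping.keys u"
    have "sweedler (carrier C) (carrier C) G \<phi> (formal_eval TC (?p q) v)
       = formal_eval G (\<lambda>q'. sweedler (carrier C) (carrier C) G \<phi> (?p q q')) v"
      by (rule TC.formal_eval_comp [OF G hom]) (use p q in blast)
    also have "\<dots> = formal_eval G (\<lambda>q'. \<phi> (fst q \<otimes>\<^bsub>C\<^esub> fst q') (snd q \<otimes>\<^bsub>C\<^esub> snd q')) v"
      by (rule G.formal_eval_cong) (use \<phi>_p \<phi>_closed q in auto)
    finally show "sweedler (carrier C) (carrier C) G \<phi> (formal_eval TC (?p q) v)
       = formal_eval G (\<lambda>q'. \<phi> (fst q \<otimes>\<^bsub>C\<^esub> fst q') (snd q \<otimes>\<^bsub>C\<^esub> snd q')) v" .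
  qed (use \<phi>_closed in \<open>blast intro: G.formal_eval_closed\<close>)
  finally show ?thesis by (simp add: case_prod_unfold)
qed

lemma comult_rep_in: "h \<in> carrier C \<Longrightarrow> rep (carrier C \<times> carrier C) (\<Delta> h) \<in> \<Delta> h"
  using T.rep_mem comult_closed unfolding tensor_def by blast

lemma sw_mult:
  assumes h: "h \<in> carrier C" and g: "g \<in> carrier C"
  shows "sw G \<phi> (h \<otimes>\<^bsub>C\<^esub> g) = sw G (\<lambda>x y. sw G (\<lambda>x' y'. \<phi> (x \<otimes>\<^bsub>C\<^esub> x') (y \<otimes>\<^bsub>C\<^esub> y')) g) h"
proof -
  let ?u = "rep (carrier C \<times> carrier C) (\<Delta> h)" and ?v = "rep (carrier C \<times> carrier C) (\<Delta> g)"
  have closed: "\<phi> (x \<otimes>\<^bsub>C\<^esub> x') (y \<otimes>\<^bsub>C\<^esub> y') \<in> carrier G"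
    if "x \<in> carrier C" "y \<in> carrier C" "x' \<in> carrier C" "y' \<in> carrier C" for x y x' y'
    using that by (intro balanced_closed [OF \<phi>] m_closed)
  have "sw G (\<lambda>x y. sw G (\<lambda>x' y'. \<phi> (x \<otimes>\<^bsub>C\<^esub> x') (y \<otimes>\<^bsub>C\<^esub> y')) g) h
      = sw G (\<lambda>x y. formal_eval G (\<lambda>(x', y'). \<phi> (x \<otimes>\<^bsub>C\<^esub> x') (y \<otimes>\<^bsub>C\<^esub> y')) ?v) h"
    by (intro sweedler_cong G.sweedler_eq closed)
  also have "\<dots> = formal_eval G (\<lambda>(x, y). formal_eval G (\<lambda>(x', y'). \<phi> (x \<otimes>\<^bsub>C\<^esub> x') (y \<otimes>\<^bsub>C\<^esub> y')) ?v) ?u"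
  proof (rule G.sweedler_eq)
    fix x y assume "x \<in> carrier C" "y \<in> carrier C"
    then show "formal_eval G (\<lambda>(x', y'). \<phi> (x \<otimes>\<^bsub>C\<^esub> x') (y \<otimes>\<^bsub>C\<^esub> y')) ?v \<in> carrier G"
      by (intro G.formal_eval_closed) (auto dest: rep_Times_D intro: closed)
  qed
  also have "\<dots> = sw G \<phi> (h \<otimes>\<^bsub>C\<^esub> g)"
    by (rule formal_eval_pure_mult [OF h g comult_rep_in comult_rep_in, symmetric]) (fact h g)+
  finally show ?thesis ..
qed

text \<open>With \<open>frag_of (a, b)\<close> as the representative of \<open>\<Delta> g\<close>,
  the inner sum collapses to one term.\<close>

lemma sw_mult_pure_right:
  assumes h: "h \<in> carrier C" and g: "g \<in> carrier C"
    and ab: "a \<in> carrier C" "b \<in> carrier C" "\<Delta> g = pure C C B r l a b"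
  shows "sw G \<phi> (h \<otimes>\<^bsub>C\<^esub> g) = sw G (\<lambda>x y. \<phi> (x \<otimes>\<^bsub>C\<^esub> a) (y \<otimes>\<^bsub>C\<^esub> b)) h"
proof -
  let ?u = "rep (carrier C \<times> carrier C) (\<Delta> h)"
  have closed: "\<phi> (x \<otimes>\<^bsub>C\<^esub> a) (y \<otimes>\<^bsub>C\<^esub> b) \<in> carrier G"
    if "x \<in> carrier C" "y \<in> carrier C" for x y
    using that ab by (intro balanced_closed [OF \<phi>] m_closed)
  have "sw G (\<lambda>x y. \<phi> (x \<otimes>\<^bsub>C\<^esub> a) (y \<otimes>\<^bsub>C\<^esub> b)) h
      = formal_eval G (\<lambda>(x, y). \<phi> (x \<otimes>\<^bsub>C\<^esub> a) (y \<otimes>\<^bsub>C\<^esub> b)) ?u"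
    by (intro G.sweedler_eq closed)
  also have "\<dots> = formal_eval G (\<lambda>(x, y). formal_eval G (\<lambda>(x', y'). \<phi> (x \<otimes>\<^bsub>C\<^esub> x') (y \<otimes>\<^bsub>C\<^esub> y')) (frag_of (a, b))) ?u"
  proof (rule G.formal_eval_cong)
    fix p assume "p \<in> Poly_Mapping.keys ?u"
    then have p: "p \<in> carrier C \<times> carrier C" by (rule subsetD [OF keys_rep])
    then show "(case p of (x, y) \<Rightarrow> \<phi> (x \<otimes>\<^bsub>C\<^esub> a) (y \<otimes>\<^bsub>C\<^esub> b))
      = (case p of (x, y) \<Rightarrow> formal_eval G (\<lambda>(x', y'). \<phi> (x \<otimes>\<^bsub>C\<^esub> x') (y \<otimes>\<^bsub>C\<^esub> y')) (frag_of (a, b)))"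
      by (auto simp: G.formal_eval_frag_of closed)
  next
    have "formal_eval G (\<lambda>(x', y'). \<phi> (x \<otimes>\<^bsub>C\<^esub> x') (y \<otimes>\<^bsub>C\<^esub> y')) (frag_of (a, b)) \<in> carrier G"
      if "(x, y) \<in> Poly_Mapping.keys ?u" for x y
      using rep_Times_D [OF that] by (simp add: G.formal_eval_frag_of closed)
    then show "(\<lambda>(x, y). formal_eval G (\<lambda>(x', y'). \<phi> (x \<otimes>\<^bsub>C\<^esub> x') (y \<otimes>\<^bsub>C\<^esub> y')) (frag_of (a, b)))
        \<in> Poly_Mapping.keys ?u \<rightarrow> carrier G"
      by auto
  qed
  also have "\<dots> = sw G \<phi> (h \<otimes>\<^bsub>C\<^esub> g)"
    by (rule formal_eval_pure_mult [OF h g comult_rep_in, symmetric]) (simp_all add: ab frag_in_pure h)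
  finally show ?thesis ..
qed

lemma sw_mult_pure_left:
  assumes h: "h \<in> carrier C" and g: "g \<in> carrier C"
    and ab: "a \<in> carrier C" "b \<in> carrier C" "\<Delta> h = pure C C B r l a b"
  shows "sw G \<phi> (h \<otimes>\<^bsub>C\<^esub> g) = sw G (\<lambda>x y. \<phi> (a \<otimes>\<^bsub>C\<^esub> x) (b \<otimes>\<^bsub>C\<^esub> y)) g"
proof -
  let ?v = "rep (carrier C \<times> carrier C) (\<Delta> g)"
  have closed: "\<phi> (a \<otimes>\<^bsub>C\<^esub> x) (b \<otimes>\<^bsub>C\<^esub> y) \<in> carrier G"
    if "x \<in> carrier C" "y \<in> carrier C" for x y
    using that ab by (intro balanced_closed [OF \<phi>] m_closed)
  have "sw G (\<lambda>x y. \<phi> (a \<otimes>\<^bsub>C\<^esub> x) (b \<otimes>\<^bsub>C\<^esub> y)) g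
      = formal_eval G (\<lambda>(x, y). \<phi> (a \<otimes>\<^bsub>C\<^esub> x) (b \<otimes>\<^bsub>C\<^esub> y)) ?v"
    by (intro G.sweedler_eq closed)
  also have "\<dots> = formal_eval G (\<lambda>(x, y). formal_eval G (\<lambda>(x', y'). \<phi> (x \<otimes>\<^bsub>C\<^esub> x') (y \<otimes>\<^bsub>C\<^esub> y')) ?v) (frag_of (a, b))"
    by (subst G.formal_eval_frag_of)
      (auto intro!: G.formal_eval_closed closed dest: rep_Times_D)
  also have "\<dots> = sw G \<phi> (h \<otimes>\<^bsub>C\<^esub> g)"
    by (rule formal_eval_pure_mult [OF h g _ comult_rep_in, symmetric]) (simp_all add: ab frag_in_pure g)
  finally show ?thesis ..
qed

end

end

lemma kalgebra_hom_closed: "f \<in> kalgebra_hom K A B \<Longrightarrow> x \<in> carrier A \<Longrightarrow> f x \<in> carrier B"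
  by (auto simp: kalgebra_hom_def ring_hom_def)

context left_bialgebroid
begin

sublocale multiplicative_coring L H "left_lact H s" "left_ract H t" \<Delta> \<epsilon>
  by unfold_locales (rule comult_one comult_mult; assumption)+

lemma s_closed [simp, intro]: "a \<in> carrier L \<Longrightarrow> s a \<in> carrier H"
  by (rule kalgebra_hom_closed [OF source_hom])

lemma t_closed [simp, intro]: "a \<in> carrier L \<Longrightarrow> t a \<in> carrier H"
  by (rule kalgebra_hom_closed [OF target_hom]) (simp add: opp_def)

text \<open>Right multiplication in one leg commutes with the left multiplications over which the
  tensor product is balanced. Hence both sides of the axiom are genuine Sweedler sums in
  \<open>TC\<close>, and \<open>\<phi>\<close> is reached by a change of variables.\<close>

lemma sw_takeuchi:
  assumes G: "comm_group G" and \<phi>: "bal G \<phi>" and h: "h \<in> carrier H" and a: "a \<in> carrier L"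
  shows "sw G (\<lambda>x y. \<phi> (x \<otimes>\<^bsub>H\<^esub> t a) y) h = sw G (\<lambda>x y. \<phi> x (y \<otimes>\<^bsub>H\<^esub> s a)) h"
proof -
  let ?p = "left_pure H L s t"
  note p = T.pure_balanced
  have 1: "bal TC (\<lambda>x y. ?p (x \<otimes>\<^bsub>H\<^esub> t a) y)"
    using p a unfolding balanced_def by (simp add: l_distr left_ract_def left_lact_def m_assoc)
  have 2: "bal TC (\<lambda>x y. ?p x (y \<otimes>\<^bsub>H\<^esub> s a))"
    using p a unfolding balanced_def by (simp add: l_distr left_ract_def left_lact_def m_assoc)
  have "sw TC (\<lambda>x y. ?p (x \<otimes>\<^bsub>H\<^esub> t a) y) h = sw TC (\<lambda>x y. ?p x (y \<otimes>\<^bsub>H\<^esub> s a)) h"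
    using takeuchi [OF h a]
    by (simp add: T.tensor_eval_sweedler [OF T.tensor_comm_group 1 comult_closed [OF h]]
      T.tensor_eval_sweedler [OF T.tensor_comm_group 2 comult_closed [OF h]])
  then show ?thesis
    using T.sweedler_pure_sum [OF G \<phi>, of "carrier H" "carrier H" "\<lambda>x y. x \<otimes>\<^bsub>H\<^esub> t a" "\<lambda>x y. y" "\<Delta> h"]
      T.sweedler_pure_sum [OF G \<phi>, of "carrier H" "carrier H" "\<lambda>x y. x" "\<lambda>x y. y \<otimes>\<^bsub>H\<^esub> s a" "\<Delta> h"] a
    by simp
qed

end

context right_bialgebroid
begin

sublocale multiplicative_coring R H "right_lact H t" "right_ract H s" \<Delta> \<epsilon>
  by unfold_locales (rule comult_one comult_mult; assumption)+

lemma s_closed [simp, intro]: "a \<in> carrier R \<Longrightarrow> s a \<in> carrier H"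
  by (rule kalgebra_hom_closed [OF source_hom])

lemma t_closed [simp, intro]: "a \<in> carrier R \<Longrightarrow> t a \<in> carrier H"
  by (rule kalgebra_hom_closed [OF target_hom]) (simp add: opp_def)

lemma sw_takeuchi:
  assumes G: "comm_group G" and \<phi>: "bal G \<phi>" and h: "h \<in> carrier H" and a: "a \<in> carrier R"
  shows "sw G (\<lambda>x y. \<phi> (s a \<otimes>\<^bsub>H\<^esub> x) y) h = sw G (\<lambda>x y. \<phi> x (t a \<otimes>\<^bsub>H\<^esub> y)) h"
proof -
  let ?p = "right_pure H R s t"
  note p = T.pure_balanced
  have 1: "bal TC (\<lambda>x y. ?p (s a \<otimes>\<^bsub>H\<^esub> x) y)"
    using p a unfolding balanced_def by (simp add: r_distr right_ract_def right_lact_def flip: m_assoc)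
  have 2: "bal TC (\<lambda>x y. ?p x (t a \<otimes>\<^bsub>H\<^esub> y))"
    using p a unfolding balanced_def by (simp add: r_distr right_ract_def right_lact_def flip: m_assoc)
  have "sw TC (\<lambda>x y. ?p (s a \<otimes>\<^bsub>H\<^esub> x) y) h = sw TC (\<lambda>x y. ?p x (t a \<otimes>\<^bsub>H\<^esub> y)) h"
    using takeuchi [OF h a]
    by (simp add: T.tensor_eval_sweedler [OF T.tensor_comm_group 1 comult_closed [OF h]]
      T.tensor_eval_sweedler [OF T.tensor_comm_group 2 comult_closed [OF h]])
  then show ?thesis
    using T.sweedler_pure_sum [OF G \<phi>, of "carrier H" "carrier H" "\<lambda>x y. s a \<otimes>\<^bsub>H\<^esub> x" "\<lambda>x y. y" "\<Delta> h"]
      T.sweedler_pure_sum [OF G \<phi>, of "carrier H" "carrier H" "\<lambda>x y. x" "\<lambda>x y. t a \<otimes>\<^bsub>H\<^esub> y" "\<Delta> h"] a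
    by simp
qed

end

section \<open>Sweedler sums in abelian groups and rings\<close>

context abelian_group
begin

lemma sweedler_sum_closed:
  assumes "\<And>x y. x \<in> U \<Longrightarrow> y \<in> V \<Longrightarrow> \<phi> x y \<in> carrier G"
  shows "sweedler U V (add_monoid G) \<phi> z \<in> carrier G"
  using comm_group.sweedler_closed [OF a_comm_group, of U V \<phi> z] assms by simp

lemma sweedler_sum_add:
  assumes "\<And>x y. x \<in> U \<Longrightarrow> y \<in> V \<Longrightarrow> \<phi> x y \<in> carrier G"
    and "\<And>x y. x \<in> U \<Longrightarrow> y \<in> V \<Longrightarrow> \<psi> x y \<in> carrier G"
  shows "sweedler U V (add_monoid G) (\<lambda>x y. \<phi> x y \<oplus> \<psi> x y) z
       = sweedler U V (add_monoid G) \<phi> z \<oplus> sweedler U V (add_monoid G) \<psi> z"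
  using comm_group.sweedler_mult [OF a_comm_group, of U V \<phi> \<psi> z] assms by simp

lemma sweedler_sum_swap:
  assumes "\<And>x y x' y'. x \<in> U \<Longrightarrow> y \<in> V \<Longrightarrow> x' \<in> U' \<Longrightarrow> y' \<in> V' \<Longrightarrow> \<phi> x y x' y' \<in> carrier G"
  shows "sweedler U V (add_monoid G) (\<lambda>x y. sweedler U' V' (add_monoid G) (\<lambda>x' y'. \<phi> x y x' y') w) z
       = sweedler U' V' (add_monoid G) (\<lambda>x' y'. sweedler U V (add_monoid G) (\<lambda>x y. \<phi> x y x' y') z) w"
  using comm_group.sweedler_swap [OF a_comm_group, of U V U' V' \<phi> w z] assms by simp

text \<open>Both sides use the same representative, so additivity of \<open>f\<close> alone
  suffices. This rule moves products, actions, the antipode and module maps across Sweedler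
  sums.\<close>

lemma sweedler_sum_additive:
  assumes "abelian_group N" and "\<And>x. x \<in> carrier G \<Longrightarrow> f x \<in> carrier N"
    and "\<And>x y. x \<in> carrier G \<Longrightarrow> y \<in> carrier G \<Longrightarrow> f (x \<oplus> y) = f x \<oplus>\<^bsub>N\<^esub> f y"
    and "\<And>x y. x \<in> U \<Longrightarrow> y \<in> V \<Longrightarrow> \<phi> x y \<in> carrier G"
  shows "f (sweedler U V (add_monoid G) \<phi> z) = sweedler U V (add_monoid N) (\<lambda>x y. f (\<phi> x y)) z"
proof (rule comm_group.sweedler_comp [OF a_comm_group])
  show "comm_group (add_monoid N)" by (rule abelian_group.a_comm_group [OF assms(1)])
  show "f \<in> hom (add_monoid G) (add_monoid N)"
    by (rule homI) (use assms in auto)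
qed (use assms in auto)

end

context ring
begin

lemma sweedler_sum_mult_left:
  assumes "c \<in> carrier R" "\<And>x y. x \<in> U \<Longrightarrow> y \<in> V \<Longrightarrow> \<phi> x y \<in> carrier R"
  shows "c \<otimes> sweedler U V (add_monoid R) \<phi> z = sweedler U V (add_monoid R) (\<lambda>x y. c \<otimes> \<phi> x y) z"
  by (rule sweedler_sum_additive) (use assms in \<open>auto simp: r_distr is_abelian_group\<close>)

lemma sweedler_sum_mult_right:
  assumes "c \<in> carrier R" "\<And>x y. x \<in> U \<Longrightarrow> y \<in> V \<Longrightarrow> \<phi> x y \<in> carrier R"
  shows "sweedler U V (add_monoid R) \<phi> z \<otimes> c = sweedler U V (add_monoid R) (\<lambda>x y. \<phi> x y \<otimes> c) z"
  by (rule sweedler_sum_additive) (use assms in \<open>auto simp: l_distr is_abelian_group\<close>)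

end

section \<open>The antipode\<close>

context hopf_algebroid
begin

abbreviation mult_H (infixl "\<cdot>" 70) where "x \<cdot> y \<equiv> x \<otimes>\<^bsub>H\<^esub> y"
abbreviation "SL M \<phi> h \<equiv> left.sw (add_monoid M) \<phi> h"
abbreviation "SR M \<phi> h \<equiv> right.sw (add_monoid M) \<phi> h"

lemma \<epsilon>L_closed [simp, intro]: "h \<in> carrier H \<Longrightarrow> \<epsilon>L h \<in> carrier L"
  by (rule left.counit_closed)

lemma \<epsilon>R_closed [simp, intro]: "h \<in> carrier H \<Longrightarrow> \<epsilon>R h \<in> carrier R"
  by (rule right.counit_closed)

lemma S_closed [simp, intro]: "h \<in> carrier H \<Longrightarrow> S h \<in> carrier H"
  using hom_in_carrier [OF antipode_hom] by simp

lemma S_add: "h \<in> carrier H \<Longrightarrow> g \<in> carrier H \<Longrightarrow> S (h \<oplus>\<^bsub>H\<^esub> g) = S h \<oplus>\<^bsub>H\<^esub> S g"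
  using hom_mult [OF antipode_hom] by simp

lemma sL_hom: "sL \<in> ring_hom L H" and sR_hom: "sR \<in> ring_hom R H"
  using left.source_hom right.source_hom by (simp_all add: kalgebra_hom_def)

lemma tL_hom: "tL \<in> ring_hom (opp L) H" and tR_hom: "tR \<in> ring_hom (opp R) H"
  using left.target_hom right.target_hom by (simp_all add: kalgebra_hom_def)

lemma base_one: "sL \<one>\<^bsub>L\<^esub> = \<one>\<^bsub>H\<^esub>" "tL \<one>\<^bsub>L\<^esub> = \<one>\<^bsub>H\<^esub>" "sR \<one>\<^bsub>R\<^esub> = \<one>\<^bsub>H\<^esub>" "tR \<one>\<^bsub>R\<^esub> = \<one>\<^bsub>H\<^esub>"
  using ring_hom_one [OF sL_hom] ring_hom_one [OF tL_hom] ring_hom_one [OF sR_hom] ring_hom_one [OF tR_hom]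
  by (simp_all add: opp_def)

lemma tR_mult: "a \<in> carrier R \<Longrightarrow> b \<in> carrier R \<Longrightarrow> tR (a \<otimes>\<^bsub>R\<^esub> b) = tR b \<cdot> tR a"
  using ring_hom_mult [OF tR_hom, of b a] by (simp add: opp_def)

lemma tR_add: "a \<in> carrier R \<Longrightarrow> b \<in> carrier R \<Longrightarrow> tR (a \<oplus>\<^bsub>R\<^esub> b) = tR a \<oplus>\<^bsub>H\<^esub> tR b"
  using ring_hom_add [OF tR_hom, of a b] by (simp add: opp_def)

lemma sR_eq_tL:
  assumes "a \<in> carrier R" obtains b where "b \<in> carrier L" "sR a = tL b"
  using tL_\<epsilon>L_sR [OF assms] assms by (metis \<epsilon>L_closed right.s_closed)

lemma tR_eq_sL:
  assumes "a \<in> carrier R" obtains b where "b \<in> carrier L" "tR a = sL b"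
  using sL_\<epsilon>L_tR [OF assms] assms by (metis \<epsilon>L_closed right.t_closed)

lemma tL_eq_sR:
  assumes "a \<in> carrier L" obtains b where "b \<in> carrier R" "tL a = sR b"
  using sR_\<epsilon>R_tL [OF assms] assms by (metis \<epsilon>R_closed left.t_closed)

lemma sL_eq_tR:
  assumes "a \<in> carrier L" obtains b where "b \<in> carrier R" "sL a = tR b"
  using tR_\<epsilon>R_sL [OF assms] assms by (metis \<epsilon>R_closed left.s_closed)

lemma sR_sL_commute: "a \<in> carrier R \<Longrightarrow> b \<in> carrier L \<Longrightarrow> sL b \<cdot> sR a = sR a \<cdot> sL b"
  by (metis sR_eq_tL left.source_target_commute)

lemma left_bal_iff: "left.bal G \<phi> \<longleftrightarrow>
     (\<forall>m\<in>carrier H. \<forall>n\<in>carrier H. \<phi> m n \<in> carrier G) \<and>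
     (\<forall>m\<in>carrier H. \<forall>m'\<in>carrier H. \<forall>n\<in>carrier H. \<phi> (m \<oplus>\<^bsub>H\<^esub> m') n = \<phi> m n \<otimes>\<^bsub>G\<^esub> \<phi> m' n) \<and>
     (\<forall>m\<in>carrier H. \<forall>n\<in>carrier H. \<forall>n'\<in>carrier H. \<phi> m (n \<oplus>\<^bsub>H\<^esub> n') = \<phi> m n \<otimes>\<^bsub>G\<^esub> \<phi> m n') \<and>
     (\<forall>m\<in>carrier H. \<forall>l\<in>carrier L. \<forall>n\<in>carrier H. \<phi> (tL l \<cdot> m) n = \<phi> m (sL l \<cdot> n))"
  unfolding balanced_def left_ract_def left_lact_def ..

lemma right_bal_iff: "right.bal G \<phi> \<longleftrightarrow>
     (\<forall>m\<in>carrier H. \<forall>n\<in>carrier H. \<phi> m n \<in> carrier G) \<and>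
     (\<forall>m\<in>carrier H. \<forall>m'\<in>carrier H. \<forall>n\<in>carrier H. \<phi> (m \<oplus>\<^bsub>H\<^esub> m') n = \<phi> m n \<otimes>\<^bsub>G\<^esub> \<phi> m' n) \<and>
     (\<forall>m\<in>carrier H. \<forall>n\<in>carrier H. \<forall>n'\<in>carrier H. \<phi> m (n \<oplus>\<^bsub>H\<^esub> n') = \<phi> m n \<otimes>\<^bsub>G\<^esub> \<phi> m n') \<and>
     (\<forall>m\<in>carrier H. \<forall>r\<in>carrier R. \<forall>n\<in>carrier H. \<phi> (m \<cdot> sR r) n = \<phi> m (n \<cdot> tR r))"
  unfolding balanced_def right_ract_def right_lact_def ..

abbreviation "LR_bal \<equiv> tri_balanced H H H L (left_ract H tL) (left_lact H sL) R (right_ract H sR) (right_lact H tR)"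
abbreviation "RL_bal \<equiv> tri_balanced H H H R (right_ract H sR) (right_lact H tR) L (left_ract H tL) (left_lact H sL)"

lemma LR_bal_iff: "LR_bal G \<psi> \<longleftrightarrow>
    (\<forall>p\<in>carrier H. left.bal G (\<lambda>m n. \<psi> m n p)) \<and> (\<forall>m\<in>carrier H. right.bal G (\<psi> m))"
  by (simp add: tri_balanced_def)

lemma RL_bal_iff: "RL_bal G \<psi> \<longleftrightarrow>
    (\<forall>p\<in>carrier H. right.bal G (\<lambda>m n. \<psi> m n p)) \<and> (\<forall>m\<in>carrier H. left.bal G (\<psi> m))"
  by (simp add: tri_balanced_def)

lemma \<Delta>L_sL: "l \<in> carrier L \<Longrightarrow> \<Delta>L (sL l) = left_pure H L sL tL (sL l) \<one>\<^bsub>H\<^esub>"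
  using left.comult_left_one [of l] by (simp add: left_lact_def)

lemma \<Delta>L_tL: "l \<in> carrier L \<Longrightarrow> \<Delta>L (tL l) = left_pure H L sL tL \<one>\<^bsub>H\<^esub> (tL l)"
  using left.comult_right_one [of l] by (simp add: left_ract_def)

lemma \<Delta>R_tR: "r \<in> carrier R \<Longrightarrow> \<Delta>R (tR r) = right_pure H R sR tR (tR r) \<one>\<^bsub>H\<^esub>"
  using right.comult_left_one [of r] by (simp add: right_lact_def)

lemma \<Delta>R_sR: "r \<in> carrier R \<Longrightarrow> \<Delta>R (sR r) = right_pure H R sR tR \<one>\<^bsub>H\<^esub> (sR r)"
  using right.comult_right_one [of r] by (simp add: right_ract_def)

section \<open>Coproducts of products with base elements\<close>

context
  fixes G :: "('g, 'u) monoid_scheme" and \<phi> :: "'h \<Rightarrow> 'h \<Rightarrow> 'g" and h :: 'h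
  assumes G: "comm_group G" and h: "h \<in> carrier H"
begin

text \<open>An element of the base \<open>R\<close> has a known left coproduct because
  \<open>sR r\<close> is some \<open>tL l\<close>. This and its companions say that each coproduct
  is linear over the other base, which the mixed laws presuppose.\<close>

lemma left_sw_sR:
  assumes \<phi>: "left.bal G \<phi>" and r: "r \<in> carrier R"
  shows "left.sw G \<phi> (h \<cdot> sR r) = left.sw G (\<lambda>x y. \<phi> x (y \<cdot> sR r)) h"
proof -
  obtain l where l: "l \<in> carrier L" "sR r = tL l" using sR_eq_tL [OF r] .
  show ?thesis
    unfolding l(2) left.sw_mult_pure_right [OF G \<phi> h left.t_closed [OF l(1)] left.one_closed left.t_closed [OF l(1)] \<Delta>L_tL [OF l(1)]]
    by (rule sweedler_cong) simp
qed

lemma left_sw_tR: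
  assumes \<phi>: "left.bal G \<phi>" and r: "r \<in> carrier R"
  shows "left.sw G \<phi> (h \<cdot> tR r) = left.sw G (\<lambda>x y. \<phi> (x \<cdot> tR r) y) h"
proof -
  obtain l where l: "l \<in> carrier L" "tR r = sL l" using tR_eq_sL [OF r] .
  show ?thesis
    unfolding l(2) left.sw_mult_pure_right [OF G \<phi> h left.s_closed [OF l(1)] left.s_closed [OF l(1)] left.one_closed \<Delta>L_sL [OF l(1)]]
    by (rule sweedler_cong) simp
qed

lemma right_sw_tR:
  assumes \<phi>: "right.bal G \<phi>" and r: "r \<in> carrier R"
  shows "right.sw G \<phi> (tR r \<cdot> h) = right.sw G (\<lambda>x y. \<phi> (tR r \<cdot> x) y) h"
  unfolding right.sw_mult_pure_left [OF G \<phi> right.t_closed [OF r] h right.t_closed [OF r] left.one_closed \<Delta>R_tR [OF r]]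
  by (rule sweedler_cong) simp

lemma right_sw_sR:
  assumes \<phi>: "right.bal G \<phi>" and r: "r \<in> carrier R"
  shows "right.sw G \<phi> (sR r \<cdot> h) = right.sw G (\<lambda>x y. \<phi> x (sR r \<cdot> y)) h"
  unfolding right.sw_mult_pure_left [OF G \<phi> right.s_closed [OF r] h left.one_closed right.s_closed [OF r] \<Delta>R_sR [OF r]]
  by (rule sweedler_cong) simp

lemma right_sw_sL:
  assumes \<phi>: "right.bal G \<phi>" and l: "l \<in> carrier L"
  shows "right.sw G \<phi> (sL l \<cdot> h) = right.sw G (\<lambda>x y. \<phi> (sL l \<cdot> x) y) h"
  using sL_eq_tR [OF l] right_sw_tR [OF \<phi>] by metis

lemma right_sw_tL:
  assumes \<phi>: "right.bal G \<phi>" and l: "l \<in> carrier L"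
  shows "right.sw G \<phi> (tL l \<cdot> h) = right.sw G (\<lambda>x y. \<phi> x (tL l \<cdot> y)) h"
  using tL_eq_sR [OF l] right_sw_sR [OF \<phi>] by metis

lemma right_sw_mult_tR:
  assumes \<phi>: "right.bal G \<phi>" and r: "r \<in> carrier R"
  shows "right.sw G \<phi> (h \<cdot> tR r) = right.sw G (\<lambda>x y. \<phi> (x \<cdot> tR r) y) h"
  using right.sw_left [OF G \<phi> r h] by (simp add: right_lact_def)

end

section \<open>Mixed coassociativity\<close>

sublocale LR: tensor3_product H H H L "left_ract H tL" "left_lact H sL" R "right_ract H sR" "right_lact H tR"
  by unfold_locales

sublocale RL: tensor3_product H H H R "right_ract H sR" "right_lact H tR" L "left_ract H tL" "left_lact H sL"
  by unfold_locales

text \<open>The axiom is pushed from the triple tensor product to \<open>G\<close>. \<open>A\<close>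
  makes the left iterated sum well defined, by \<open>R\<close>-linearity of
  \<open>\<Delta>L\<close>, and \<open>B\<close> the right one, by \<open>L\<close>-linearity of
  \<open>\<Delta>R\<close>.\<close>

lemma mixed_LR:
  assumes G: "comm_group G" and \<psi>: "LR_bal G \<psi>" and h: "h \<in> carrier H"
  shows "right.sw G (\<lambda>x y. left.sw G (\<lambda>x1 x2. \<psi> x1 x2 y) x) h = left.sw G (\<lambda>x y. right.sw G (\<lambda>y1 y2. \<psi> x y1 y2) y) h"
proof -
  obtain \<Psi> where \<Psi>: "\<Psi> \<in> hom LR.T3 G" "\<And>x y z. x \<in> carrier H \<Longrightarrow> y \<in> carrier H \<Longrightarrow>
      z \<in> carrier H \<Longrightarrow> \<Psi> (LR.p3 x y z) = \<psi> x y z"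
    using LR.tri_balanced_factor [OF G \<psi>] by blast
  have p3: "left.bal LR.T3 (\<lambda>x y. LR.p3 x y z)" "right.bal LR.T3 (LR.p3 z)" if "z \<in> carrier H" for z
    using LR.pure3_tri_balanced that by (simp_all add: LR_bal_iff)
  have A: "left.sw LR.T3 (\<lambda>m n. LR.p3 m n p) (right_ract H sR q b)
      = left.sw LR.T3 (\<lambda>m n. LR.p3 m n (right_lact H tR b p)) q"
    if "q \<in> carrier H" "b \<in> carrier R" "p \<in> carrier H" for q b p
    unfolding right_ract_def [of H sR q b] right_lact_def [of H tR b p] left_sw_sR [OF LR.comm_group that(1) p3(1) [OF that(3)] that(2)]
    by (rule sweedler_cong) (use p3(2) that in \<open>simp add: right_bal_iff\<close>)
  have B: "right.sw LR.T3 (\<lambda>n p. LR.p3 m n p) (left_lact H sL b q)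
      = right.sw LR.T3 (\<lambda>n p. LR.p3 (left_ract H tL m b) n p) q"
    if "q \<in> carrier H" "b \<in> carrier L" "m \<in> carrier H" for q b m
    unfolding left_ract_def [of H tL m b] left_lact_def [of H sL b q] right_sw_sL [OF LR.comm_group that(1) p3(2) [OF that(3)] that(2)]
    by (rule sweedler_cong) (use p3(1) that in \<open>simp add: left_bal_iff\<close>)
  show ?thesis
    using LR.nested_eval_left [OF G \<Psi> right.T.tensor_product_axioms left.comult_hom A right.comult_closed [OF h]]
      LR.nested_eval_right [OF G \<Psi> left.T.tensor_product_axioms right.comult_hom B left.comult_closed [OF h]]
      mixed_coassociative_LR [OF h] by simp
qed

lemma mixed_RL:
  assumes G: "comm_group G" and \<psi>: "RL_bal G \<psi>" and h: "h \<in> carrier H"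
  shows "left.sw G (\<lambda>x y. right.sw G (\<lambda>x1 x2. \<psi> x1 x2 y) x) h = right.sw G (\<lambda>x y. left.sw G (\<lambda>y1 y2. \<psi> x y1 y2) y) h"
proof -
  obtain \<Psi> where \<Psi>: "\<Psi> \<in> hom RL.T3 G" "\<And>x y z. x \<in> carrier H \<Longrightarrow> y \<in> carrier H \<Longrightarrow>
      z \<in> carrier H \<Longrightarrow> \<Psi> (RL.p3 x y z) = \<psi> x y z"
    using RL.tri_balanced_factor [OF G \<psi>] by blast
  have p3: "right.bal RL.T3 (\<lambda>x y. RL.p3 x y z)" "left.bal RL.T3 (RL.p3 z)" if "z \<in> carrier H" for z
    using RL.pure3_tri_balanced that by (simp_all add: RL_bal_iff)
  have A: "right.sw RL.T3 (\<lambda>m n. RL.p3 m n p) (left_ract H tL q b)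
      = right.sw RL.T3 (\<lambda>m n. RL.p3 m n (left_lact H sL b p)) q"
    if "q \<in> carrier H" "b \<in> carrier L" "p \<in> carrier H" for q b p
    unfolding left_ract_def [of H tL q b] left_lact_def [of H sL b p] right_sw_tL [OF RL.comm_group that(1) p3(1) [OF that(3)] that(2)]
    by (rule sweedler_cong) (use p3(2) that in \<open>simp add: left_bal_iff\<close>)
  have B: "left.sw RL.T3 (\<lambda>n p. RL.p3 m n p) (right_lact H tR b q)
      = left.sw RL.T3 (\<lambda>n p. RL.p3 (right_ract H sR m b) n p) q"
    if "q \<in> carrier H" "b \<in> carrier R" "m \<in> carrier H" for q b m
    unfolding right_ract_def [of H sR m b] right_lact_def [of H tR b q] left_sw_tR [OF RL.comm_group that(1) p3(2) [OF that(3)] that(2)]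
    by (rule sweedler_cong) (use p3(1) that in \<open>simp add: right_bal_iff\<close>)
  show ?thesis
    using RL.nested_eval_left [OF G \<Psi> left.T.tensor_product_axioms right.comult_hom A left.comult_closed [OF h]]
      RL.nested_eval_right [OF G \<Psi> right.T.tensor_product_axioms left.comult_hom B right.comult_closed [OF h]]
      mixed_coassociative_RL [OF h] by simp
qed

end

section \<open>The antipode reverses products\<close>

context hopf_algebroid
begin

lemma H_cg: "comm_group (add_monoid H)"
  by (rule left.additive_monoid)

lemma S_tL: "l \<in> carrier L \<Longrightarrow> h \<in> carrier H \<Longrightarrow> S (tL l \<cdot> h) = S h \<cdot> sL l"
  using antipode_base [of l "\<one>\<^bsub>R\<^esub>" h] by (simp add: base_one right.R.one_closed)

lemma S_tR: "r \<in> carrier R \<Longrightarrow> h \<in> carrier H \<Longrightarrow> S (h \<cdot> tR r) = sR r \<cdot> S h"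
  using antipode_base [of "\<one>\<^bsub>L\<^esub>" r h] by (simp add: base_one left.L.one_closed)

text \<open>Matches the right-nested products that \<open>m_assoc\<close> produces in the
  simplifier.\<close>

lemma S_tR_assoc:
  "r \<in> carrier R \<Longrightarrow> g \<in> carrier H \<Longrightarrow> h \<in> carrier H \<Longrightarrow> S (g \<cdot> (h \<cdot> tR r)) = sR r \<cdot> S (g \<cdot> h)"
  using S_tR [of r "g \<cdot> h"] by (simp add: left.m_assoc)

lemmas H_simps = left.m_assoc left.l_distr left.r_distr S_add S_tL S_tR S_tR_assoc
  left.sweedler_sum_mult_left left.sweedler_sum_mult_right left.sweedler_sum_closed

lemma S_sum:
  "(\<And>x y. x \<in> carrier H \<Longrightarrow> y \<in> carrier H \<Longrightarrow> \<phi> x y \<in> carrier H) \<Longrightarrow>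
    S (sweedler (carrier H) (carrier H) (add_monoid H) \<phi> z) = sweedler (carrier H) (carrier H) (add_monoid H) (\<lambda>x y. S (\<phi> x y)) z"
  by (rule left.sweedler_sum_additive [where f = S]) (auto simp: S_add left.is_abelian_group)

lemma counit_right_L: "h \<in> carrier H \<Longrightarrow> SL H (\<lambda>x y. tL (\<epsilon>L y) \<cdot> x) h = h"
  using left.sw_counit_right by (simp add: left_ract_def)

lemma counit_left_R: "h \<in> carrier H \<Longrightarrow> SR H (\<lambda>x y. y \<cdot> tR (\<epsilon>R x)) h = h"
  using right.sw_counit_left by (simp add: right_lact_def)

lemma antipode_sum_left: "h \<in> carrier H \<Longrightarrow> SL H (\<lambda>x y. S x \<cdot> y) h = sR (\<epsilon>R h)"
  by (rule left.T.sweedler_evals_toD [OF left.comult_closed H_cg _ antipode_left]) auto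

lemma antipode_sum_right: "h \<in> carrier H \<Longrightarrow> SR H (\<lambda>x y. x \<cdot> S y) h = sL (\<epsilon>L h)"
  by (rule right.T.sweedler_evals_toD [OF right.comult_closed H_cg _ antipode_right]) auto

text \<open>\<open>S\<close> applied to the counit law. The factor \<open>sL (\<epsilon>L y)\<close>
  is the value of an antipode sum over \<open>\<Delta>R y\<close>, which is where a second antipode
  can be introduced.\<close>

lemma S_counit: "h \<in> carrier H \<Longrightarrow> SL H (\<lambda>x y. S x \<cdot> sL (\<epsilon>L y)) h = S h"
  using S_sum [of "\<lambda>x y. tL (\<epsilon>L y) \<cdot> x" "\<Delta>L h"] by (simp add: counit_right_L S_tL cong: sweedler_cong)

lemma S_one: "S \<one>\<^bsub>H\<^esub> = \<one>\<^bsub>H\<^esub>"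
proof -
  have "left.bal (add_monoid H) (\<lambda>x y. S x \<cdot> y)"
    unfolding left_bal_iff by (simp add: H_simps)
  from left.sw_one [OF H_cg this] antipode_sum_left [of "\<one>\<^bsub>H\<^esub>"] show ?thesis
    by (simp add: right.counit_one base_one)
qed

text \<open>The axiom \<open>antipode_base\<close> handles \<open>tR\<close> only on the right. Here
  \<open>sR r\<close> slides past \<open>sL (\<epsilon>L y)\<close>, the latter is expanded by the
  antipode law, and Takeuchi's condition for \<open>\<Delta>R\<close> moves \<open>sR r\<close> into
  the second antipode as \<open>tR r\<close>. Mixed coassociativity then contracts the first
  antipode, and the counit of \<open>\<Delta>R\<close> restores \<open>h\<close>.\<close>

lemma S_tR_left:
  assumes h: "h \<in> carrier H" and r: "r \<in> carrier R"
  shows "S (tR r \<cdot> h) = S h \<cdot> sR r"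
proof -
  have bal1: "right.bal (add_monoid H) (\<lambda>p q. S x \<cdot> (p \<cdot> S q))" if "x \<in> carrier H" for x
    unfolding right_bal_iff using that by (simp add: H_simps)
  have bal2: "LR_bal (add_monoid H) (\<lambda>x p q. S x \<cdot> (p \<cdot> S (tR r \<cdot> q)))"
    unfolding LR_bal_iff left_bal_iff right_bal_iff using r by (simp add: H_simps)
  have "S h \<cdot> sR r = SL H (\<lambda>x y. S x \<cdot> sL (\<epsilon>L y)) h \<cdot> sR r"
    by (simp add: S_counit h)
  also have "\<dots> = SL H (\<lambda>x y. S x \<cdot> (sR r \<cdot> sL (\<epsilon>L y))) h"
    using r by (simp add: H_simps sR_sL_commute cong: sweedler_cong)
  also have "\<dots> = SL H (\<lambda>x y. S x \<cdot> (sR r \<cdot> SR H (\<lambda>p q. p \<cdot> S q) y)) h"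
    by (simp add: antipode_sum_right cong: sweedler_cong)
  also have "\<dots> = SL H (\<lambda>x y. SR H (\<lambda>p q. S x \<cdot> ((sR r \<cdot> p) \<cdot> S q)) y) h"
    using r by (simp add: H_simps cong: sweedler_cong)
  also have "\<dots> = SL H (\<lambda>x y. SR H (\<lambda>p q. S x \<cdot> (p \<cdot> S (tR r \<cdot> q))) y) h"
    by (rule sweedler_cong) (rule right.sw_takeuchi [OF H_cg bal1 _ r])
  also have "\<dots> = SR H (\<lambda>x y. SL H (\<lambda>p q. S p \<cdot> (q \<cdot> S (tR r \<cdot> y))) x) h"
    by (rule mixed_LR [OF H_cg bal2 h, symmetric])
  also have "\<dots> = SR H (\<lambda>x y. SL H (\<lambda>p q. S p \<cdot> q) x \<cdot> S (tR r \<cdot> y)) h"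
    using r by (simp add: H_simps cong: sweedler_cong)
  also have "\<dots> = SR H (\<lambda>x y. S (tR r \<cdot> (y \<cdot> tR (\<epsilon>R x)))) h"
    using r by (simp add: antipode_sum_left H_simps cong: sweedler_cong)
  also have "\<dots> = S (SR H (\<lambda>x y. tR r \<cdot> (y \<cdot> tR (\<epsilon>R x))) h)"
    using r by (simp add: S_sum)
  also have "\<dots> = S (tR r \<cdot> SR H (\<lambda>x y. y \<cdot> tR (\<epsilon>R x)) h)"
    using r by (simp add: left.sweedler_sum_mult_left)
  also have "\<dots> = S (tR r \<cdot> h)"
    by (simp add: counit_left_R h)
  finally show ?thesis ..
qed

text \<open>The Hopf-algebra argument \<open>S(k\<^sub>1g)k\<^sub>2 =
  S(k\<^sub>1g\<^sub>1)k\<^sub>2g\<^sub>2S(g\<^sub>3)\<close> with contraction of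
  \<open>S(k\<^sub>1g\<^sub>1)k\<^sub>2g\<^sub>2\<close>. In the present setting the last pair of
  legs of \<open>g\<close> comes from \<open>\<Delta>R\<close>, and the counit is replaced by base
  elements that must be carried along.\<close>

lemma S_mult_cancel:
  assumes k: "k \<in> carrier H" and g: "g \<in> carrier H"
  shows "SL H (\<lambda>x y. S (x \<cdot> g) \<cdot> y) k = S g \<cdot> sR (\<epsilon>R k)"
proof -
  \<comment> \<open>The sum over \<open>k\<close> stays inside \<open>\<psi>\<close>: balance over
    \<open>L\<close> in \<open>p\<close> and \<open>a\<close> holds only after this summation, by
    Takeuchi's condition at \<open>k\<close>.\<close>
  define \<psi> where "\<psi> = (\<lambda>p a b. SL H (\<lambda>x y. S (x \<cdot> p) \<cdot> (y \<cdot> (a \<cdot> S b))) k)"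
  have bal1: "left.bal (add_monoid H) (\<lambda>x y. S (x \<cdot> p) \<cdot> y)" if "p \<in> carrier H" for p
    unfolding left_bal_iff using that by (simp add: H_simps)
  \<comment> \<open>Needed twice: for the balance of \<open>\<psi>\<close>, and with
    \<open>c\<close> equal to one for trading \<open>tL (\<epsilon>L q)\<close> against
    \<open>sL (\<epsilon>L q)\<close>.\<close>
  have tak: "SL H (\<lambda>x y. S (x \<cdot> (tL l \<cdot> p)) \<cdot> (y \<cdot> c)) k = SL H (\<lambda>x y. S (x \<cdot> p) \<cdot> (y \<cdot> (sL l \<cdot> c))) k"
    if "p \<in> carrier H" "l \<in> carrier L" "c \<in> carrier H" for p l c
  proof -
    have "left.bal (add_monoid H) (\<lambda>x y. S (x \<cdot> p) \<cdot> (y \<cdot> c))"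
      unfolding left_bal_iff using that by (simp add: H_simps)
    from left.sw_takeuchi [OF H_cg this k that(2)] show ?thesis
      using that by (simp add: H_simps cong: sweedler_cong)
  qed
  have bal2: "LR_bal (add_monoid H) \<psi>"
    unfolding LR_bal_iff left_bal_iff right_bal_iff \<psi>_def
    by (simp add: H_simps left.sweedler_sum_add tak cong: sweedler_cong)
  have bal3: "left.bal (add_monoid H) (\<lambda>x y. S x \<cdot> y)"
    unfolding left_bal_iff by (simp add: H_simps)
  have bal4: "right.bal (add_monoid H) (\<lambda>u b. b \<cdot> tR (\<epsilon>R u))"
  proof -
    have "\<epsilon>R (u \<oplus>\<^bsub>H\<^esub> v) = \<epsilon>R u \<oplus>\<^bsub>R\<^esub> \<epsilon>R v" if "u \<in> carrier H" "v \<in> carrier H" for u v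
      using hom_mult [OF right.counit_hom] that by simp
    moreover have "\<epsilon>R (u \<cdot> sR a) = \<epsilon>R u \<otimes>\<^bsub>R\<^esub> a" if "u \<in> carrier H" "a \<in> carrier R" for u a
      using right.counit_right that by (simp add: right_ract_def)
    ultimately show ?thesis
      unfolding right_bal_iff by (simp add: H_simps tR_add tR_mult)
  qed
  have "SL H (\<lambda>x y. S (x \<cdot> g) \<cdot> y) k = SL H (\<lambda>x y. S (x \<cdot> SL H (\<lambda>p q. tL (\<epsilon>L q) \<cdot> p) g) \<cdot> y) k"
    by (simp add: counit_right_L g)
  also have "\<dots> = SL H (\<lambda>x y. SL H (\<lambda>p q. S (x \<cdot> (tL (\<epsilon>L q) \<cdot> p)) \<cdot> y) g) k"
    by (simp add: left.sweedler_sum_mult_left left.sweedler_sum_mult_right S_sum cong: sweedler_cong)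
  also have "\<dots> = SL H (\<lambda>p q. SL H (\<lambda>x y. S (x \<cdot> (tL (\<epsilon>L q) \<cdot> p)) \<cdot> y) k) g"
    by (rule left.sweedler_sum_swap) simp
  also have "\<dots> = SL H (\<lambda>p q. SL H (\<lambda>x y. S (x \<cdot> p) \<cdot> (y \<cdot> sL (\<epsilon>L q))) k) g"
    using tak [of _ _ "\<one>\<^bsub>H\<^esub>"] by (simp cong: sweedler_cong)
  also have "\<dots> = SL H (\<lambda>p q. SL H (\<lambda>x y. S (x \<cdot> p) \<cdot> (y \<cdot> SR H (\<lambda>a b. a \<cdot> S b) q)) k) g"
    by (simp add: antipode_sum_right cong: sweedler_cong)
  also have "\<dots> = SL H (\<lambda>p q. SL H (\<lambda>x y. SR H (\<lambda>a b. S (x \<cdot> p) \<cdot> (y \<cdot> (a \<cdot> S b))) q) k) g"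
    by (simp add: left.sweedler_sum_mult_left cong: sweedler_cong)
  also have "\<dots> = SL H (\<lambda>p q. SR H (\<lambda>a b. \<psi> p a b) q) g"
    unfolding \<psi>_def by (intro sweedler_cong left.sweedler_sum_swap) simp
  also have "\<dots> = SR H (\<lambda>u b. SL H (\<lambda>p a. \<psi> p a b) u) g"
    by (rule mixed_LR [OF H_cg bal2 g, symmetric])
  also have "\<dots> = SR H (\<lambda>u b. SL H (\<lambda>x y. SL H (\<lambda>p a. S (x \<cdot> p) \<cdot> (y \<cdot> (a \<cdot> S b))) u) k) g"
    unfolding \<psi>_def by (intro sweedler_cong left.sweedler_sum_swap) simp
  also have "\<dots> = SR H (\<lambda>u b. SL H (\<lambda>x y. SL H (\<lambda>p a. S (x \<cdot> p) \<cdot> (y \<cdot> a)) u) k \<cdot> S b) g"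
    by (simp add: H_simps cong: sweedler_cong)
  also have "\<dots> = SR H (\<lambda>u b. SL H (\<lambda>x y. S x \<cdot> y) (k \<cdot> u) \<cdot> S b) g"
    by (simp add: left.sw_mult [OF H_cg bal3 k] cong: sweedler_cong)
  \<comment> \<open>\<open>counit_target\<close> replaces \<open>k\<close> by
    \<open>tR (\<epsilon>R k)\<close>, whose right coproduct is pure; the factor can then be taken
    out of the sum and joined to \<open>g\<close>.\<close>
  also have "\<dots> = SR H (\<lambda>u b. S (b \<cdot> tR (\<epsilon>R (tR (\<epsilon>R k) \<cdot> u)))) g"
    using k by (simp add: antipode_sum_left right.counit_target H_simps cong: sweedler_cong)
  also have "\<dots> = S (SR H (\<lambda>u b. b \<cdot> tR (\<epsilon>R (tR (\<epsilon>R k) \<cdot> u))) g)"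
    using k by (simp add: S_sum)
  also have "\<dots> = S (SR H (\<lambda>u b. b \<cdot> tR (\<epsilon>R u)) (tR (\<epsilon>R k) \<cdot> g))"
    using k by (simp add: right_sw_tR [OF H_cg g bal4])
  also have "\<dots> = S g \<cdot> sR (\<epsilon>R k)"
    using k g by (simp add: counit_left_R S_tR_left)
  finally show ?thesis .
qed

text \<open>The same expansion applied to the left factor: the antipode law creates a trailing
  \<open>S b\<close>, mixed coassociativity regroups, and \<open>S_mult_cancel\<close> evaluates
  what stands before it.\<close>

lemma S_mult:
  assumes h: "h \<in> carrier H" and g: "g \<in> carrier H"
  shows "S (h \<cdot> g) = S g \<cdot> S h"
proof -
  have bal: "LR_bal (add_monoid H) (\<lambda>x a b. S (x \<cdot> g) \<cdot> (a \<cdot> S b))"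
    unfolding LR_bal_iff left_bal_iff right_bal_iff using g by (simp add: H_simps)
  have "S (h \<cdot> g) = S (SL H (\<lambda>x y. tL (\<epsilon>L y) \<cdot> x) h \<cdot> g)"
    by (simp add: counit_right_L h)
  also have "\<dots> = SL H (\<lambda>x y. S (x \<cdot> g) \<cdot> sL (\<epsilon>L y)) h"
    using g by (simp add: H_simps S_sum cong: sweedler_cong)
  also have "\<dots> = SL H (\<lambda>x y. S (x \<cdot> g) \<cdot> SR H (\<lambda>a b. a \<cdot> S b) y) h"
    by (simp add: antipode_sum_right cong: sweedler_cong)
  also have "\<dots> = SL H (\<lambda>x y. SR H (\<lambda>a b. S (x \<cdot> g) \<cdot> (a \<cdot> S b)) y) h"
    using g by (simp add: left.sweedler_sum_mult_left cong: sweedler_cong)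
  also have "\<dots> = SR H (\<lambda>u b. SL H (\<lambda>x a. S (x \<cdot> g) \<cdot> (a \<cdot> S b)) u) h"
    by (rule mixed_LR [OF H_cg bal h, symmetric])
  also have "\<dots> = SR H (\<lambda>u b. SL H (\<lambda>x a. S (x \<cdot> g) \<cdot> a) u \<cdot> S b) h"
    using g by (simp add: H_simps cong: sweedler_cong)
  also have "\<dots> = SR H (\<lambda>u b. S g \<cdot> S (b \<cdot> tR (\<epsilon>R u))) h"
    using g by (simp add: S_mult_cancel H_simps cong: sweedler_cong)
  also have "\<dots> = S g \<cdot> S (SR H (\<lambda>u b. b \<cdot> tR (\<epsilon>R u)) h)"
    using g by (simp add: S_sum left.sweedler_sum_mult_left)
  also have "\<dots> = S g \<cdot> S h"
    by (simp add: counit_left_R h)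
  finally show ?thesis .
qed

text \<open>\<open>antipode_base\<close> does not reach \<open>sR\<close> on the right. Written as
  \<open>tL (\<epsilon>L (sR r))\<close>, it is detached by \<open>S_mult\<close> and evaluated at
  the unit. The rule supplies the balance of \<open>split_act\<close> over \<open>R\<close>.\<close>

lemma S_sR:
  assumes h: "h \<in> carrier H" and r: "r \<in> carrier R"
  shows "S (h \<cdot> sR r) = sL (\<epsilon>L (sR r)) \<cdot> S h"
proof -
  have "S (sR r) = S (tL (\<epsilon>L (sR r)) \<cdot> \<one>\<^bsub>H\<^esub>)"
    using r by (simp add: tL_\<epsilon>L_sR)
  also have "\<dots> = sL (\<epsilon>L (sR r))"
    using r S_tL [of "\<epsilon>L (sR r)" "\<one>\<^bsub>H\<^esub>"] by (simp add: S_one)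
  finally show ?thesis using h r by (simp add: S_mult)
qed

end

section \<open>Equivariant modules\<close>

locale hopf_module_algebra =
    hopf_algebroid K H L sL tL \<Delta>L \<epsilon>L R sR tR \<Delta>R \<epsilon>R S + MA: module_algebra K H sL tL \<Delta>L \<epsilon>L A act
  for K :: "('k, 'x) ring_scheme" and H :: "('k, 'h) module"
    and L :: "('k, 'l) module" and sL :: "'l \<Rightarrow> 'h" and tL :: "'l \<Rightarrow> 'h"
    and \<Delta>L :: "'h \<Rightarrow> ('h \<times> 'h \<Rightarrow>\<^sub>0 int) set" and \<epsilon>L :: "'h \<Rightarrow> 'l"
    and R :: "('k, 'r) module" and sR :: "'r \<Rightarrow> 'h" and tR :: "'r \<Rightarrow> 'h"
    and \<Delta>R :: "'h \<Rightarrow> ('h \<times> 'h \<Rightarrow>\<^sub>0 int) set" and \<epsilon>R :: "'h \<Rightarrow> 'r"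
    and S :: "'h \<Rightarrow> 'h" and A :: "('k, 'a) module" and act :: "'h \<Rightarrow> 'a \<Rightarrow> 'a"
begin

lemma A_ring: "ring A"
  using MA.module_algebra_axioms by (simp add: module_algebra_def kalgebra_def)

lemma A_module: "left_module K H A act"
  using MA.module_algebra_axioms by (simp add: module_algebra_def)

lemmas A_abelian = ring.is_abelian_group [OF A_ring]
lemmas act_closed [simp] = left_module.act_closed [OF A_module]
lemmas act_add_left = left_module.act_add_left [OF A_module]
lemmas act_add_right = left_module.act_add_right [OF A_module]
lemmas act_mult = left_module.act_mult [OF A_module]
lemmas act_one = left_module.act_one [OF A_module]
lemmas A_one_closed [simp] = monoid.one_closed [OF ring.is_monoid [OF A_ring]]
lemmas A_mult_closed [simp] = monoid.m_closed [OF ring.is_monoid [OF A_ring]]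
lemmas A_l_one [simp] = monoid.l_one [OF ring.is_monoid [OF A_ring]]
lemmas A_add_closed [simp] = abelian_monoid.a_closed [OF abelian_group.axioms(1) [OF A_abelian]]

lemma \<epsilon>L_sL: "l \<in> carrier L \<Longrightarrow> \<epsilon>L (sL l) = l"
  using left.counit_left [of l "\<one>\<^bsub>H\<^esub>"] by (simp add: left_lact_def left.counit_one left.L.r_one)

lemma \<epsilon>L_tL: "l \<in> carrier L \<Longrightarrow> \<epsilon>L (tL l) = l"
  using left.counit_right [of l "\<one>\<^bsub>H\<^esub>"] by (simp add: left_ract_def left.counit_one left.L.l_one)

lemma act_tL_one: "l \<in> carrier L \<Longrightarrow> act (tL l) \<one>\<^bsub>A\<^esub> = act (sL l) \<one>\<^bsub>A\<^esub>"
  using MA.act_unit_source [of "tL l"] by (simp add: \<epsilon>L_tL)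

text \<open>A pure coproduct contains the single generator \<open>frag_of (a, b)\<close>, which
  reduces a Sweedler assertion to one term. This is the source of the rules for base elements acting
  on \<open>A\<close> and on equivariant modules.\<close>

lemma tensor_evals_to_pure:
  assumes "comm_group G" "tensor_evals_to G (\<lambda>(x, y). \<phi> x y) (\<Delta>L h) z"
    and "\<Delta>L h = left_pure H L sL tL a b" "a \<in> carrier H" "b \<in> carrier H" "\<phi> a b \<in> carrier G"
  shows "\<phi> a b = z"
  using assms left.frag_in_pure [of a b] comm_group.formal_eval_frag_of [OF assms(1), of "\<lambda>(x, y). \<phi> x y" "(a, b)"]
  by (auto simp: tensor_evals_to_def)

lemma act_sL_mult:
  "l \<in> carrier L \<Longrightarrow> a \<in> carrier A \<Longrightarrow> b \<in> carrier A \<Longrightarrow> act (sL l) (a \<otimes>\<^bsub>A\<^esub> b) = act (sL l) a \<otimes>\<^bsub>A\<^esub> b"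
  using tensor_evals_to_pure [OF abelian_group.a_comm_group [OF A_abelian] MA.act_product \<Delta>L_sL]
  by (simp add: act_one)

abbreviation eqm :: "('k, 'm, 'h, 'a) eqmod \<Rightarrow> bool" where
  "eqm X \<equiv> equivariant_module K H \<Delta>L A act X"

context
  fixes X :: "('k, 'm, 'h, 'a) eqmod"
  assumes X: "eqm X"
begin

lemma eqm_left_module: "left_module K H X (hact X)"
  using X by (simp add: equivariant_module_def)

lemma eqm_module: "Module.module K X"
  using eqm_left_module by (simp add: left_module_def)

lemma eqm_abelian: "abelian_group X"
  using eqm_module by (rule module.axioms)

lemma eqm_right_module: "left_module K (opp A) X (\<lambda>a m. ract X m a)"
  using X by (simp add: equivariant_module_def right_module_def)

lemmas eqm_comm_group = abelian_group.a_comm_group [OF eqm_abelian]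
lemmas hact_closed = left_module.act_closed [OF eqm_left_module]
lemmas hact_add_left = left_module.act_add_left [OF eqm_left_module]
lemmas hact_add_right = left_module.act_add_right [OF eqm_left_module]
lemmas hact_smult_left = left_module.act_smult_left [OF eqm_left_module]
lemmas hact_smult_right = left_module.act_smult_right [OF eqm_left_module]
lemmas hact_mult = left_module.act_mult [OF eqm_left_module]
lemmas hact_one = left_module.act_one [OF eqm_left_module]
lemmas eqm_add_closed = abelian_monoid.a_closed [OF abelian_group.axioms(1) [OF eqm_abelian]]

lemma ract_closed: "x \<in> carrier X \<Longrightarrow> a \<in> carrier A \<Longrightarrow> ract X x a \<in> carrier X"
  using left_module.act_closed [OF eqm_right_module] by (simp add: opp_def)

lemma ract_add_left: "x \<in> carrier X \<Longrightarrow> y \<in> carrier X \<Longrightarrow> a \<in> carrier A \<Longrightarrow>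
    ract X (x \<oplus>\<^bsub>X\<^esub> y) a = ract X x a \<oplus>\<^bsub>X\<^esub> ract X y a"
  using left_module.act_add_right [OF eqm_right_module] by (simp add: opp_def)

lemma ract_add_right: "x \<in> carrier X \<Longrightarrow> a \<in> carrier A \<Longrightarrow> b \<in> carrier A \<Longrightarrow>
    ract X x (a \<oplus>\<^bsub>A\<^esub> b) = ract X x a \<oplus>\<^bsub>X\<^esub> ract X x b"
  using left_module.act_add_left [OF eqm_right_module] by (simp add: opp_def)

lemma ract_smult_left: "c \<in> carrier K \<Longrightarrow> x \<in> carrier X \<Longrightarrow> a \<in> carrier A \<Longrightarrow>
    ract X (c \<odot>\<^bsub>X\<^esub> x) a = c \<odot>\<^bsub>X\<^esub> ract X x a"
  using left_module.act_smult_right [OF eqm_right_module] by (simp add: opp_def)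

lemma ract_smult_right: "c \<in> carrier K \<Longrightarrow> x \<in> carrier X \<Longrightarrow> a \<in> carrier A \<Longrightarrow>
    ract X x (c \<odot>\<^bsub>A\<^esub> a) = c \<odot>\<^bsub>X\<^esub> ract X x a"
  using left_module.act_smult_left [OF eqm_right_module] by (simp add: opp_def)

lemma ract_mult: "x \<in> carrier X \<Longrightarrow> a \<in> carrier A \<Longrightarrow> b \<in> carrier A \<Longrightarrow>
    ract X x (a \<otimes>\<^bsub>A\<^esub> b) = ract X (ract X x a) b"
  using left_module.act_mult [OF eqm_right_module, of b a] by (simp add: opp_def)

lemma ract_one: "x \<in> carrier X \<Longrightarrow> ract X x \<one>\<^bsub>A\<^esub> = x"
  using left_module.act_one [OF eqm_right_module] by (simp add: opp_def)

lemma equivariant_evals_to: "h \<in> carrier H \<Longrightarrow> x \<in> carrier X \<Longrightarrow> a \<in> carrier A \<Longrightarrow>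
    tensor_evals_to (add_monoid X) (\<lambda>(p, q). ract X (hact X p x) (act q a)) (\<Delta>L h) (hact X h (ract X x a))"
  using X by (simp add: equivariant_module_def)

lemma hact_ract: "h \<in> carrier H \<Longrightarrow> x \<in> carrier X \<Longrightarrow> a \<in> carrier A \<Longrightarrow>
    hact X h (ract X x a) = SL X (\<lambda>p q. ract X (hact X p x) (act q a)) h"
  by (rule left.T.sweedler_evals_toD [OF left.comult_closed eqm_comm_group _ equivariant_evals_to, symmetric])
    (auto simp: ract_closed hact_closed)

lemma hact_sL_ract:
  assumes "l \<in> carrier L" "x \<in> carrier X" "a \<in> carrier A"
  shows "hact X (sL l) (ract X x a) = ract X (hact X (sL l) x) a"
  using tensor_evals_to_pure [OF eqm_comm_group equivariant_evals_to [of "sL l" x a] \<Delta>L_sL [of l]] assms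
  by (simp add: act_one ract_closed hact_closed)

lemma hact_tL_ract:
  assumes "l \<in> carrier L" "x \<in> carrier X" "a \<in> carrier A"
  shows "hact X (tL l) (ract X x a) = ract X x (act (tL l) a)"
  using tensor_evals_to_pure [OF eqm_comm_group equivariant_evals_to [of "tL l" x a] \<Delta>L_tL [of l]] assms
  by (simp add: hact_one ract_closed hact_closed)

lemma hact_tL: "l \<in> carrier L \<Longrightarrow> x \<in> carrier X \<Longrightarrow> hact X (tL l) x = ract X x (act (tL l) \<one>\<^bsub>A\<^esub>)"
  using hact_tL_ract [of l x "\<one>\<^bsub>A\<^esub>"] by (simp add: ract_one)

text \<open>The element of \<open>A\<close> by which \<open>tL l\<close> multiplies can be written
  with \<open>sL l\<close> instead, and \<open>sL l\<close> acts on a product through its left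
  factor. The result is the balance over \<open>L\<close> of the right action of \<open>A\<close>
  under \<open>\<Delta>L\<close>.\<close>

lemma ract_hact_tL:
  assumes "l \<in> carrier L" "x \<in> carrier X" "a \<in> carrier A"
  shows "ract X (hact X (tL l) x) a = ract X x (act (sL l) a)"
proof -
  have "ract X (hact X (tL l) x) a = ract X x (act (sL l) \<one>\<^bsub>A\<^esub> \<otimes>\<^bsub>A\<^esub> a)"
    using assms by (simp add: hact_tL ract_mult act_tL_one)
  also have "act (sL l) \<one>\<^bsub>A\<^esub> \<otimes>\<^bsub>A\<^esub> a = act (sL l) a"
    using assms act_sL_mult [of l "\<one>\<^bsub>A\<^esub>" a] by simp
  finally show ?thesis .
qed

lemma ract_act_sR: "r \<in> carrier R \<Longrightarrow> x \<in> carrier X \<Longrightarrow> a \<in> carrier A \<Longrightarrow>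
    ract X x (act (sR r) a) = hact X (sR r) (ract X x a)"
  using sR_eq_tL [of r] hact_tL_ract by metis

lemma ract_hact_sR: "r \<in> carrier R \<Longrightarrow> x \<in> carrier X \<Longrightarrow> a \<in> carrier A \<Longrightarrow>
    ract X (hact X (sR r) x) a = ract X x (act (sL (\<epsilon>L (sR r))) a)"
  using ract_hact_tL [of "\<epsilon>L (sR r)" x a] by (simp add: tL_\<epsilon>L_sR)

lemma hact_sum:
  "h \<in> carrier H \<Longrightarrow> (\<And>x y. x \<in> U \<Longrightarrow> y \<in> V \<Longrightarrow> \<phi> x y \<in> carrier X) \<Longrightarrow>
    hact X h (sweedler U V (add_monoid X) \<phi> z) = sweedler U V (add_monoid X) (\<lambda>x y. hact X h (\<phi> x y)) z"
  by (rule abelian_group.sweedler_sum_additive [OF eqm_abelian eqm_abelian]) (auto simp: hact_closed hact_add_right)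

lemma hact_sum_left:
  "m \<in> carrier X \<Longrightarrow> (\<And>x y. x \<in> U \<Longrightarrow> y \<in> V \<Longrightarrow> \<phi> x y \<in> carrier H) \<Longrightarrow>
    hact X (sweedler U V (add_monoid H) \<phi> z) m = sweedler U V (add_monoid X) (\<lambda>x y. hact X (\<phi> x y) m) z"
  by (rule left.sweedler_sum_additive [OF eqm_abelian, where f = "\<lambda>h. hact X h m"]) (auto simp: hact_closed hact_add_left)

lemma ract_sum:
  "a \<in> carrier A \<Longrightarrow> (\<And>x y. x \<in> U \<Longrightarrow> y \<in> V \<Longrightarrow> \<phi> x y \<in> carrier X) \<Longrightarrow>
    ract X (sweedler U V (add_monoid X) \<phi> z) a = sweedler U V (add_monoid X) (\<lambda>x y. ract X (\<phi> x y) a) z"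
  by (rule abelian_group.sweedler_sum_additive [OF eqm_abelian eqm_abelian, where f = "\<lambda>m. ract X m a"])
    (auto simp: ract_closed ract_add_left)

lemma ract_act_sum:
  "m \<in> carrier X \<Longrightarrow> a \<in> carrier A \<Longrightarrow> (\<And>x y. x \<in> U \<Longrightarrow> y \<in> V \<Longrightarrow> \<phi> x y \<in> carrier H) \<Longrightarrow>
    ract X m (act (sweedler U V (add_monoid H) \<phi> z) a) = sweedler U V (add_monoid X) (\<lambda>x y. ract X m (act (\<phi> x y) a)) z"
  by (rule left.sweedler_sum_additive [OF eqm_abelian, where f = "\<lambda>h. ract X m (act h a)"])
    (auto simp: ract_closed ract_add_right act_add_left)

lemmas eqm_sum_closed = abelian_group.sweedler_sum_closed [OF eqm_abelian]
lemmas eqm_sum_add = abelian_group.sweedler_sum_add [OF eqm_abelian]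

lemmas eqm_closed = ract_closed hact_closed eqm_add_closed eqm_sum_closed
lemmas eqm_simps = hact_add_left hact_add_right hact_mult ract_add_left ract_add_right

text \<open>Starting from the right-hand side, equivariance splits \<open>p\<close>. Mixed
  coassociativity then brings \<open>S q\<close> next to the leg acting on \<open>A\<close>, where
  the antipode law leaves \<open>sL (\<epsilon>L c)\<close>; \<open>ract_hact_tL\<close> returns it
  to \<open>X\<close> as \<open>tL (\<epsilon>L c)\<close>, ready for the counit law.\<close>

lemma ract_hact:
  assumes h: "h \<in> carrier H" and y: "y \<in> carrier X" and a: "a \<in> carrier A"
  shows "ract X (hact X h y) a = SR X (\<lambda>p q. hact X p (ract X y (act (S q) a))) h"
proof -
  have bal: "LR_bal (add_monoid X) (\<lambda>u v q. ract X (hact X u y) (act v (act (S q) a)))"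
    unfolding LR_bal_iff left_bal_iff right_bal_iff using y a
    by (simp add: eqm_closed eqm_simps S_add S_tR act_add_left act_add_right act_mult ract_hact_tL)
  have "SR X (\<lambda>p q. hact X p (ract X y (act (S q) a))) h
      = SR X (\<lambda>p q. SL X (\<lambda>u v. ract X (hact X u y) (act v (act (S q) a))) p) h"
    using y a by (simp add: hact_ract cong: sweedler_cong)
  also have "\<dots> = SL X (\<lambda>u c. SR X (\<lambda>v q. ract X (hact X u y) (act v (act (S q) a))) c) h"
    by (rule mixed_LR [OF eqm_comm_group bal h])
  also have "\<dots> = SL X (\<lambda>u c. ract X (hact X u y) (act (SR H (\<lambda>v q. v \<cdot> S q) c) a)) h"
    using y a by (simp add: ract_act_sum eqm_closed act_mult cong: sweedler_cong)
  also have "\<dots> = SL X (\<lambda>u c. ract X (hact X (tL (\<epsilon>L c) \<cdot> u) y) a) h"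
    using y a by (simp add: antipode_sum_right hact_mult ract_hact_tL hact_closed cong: sweedler_cong)
  also have "\<dots> = ract X (hact X (SL H (\<lambda>u c. tL (\<epsilon>L c) \<cdot> u) h) y) a"
    using y a by (simp add: hact_sum_left ract_sum eqm_closed)
  also have "\<dots> = ract X (hact X h y) a"
    by (simp add: counit_right_L h)
  finally show ?thesis ..
qed

end

end

section \<open>The action on morphisms\<close>

context hopf_module_algebra
begin

text \<open>The action on maps is defined before it is known to preserve \<open>A\<close>-linearity; the weaker
  condition \<open>base_linear\<close> is what makes the summands balanced over \<open>R\<close>.\<close>

definition base_linear ::
    "('k, 'm, 'h, 'a) eqmod \<Rightarrow> ('k, 'm, 'h, 'a) eqmod \<Rightarrow> ('m \<Rightarrow> 'm) \<Rightarrow> bool" where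
  "base_linear X Y f \<longleftrightarrow>
     (\<forall>x\<in>carrier X. f x \<in> carrier Y) \<and>
     (\<forall>x\<in>carrier X. \<forall>y\<in>carrier X. f (x \<oplus>\<^bsub>X\<^esub> y) = f x \<oplus>\<^bsub>Y\<^esub> f y) \<and>
     (\<forall>r\<in>carrier R. \<forall>x\<in>carrier X. f (hact X (sR r) x) = hact Y (sR r) (f x))"

text \<open>Unlike \<open>hom_action\<close>, this is a Sweedler sum at the chosen representative,
  with no definite description and no cut-off outside the carrier, so it can be rewritten before
  well-definedness is settled. The two agree on carriers by \<open>hom_action_eq\<close>.\<close>

definition map_act ::
    "('k, 'm, 'h, 'a) eqmod \<Rightarrow> ('k, 'm, 'h, 'a) eqmod \<Rightarrow> 'h \<Rightarrow> ('m \<Rightarrow> 'm) \<Rightarrow> 'm \<Rightarrow> 'm" where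
  "map_act X Y h f x = SR Y (\<lambda>p q. hact Y p (f (hact X (S q) x))) h"

section \<open>Formal properties of the action on maps\<close>

context
  fixes X Y :: "('k, 'm, 'h, 'a) eqmod"
  assumes X: "eqm X" and Y: "eqm Y"
begin

context
  fixes f :: "'m \<Rightarrow> 'm"
  assumes f: "base_linear X Y f"
begin

lemma map_closed: "x \<in> carrier X \<Longrightarrow> f x \<in> carrier Y"
  using f by (simp add: base_linear_def)

lemma map_add: "x \<in> carrier X \<Longrightarrow> y \<in> carrier X \<Longrightarrow> f (x \<oplus>\<^bsub>X\<^esub> y) = f x \<oplus>\<^bsub>Y\<^esub> f y"
  using f by (simp add: base_linear_def)

lemma map_sR: "r \<in> carrier R \<Longrightarrow> x \<in> carrier X \<Longrightarrow> f (hact X (sR r) x) = hact Y (sR r) (f x)"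
  using f by (simp add: base_linear_def)

lemma map_sum:
  "(\<And>x y. x \<in> U \<Longrightarrow> y \<in> V \<Longrightarrow> \<phi> x y \<in> carrier X) \<Longrightarrow>
    f (sweedler U V (add_monoid X) \<phi> z) = sweedler U V (add_monoid Y) (\<lambda>x y. f (\<phi> x y)) z"
  by (rule abelian_group.sweedler_sum_additive [OF eqm_abelian [OF X] eqm_abelian [OF Y]])
    (auto simp: map_closed map_add)

lemmas map_closed_simps = map_closed eqm_closed [OF X] eqm_closed [OF Y]
lemmas map_simps = map_add map_sR eqm_simps [OF X] eqm_simps [OF Y] S_add S_tR S_tL

text \<open>A factor \<open>sR r\<close> on the right of \<open>p\<close> meets \<open>f\<close>
  from outside; a factor \<open>tR r\<close> on the right of \<open>q\<close> becomes
  \<open>sR r\<close> before \<open>S q\<close> and meets \<open>f\<close> from inside.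
  \<open>base_linear\<close> identifies the two.\<close>

lemma map_act_balanced:
  assumes "x \<in> carrier X"
  shows "right.bal (add_monoid Y) (\<lambda>p q. hact Y p (f (hact X (S q) x)))"
  unfolding right_bal_iff using assms by (simp add: map_closed_simps map_simps)

lemma map_act_closed: "x \<in> carrier X \<Longrightarrow> map_act X Y h f x \<in> carrier Y"
  unfolding map_act_def by (rule eqm_sum_closed [OF Y]) (simp add: map_closed_simps)

lemma map_act_add_left: "h \<in> carrier H \<Longrightarrow> g \<in> carrier H \<Longrightarrow> x \<in> carrier X \<Longrightarrow>
    map_act X Y (h \<oplus>\<^bsub>H\<^esub> g) f x = map_act X Y h f x \<oplus>\<^bsub>Y\<^esub> map_act X Y g f x"
  unfolding map_act_def using right.sw_add [OF eqm_comm_group [OF Y] map_act_balanced] by simp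

lemma map_act_sum_left:
  "x \<in> carrier X \<Longrightarrow> (\<And>u v. u \<in> U \<Longrightarrow> v \<in> V \<Longrightarrow> \<phi> u v \<in> carrier H) \<Longrightarrow>
    map_act X Y (sweedler U V (add_monoid H) \<phi> z) f x = sweedler U V (add_monoid Y) (\<lambda>u v. map_act X Y (\<phi> u v) f x) z"
  by (rule left.sweedler_sum_additive [OF eqm_abelian [OF Y], where f = "\<lambda>h. map_act X Y h f x"])
    (auto simp: map_act_closed map_act_add_left)

lemma map_act_add_arg: "x \<in> carrier X \<Longrightarrow> y \<in> carrier X \<Longrightarrow>
    map_act X Y h f (x \<oplus>\<^bsub>X\<^esub> y) = map_act X Y h f x \<oplus>\<^bsub>Y\<^esub> map_act X Y h f y"
  unfolding map_act_def by (simp add: map_closed_simps map_simps eqm_sum_add [OF Y] cong: sweedler_cong)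

text \<open>Makes the action iterable. An \<open>sR r\<close> on the argument is absorbed through
  \<open>S q \<cdot> sR r = S (tR r \<cdot> q)\<close>, and Takeuchi's condition for
  \<open>\<Delta>R\<close> moves it to the outer leg.\<close>

lemma map_act_base_linear:
  assumes h: "h \<in> carrier H"
  shows "base_linear X Y (map_act X Y h f)"
  unfolding base_linear_def
proof (intro conjI ballI)
  fix r x assume r: "r \<in> carrier R" and x: "x \<in> carrier X"
  have "map_act X Y h f (hact X (sR r) x) = SR Y (\<lambda>p q. hact Y p (f (hact X (S (tR r \<cdot> q)) x))) h"
    unfolding map_act_def using r x
    by (simp add: S_tR_left hact_mult [OF X] cong: sweedler_cong)
  also have "\<dots> = SR Y (\<lambda>p q. hact Y (sR r \<cdot> p) (f (hact X (S q) x))) h"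
    by (rule right.sw_takeuchi [OF eqm_comm_group [OF Y] map_act_balanced [OF x] h r, symmetric])
  also have "\<dots> = hact Y (sR r) (map_act X Y h f x)"
    unfolding map_act_def using r x by (simp add: map_closed_simps hact_mult [OF Y] hact_sum [OF Y] cong: sweedler_cong)
  finally show "map_act X Y h f (hact X (sR r) x) = hact Y (sR r) (map_act X Y h f x)" .
qed (simp_all add: map_act_closed map_act_add_arg)

lemma map_act_mult:
  assumes h: "h \<in> carrier H" and g: "g \<in> carrier H" and x: "x \<in> carrier X"
  shows "map_act X Y (h \<cdot> g) f x = map_act X Y h (map_act X Y g f) x"
proof -
  have "map_act X Y (h \<cdot> g) f x
      = SR Y (\<lambda>p q. SR Y (\<lambda>p' q'. hact Y (p \<cdot> p') (f (hact X (S (q \<cdot> q')) x))) g) h"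
    unfolding map_act_def by (rule right.sw_mult [OF eqm_comm_group [OF Y] map_act_balanced [OF x] h g])
  also have "\<dots> = map_act X Y h (map_act X Y g f) x"
    unfolding map_act_def using x
    by (simp add: S_mult map_closed_simps hact_mult [OF X] hact_mult [OF Y] hact_sum [OF Y] cong: sweedler_cong)
  finally show ?thesis .
qed

lemma map_act_one: "x \<in> carrier X \<Longrightarrow> map_act X Y \<one>\<^bsub>H\<^esub> f x = f x"
  unfolding map_act_def right.sw_one [OF eqm_comm_group [OF Y] map_act_balanced]
  by (simp add: S_one hact_one [OF X] hact_one [OF Y] map_closed)

text \<open>\<open>\<Delta>R\<close> puts \<open>tL l\<close> on the second leg, inside the
  antipode, which turns it into \<open>sL l\<close> next to the argument. It serves as balance over
  \<open>L\<close> whenever an acted-on map is applied to an acted-on element.\<close>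

lemma map_act_tL:
  assumes "l \<in> carrier L" "h \<in> carrier H" "x \<in> carrier X"
  shows "map_act X Y (tL l \<cdot> h) f x = map_act X Y h f (hact X (sL l) x)"
  unfolding map_act_def right_sw_tL [OF eqm_comm_group [OF Y] assms(2) map_act_balanced [OF assms(3)] assms(1)]
  using assms by (simp add: S_tL hact_mult [OF X] cong: sweedler_cong)

lemma map_act_smult_left:
  assumes c: "c \<in> carrier K" and h: "h \<in> carrier H" and x: "x \<in> carrier X"
  shows "map_act X Y (c \<odot>\<^bsub>H\<^esub> h) f x = c \<odot>\<^bsub>Y\<^esub> map_act X Y h f x"
proof -
  interpret Y: module K Y by (rule eqm_module [OF Y])
  have R1: "c \<odot>\<^bsub>R\<^esub> \<one>\<^bsub>R\<^esub> \<in> carrier R"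
    using c by (simp add: right.R.one_closed)
  have "tR (c \<odot>\<^bsub>R\<^esub> \<one>\<^bsub>R\<^esub>) = c \<odot>\<^bsub>H\<^esub> \<one>\<^bsub>H\<^esub>"
    using right.target_hom c right.R.one_closed by (simp add: kalgebra_hom_def opp_def base_one)
  then have tR: "p \<cdot> tR (c \<odot>\<^bsub>R\<^esub> \<one>\<^bsub>R\<^esub>) = c \<odot>\<^bsub>H\<^esub> p" if "p \<in> carrier H" for p
    using c that by (simp add: left.smult_mult_right)
  have "map_act X Y (c \<odot>\<^bsub>H\<^esub> h) f x = map_act X Y (h \<cdot> tR (c \<odot>\<^bsub>R\<^esub> \<one>\<^bsub>R\<^esub>)) f x"
    by (simp add: tR h)
  also have "\<dots> = SR Y (\<lambda>p q. hact Y (p \<cdot> tR (c \<odot>\<^bsub>R\<^esub> \<one>\<^bsub>R\<^esub>)) (f (hact X (S q) x))) h"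
    unfolding map_act_def by (rule right_sw_mult_tR [OF eqm_comm_group [OF Y] h map_act_balanced [OF x] R1])
  also have "\<dots> = SR Y (\<lambda>p q. c \<odot>\<^bsub>Y\<^esub> hact Y p (f (hact X (S q) x))) h"
    using c x by (simp add: tR hact_smult_left [OF Y] map_closed_simps cong: sweedler_cong)
  also have "\<dots> = c \<odot>\<^bsub>Y\<^esub> map_act X Y h f x"
    unfolding map_act_def using c x
    by (intro abelian_group.sweedler_sum_additive [OF eqm_abelian [OF Y] eqm_abelian [OF Y], symmetric])
      (auto simp: map_closed_simps Y.smult_r_distr)
  finally show ?thesis .
qed

text \<open>The antipode coming from the action on \<open>f\<close> must meet the leg
  \<open>q\<close> acting on \<open>y\<close>, so the opposite mixed law, \<open>mixed_RL\<close>,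
  is required. The contraction leaves \<open>sR (\<epsilon>R c)\<close>, which \<open>f\<close> lets
  through, and the right counit law of \<open>\<Delta>R\<close> finishes.\<close>

lemma map_act_hact:
  assumes k: "k \<in> carrier H" and y: "y \<in> carrier X"
  shows "SL Y (\<lambda>p q. map_act X Y p f (hact X q y)) k = hact Y k (f y)"
proof -
  have bal: "RL_bal (add_monoid Y) (\<lambda>a b q. hact Y a (f (hact X (S b) (hact X q y))))"
    unfolding RL_bal_iff left_bal_iff right_bal_iff using y
    by (simp add: map_closed_simps map_simps)
  have "SL Y (\<lambda>p q. map_act X Y p f (hact X q y)) k
      = SR Y (\<lambda>a c. SL Y (\<lambda>b q. hact Y a (f (hact X (S b) (hact X q y)))) c) k"
    unfolding map_act_def by (rule mixed_RL [OF eqm_comm_group [OF Y] bal k])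
  also have "\<dots> = SR Y (\<lambda>a c. hact Y a (f (hact X (SL H (\<lambda>b q. S b \<cdot> q) c) y))) k"
    using y by (simp add: hact_sum_left [OF X] map_sum hact_sum [OF Y] map_closed_simps hact_mult [OF X]
        cong: sweedler_cong)
  also have "\<dots> = SR Y (\<lambda>a c. hact Y (a \<cdot> sR (\<epsilon>R c)) (f y)) k"
    using y by (simp add: antipode_sum_left map_sR hact_mult [OF Y] map_closed_simps cong: sweedler_cong)
  also have "\<dots> = hact Y (SR H (\<lambda>a c. a \<cdot> sR (\<epsilon>R c)) k) (f y)"
    using y by (simp add: hact_sum_left [OF Y] map_closed)
  also have "\<dots> = hact Y k (f y)"
    using right.sw_counit_right [OF k] by (simp add: right_ract_def)
  finally show ?thesis .
qed

end

text \<open>This is \<open>S(w)(x a)\<close> expanded as if \<open>\<Delta>\<^sub>L(S(w)) = S(w\<^sup>2) \<otimes> S(w\<^sup>1)\<close>. Working with the expansion makes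
  it unnecessary to prove that \<open>S\<close> reverses coproducts.\<close>

definition split_act :: "'m \<Rightarrow> 'a \<Rightarrow> 'h \<Rightarrow> 'm" where
  "split_act x a w = SR X (\<lambda>t q. ract X (hact X (S q) x) (act (S t) a)) w"

context
  fixes x :: 'm and a :: 'a
  assumes x: "x \<in> carrier X" and a: "a \<in> carrier A"
begin

lemma split_act_balanced: "right.bal (add_monoid X) (\<lambda>t q. ract X (hact X (S q) x) (act (S t) a))"
  unfolding right_bal_iff using x a
  by (simp add: eqm_closed [OF X] eqm_simps [OF X] S_add S_tR S_sR act_add_left act_mult ract_hact_sR [OF X])

lemma split_act_closed: "split_act x a w \<in> carrier X"
  unfolding split_act_def by (rule eqm_sum_closed [OF X]) (simp add: eqm_closed [OF X] x a)

lemma split_act_add: "v \<in> carrier H \<Longrightarrow> w \<in> carrier H \<Longrightarrow>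
    split_act x a (v \<oplus>\<^bsub>H\<^esub> w) = split_act x a v \<oplus>\<^bsub>X\<^esub> split_act x a w"
  unfolding split_act_def using right.sw_add [OF eqm_comm_group [OF X] split_act_balanced] by simp

lemma split_act_tR:
  assumes w: "w \<in> carrier H" and r: "r \<in> carrier R"
  shows "split_act x a (w \<cdot> tR r) = hact X (sR r) (split_act x a w)"
  unfolding split_act_def right_sw_mult_tR [OF eqm_comm_group [OF X] w split_act_balanced r]
  using r x a by (simp add: S_tR act_mult ract_act_sR [OF X] hact_sum [OF X] eqm_closed [OF X] cong: sweedler_cong)

text \<open>This would be the antipode law for \<open>\<Delta>R\<close> if
  \<open>split_act x a w\<close> were known to be \<open>S w\<close> acting on \<open>x a\<close>.
  Instead \<open>sL (\<epsilon>L c)\<close> is placed on \<open>x\<close> alone and expanded,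
  \<open>ract_hact\<close> draws \<open>a\<close> under the first leg, and coassociativity of
  \<open>\<Delta>R\<close> gathers the remaining legs into \<open>split_act\<close>.\<close>

lemma ract_sL_eq_split_act:
  assumes c: "c \<in> carrier H"
  shows "hact X (sL (\<epsilon>L c)) (ract X x a) = SR X (\<lambda>s w. hact X s (split_act x a w)) c"
proof -
  have bal: "tri_balanced H H H R (right_ract H sR) (right_lact H tR) R (right_ract H sR) (right_lact H tR)
      (add_monoid X) (\<lambda>s t q. hact X s (ract X (hact X (S q) x) (act (S t) a)))"
    unfolding tri_balanced_def right_bal_iff using x a
    by (simp add: eqm_closed [OF X] eqm_simps [OF X] S_add S_tR S_sR act_add_left act_mult
        ract_hact_sR [OF X] ract_act_sR [OF X])
  have "hact X (sL (\<epsilon>L c)) (ract X x a) = ract X (hact X (SR H (\<lambda>p q. p \<cdot> S q) c) x) a"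
    using x a c by (simp add: antipode_sum_right hact_sL_ract [OF X])
  also have "\<dots> = SR X (\<lambda>p q. SR X (\<lambda>s t. hact X s (ract X (hact X (S q) x) (act (S t) a))) p) c"
    using x a by (simp add: hact_sum_left [OF X] ract_sum [OF X] hact_mult [OF X] ract_hact [OF X] eqm_closed [OF X]
        cong: sweedler_cong)
  also have "\<dots> = SR X (\<lambda>s w. SR X (\<lambda>t q. hact X s (ract X (hact X (S q) x) (act (S t) a))) w) c"
    by (rule right.sw_coassoc [OF eqm_comm_group [OF X] bal c])
  also have "\<dots> = SR X (\<lambda>s w. hact X s (split_act x a w)) c"
    unfolding split_act_def using x a by (simp add: hact_sum [OF X] eqm_closed [OF X] cong: sweedler_cong)
  finally show ?thesis .
qed

text \<open>Linearity over \<open>A\<close> is available for \<open>f\<close> but sought for the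
  acted-on map. \<open>ract_hact\<close> in \<open>X\<close>, hidden in
  \<open>ract_sL_eq_split_act\<close>, separates \<open>a\<close> from \<open>x\<close>;
  \<open>map_act_hact\<close> removes the action on \<open>f\<close>, so that \<open>f_ract\<close>
  applies; \<open>ract_hact\<close> in \<open>Y\<close> reassembles the result.\<close>

lemma map_act_ract:
  assumes f: "base_linear X Y f" and h: "h \<in> carrier H"
    and f_ract: "\<And>y b. y \<in> carrier X \<Longrightarrow> b \<in> carrier A \<Longrightarrow> f (ract X y b) = ract Y (f y) b"
  shows "map_act X Y h f (ract X x a) = ract Y (map_act X Y h f x) a"
proof -
  note clos = map_closed_simps [OF f] map_act_closed [OF f] split_act_closed
  \<comment> \<open>Balance over \<open>L\<close> between \<open>u\<close> and \<open>s\<close> is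
    \<open>map_act_tL\<close>; balance over \<open>R\<close> between \<open>s\<close> and
    \<open>w\<close> is \<open>split_act_tR\<close>.\<close>
  have bal1: "LR_bal (add_monoid Y) (\<lambda>u s w. map_act X Y u f (hact X s (split_act x a w)))"
    unfolding LR_bal_iff left_bal_iff right_bal_iff
    by (simp add: clos eqm_simps [OF X] map_act_add_left [OF f] map_act_add_arg [OF f] map_act_tL [OF f]
        split_act_add split_act_tR)
  have bal2: "tri_balanced H H H R (right_ract H sR) (right_lact H tR) R (right_ract H sR) (right_lact H tR)
      (add_monoid Y) (\<lambda>s t q. hact Y s (f (ract X (hact X (S q) x) (act (S t) a))))"
    unfolding tri_balanced_def right_bal_iff using x a
    by (simp add: clos map_simps [OF f] S_sR act_add_left act_mult ract_hact_sR [OF X] ract_act_sR [OF X])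
  have "map_act X Y h f (ract X x a) = map_act X Y (SL H (\<lambda>u c. tL (\<epsilon>L c) \<cdot> u) h) f (ract X x a)"
    by (simp add: counit_right_L h)
  also have "\<dots> = SL Y (\<lambda>u c. map_act X Y u f (hact X (sL (\<epsilon>L c)) (ract X x a))) h"
    using x a by (simp add: map_act_sum_left [OF f] map_act_tL [OF f] clos cong: sweedler_cong)
  also have "\<dots> = SL Y (\<lambda>u c. SR Y (\<lambda>s w. map_act X Y u f (hact X s (split_act x a w))) c) h"
    by (simp add: ract_sL_eq_split_act map_sum [OF map_act_base_linear [OF f]] clos cong: sweedler_cong)
  also have "\<dots> = SR Y (\<lambda>v w. SL Y (\<lambda>u s. map_act X Y u f (hact X s (split_act x a w))) v) h"
    by (rule mixed_LR [OF eqm_comm_group [OF Y] bal1 h, symmetric])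
  also have "\<dots> = SR Y (\<lambda>v w. hact Y v (f (split_act x a w))) h"
    by (simp add: map_act_hact [OF f] split_act_closed cong: sweedler_cong)
  also have "\<dots> = SR Y (\<lambda>v w. SR Y (\<lambda>t q. hact Y v (f (ract X (hact X (S q) x) (act (S t) a)))) w) h"
    unfolding split_act_def using x a
    by (simp add: map_sum [OF f] hact_sum [OF Y] clos cong: sweedler_cong)
  also have "\<dots> = SR Y (\<lambda>v q. SR Y (\<lambda>s t. hact Y s (f (ract X (hact X (S q) x) (act (S t) a)))) v) h"
    by (rule right.sw_coassoc [OF eqm_comm_group [OF Y] bal2 h, symmetric])
  also have "\<dots> = SR Y (\<lambda>v q. ract Y (hact Y v (f (hact X (S q) x))) a) h"
    using x a by (simp add: f_ract ract_hact [OF Y] clos cong: sweedler_cong)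
  also have "\<dots> = ract Y (map_act X Y h f x) a"
    unfolding map_act_def using x a by (simp add: ract_sum [OF Y] clos cong: sweedler_cong)
  finally show ?thesis .
qed

end

end

text \<open>Mixed coassociativity pairs the leg acting on \<open>f\<close> with the outer leg of the
  action on \<open>g\<close>; \<open>map_act_hact\<close> contracts this pair.\<close>

lemma map_act_compose:
  assumes X: "eqm X" and Y: "eqm Y" and Z: "eqm Z"
    and f: "base_linear Y Z f" and g: "base_linear X Y g"
    and h: "h \<in> carrier H" and x: "x \<in> carrier X"
  shows "SL Z (\<lambda>p q. map_act Y Z p f (map_act X Y q g x)) h = map_act X Z h (\<lambda>x. f (g x)) x"
proof -
  note clos = map_closed_simps [OF X Y g] map_closed_simps [OF Y Z f] map_act_closed [OF Y Z f]
  note simps = map_simps [OF X Y g] eqm_simps [OF Z]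
  have bal: "LR_bal (add_monoid Z) (\<lambda>p a b. map_act Y Z p f (hact Y a (g (hact X (S b) x))))"
    unfolding LR_bal_iff left_bal_iff right_bal_iff using x
    by (simp add: clos simps map_act_add_left [OF Y Z f] map_act_add_arg [OF Y Z f] map_act_tL [OF Y Z f])
  have "SL Z (\<lambda>p q. map_act Y Z p f (map_act X Y q g x)) h
      = SL Z (\<lambda>p q. SR Z (\<lambda>a b. map_act Y Z p f (hact Y a (g (hact X (S b) x)))) q) h"
    unfolding map_act_def [of X Y] using x
    by (simp add: map_sum [OF Y Z map_act_base_linear [OF Y Z f]] clos cong: sweedler_cong)
  also have "\<dots> = SR Z (\<lambda>u b. SL Z (\<lambda>p a. map_act Y Z p f (hact Y a (g (hact X (S b) x)))) u) h"
    by (rule mixed_LR [OF eqm_comm_group [OF Z] bal h, symmetric])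
  also have "\<dots> = map_act X Z h (\<lambda>x. f (g x)) x"
    unfolding map_act_def [of X Z] using x by (simp add: map_act_hact [OF Y Z f] clos cong: sweedler_cong)
  finally show ?thesis .
qed

end

section \<open>The category of equivariant modules\<close>

lemma (in hopf_algebroid) left_module_bimodule:
  assumes "left_module K H M a"
  shows "bimodule L M (\<lambda>l m. a (sL l) m) (\<lambda>m l. a (tL l) m)"
proof -
  interpret M: left_module K H M a by (rule assms)
  have sL: "sL (x \<oplus>\<^bsub>L\<^esub> y) = sL x \<oplus>\<^bsub>H\<^esub> sL y" "sL (x \<otimes>\<^bsub>L\<^esub> y) = sL x \<cdot> sL y"
    if "x \<in> carrier L" "y \<in> carrier L" for x y
    using ring_hom_add [OF sL_hom] ring_hom_mult [OF sL_hom] that by auto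
  have tL: "tL (x \<oplus>\<^bsub>L\<^esub> y) = tL x \<oplus>\<^bsub>H\<^esub> tL y" "tL (x \<otimes>\<^bsub>L\<^esub> y) = tL y \<cdot> tL x"
    if "x \<in> carrier L" "y \<in> carrier L" for x y
    using ring_hom_add [OF tL_hom] ring_hom_mult [OF tL_hom, of y x] that by (auto simp: opp_def)
  have commute: "a (tL y) (a (sL x) m) = a (sL x) (a (tL y) m)"
    if "x \<in> carrier L" "y \<in> carrier L" "m \<in> carrier M" for x y m
    using that by (simp flip: M.act_mult add: left.source_target_commute)
  have "abelian_group M" using M.M.module_axioms by (rule module.axioms)
  then show ?thesis
    by (intro bimodule.intro bimodule_axioms.intro left.L.ring_axioms)
      (simp_all add: sL tL base_one commute M.act_closed M.act_add_left M.act_add_right M.act_mult M.act_one)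
qed

context hopf_module_algebra
begin

context
  fixes X Y :: "('k, 'm, 'h, 'a) eqmod"
  assumes X: "eqm X" and Y: "eqm Y"
begin

lemma module_homD:
  assumes "f \<in> module_hom_set A X Y"
  shows "f \<in> extensional (carrier X)" "x \<in> carrier X \<Longrightarrow> f x \<in> carrier Y"
    "x \<in> carrier X \<Longrightarrow> y \<in> carrier X \<Longrightarrow> f (x \<oplus>\<^bsub>X\<^esub> y) = f x \<oplus>\<^bsub>Y\<^esub> f y"
    "x \<in> carrier X \<Longrightarrow> a \<in> carrier A \<Longrightarrow> f (ract X x a) = ract Y (f x) a"
  using assms by (auto simp: module_hom_set_def PiE_def)

lemma module_hom_restrictI:
  assumes "\<And>x. x \<in> carrier X \<Longrightarrow> f x \<in> carrier Y"
    and "\<And>x y. x \<in> carrier X \<Longrightarrow> y \<in> carrier X \<Longrightarrow> f (x \<oplus>\<^bsub>X\<^esub> y) = f x \<oplus>\<^bsub>Y\<^esub> f y"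
    and "\<And>x a. x \<in> carrier X \<Longrightarrow> a \<in> carrier A \<Longrightarrow> f (ract X x a) = ract Y (f x) a"
  shows "restrict f (carrier X) \<in> module_hom_set A X Y"
  using assms by (auto simp: module_hom_set_def eqm_closed [OF X])

lemma module_hom_eqI:
  assumes "f \<in> module_hom_set A X Y" "g \<in> module_hom_set A X Y" "\<And>x. x \<in> carrier X \<Longrightarrow> f x = g x"
  shows "f = g"
  using module_homD(1) [OF assms(1)] module_homD(1) [OF assms(2)] assms(3) by (rule extensionalityI)

lemma module_hom_smult:
  assumes f: "f \<in> module_hom_set A X Y" and c: "c \<in> carrier K" and x: "x \<in> carrier X"
  shows "f (c \<odot>\<^bsub>X\<^esub> x) = c \<odot>\<^bsub>Y\<^esub> f x"
proof -
  interpret A: module K A using A_module by (simp add: left_module_def)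
  have "f (c \<odot>\<^bsub>X\<^esub> x) = f (ract X x (c \<odot>\<^bsub>A\<^esub> \<one>\<^bsub>A\<^esub>))"
    using c x by (simp add: ract_smult_right [OF X] ract_one [OF X])
  also have "\<dots> = c \<odot>\<^bsub>Y\<^esub> f x"
    using c x by (simp add: module_homD [OF f] ract_smult_right [OF Y] ract_one [OF Y])
  finally show ?thesis .
qed

lemma module_hom_base_linear:
  assumes f: "f \<in> module_hom_set A X Y"
  shows "base_linear X Y f"
  unfolding base_linear_def
proof (intro conjI ballI)
  fix r x assume r: "r \<in> carrier R" and x: "x \<in> carrier X"
  obtain l where l: "l \<in> carrier L" "sR r = tL l" using sR_eq_tL [OF r] .
  show "f (hact X (sR r) x) = hact Y (sR r) (f x)"
    using l x by (simp add: hact_tL [OF X] hact_tL [OF Y] module_homD [OF f])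
qed (simp_all add: module_homD [OF f])

lemma module_hom_module: "Module.module K (module_hom A X Y)"
proof -
  interpret Y: module K Y by (rule eqm_module [OF Y])
  let ?M = "module_hom A X Y"
  have add: "f \<oplus>\<^bsub>?M\<^esub> g \<in> carrier ?M" if "f \<in> carrier ?M" "g \<in> carrier ?M" for f g
    using that unfolding module_hom_def
    by (auto intro!: module_hom_restrictI simp: module_homD ract_add_left [OF Y] Y.M.add.m_ac)
  have zero: "\<zero>\<^bsub>?M\<^esub> \<in> carrier ?M"
  proof -
    have "ract Y \<zero>\<^bsub>Y\<^esub> a = \<zero>\<^bsub>Y\<^esub>" if "a \<in> carrier A" for a
    proof -
      \<comment> \<open>The element equals its own double, hence vanishes.\<close>
      have "ract Y \<zero>\<^bsub>Y\<^esub> a \<oplus>\<^bsub>Y\<^esub> ract Y \<zero>\<^bsub>Y\<^esub> a = ract Y \<zero>\<^bsub>Y\<^esub> a"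
        using that ract_add_left [OF Y, of "\<zero>\<^bsub>Y\<^esub>" "\<zero>\<^bsub>Y\<^esub>" a] by simp
      then show ?thesis using that by (simp add: ract_closed [OF Y])
    qed
    then show ?thesis
      unfolding module_hom_def by (auto intro!: module_hom_restrictI)
  qed
  have smult: "c \<odot>\<^bsub>?M\<^esub> f \<in> carrier ?M" if "c \<in> carrier K" "f \<in> carrier ?M" for c f
    using that unfolding module_hom_def
    by (auto intro!: module_hom_restrictI simp: module_homD ract_smult_left [OF Y] Y.smult_r_distr)
  have neg: "\<exists>g\<in>carrier ?M. g \<oplus>\<^bsub>?M\<^esub> f = \<zero>\<^bsub>?M\<^esub>" if f: "f \<in> carrier ?M" for f
  proof
    have f': "f \<in> module_hom_set A X Y" using f by (simp add: module_hom_def)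
    \<comment> \<open>Scaling by minus one is the witness, so that closure is inherited from
      \<open>smult\<close>.\<close>
    show "(\<ominus>\<^bsub>K\<^esub> \<one>\<^bsub>K\<^esub>) \<odot>\<^bsub>?M\<^esub> f \<in> carrier ?M" using f by (intro smult) auto
    show "(\<ominus>\<^bsub>K\<^esub> \<one>\<^bsub>K\<^esub>) \<odot>\<^bsub>?M\<^esub> f \<oplus>\<^bsub>?M\<^esub> f = \<zero>\<^bsub>?M\<^esub>"
      by (auto simp: module_hom_def module_homD [OF f'] Y.smult_l_minus Y.M.l_neg intro!: restrict_ext)
  qed
  have "abelian_group ?M"
  proof (rule abelian_groupI)
    fix f g h assume *: "f \<in> carrier ?M" "g \<in> carrier ?M" "h \<in> carrier ?M"
    then have hom: "f \<in> module_hom_set A X Y" "g \<in> module_hom_set A X Y" "h \<in> module_hom_set A X Y"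
      by (simp_all add: module_hom_def)
    note D = hom [THEN module_homD(2)]
    show "f \<oplus>\<^bsub>?M\<^esub> g \<oplus>\<^bsub>?M\<^esub> h = f \<oplus>\<^bsub>?M\<^esub> (g \<oplus>\<^bsub>?M\<^esub> h)"
      by (auto simp: module_hom_def D Y.M.add.m_assoc intro!: restrict_ext)
    show "f \<oplus>\<^bsub>?M\<^esub> g = g \<oplus>\<^bsub>?M\<^esub> f"
      by (auto simp: module_hom_def D Y.M.add.m_comm intro!: restrict_ext)
  next
    fix f assume "f \<in> carrier ?M"
    then have f: "f \<in> module_hom_set A X Y" by (simp add: module_hom_def)
    show "\<zero>\<^bsub>?M\<^esub> \<oplus>\<^bsub>?M\<^esub> f = f"
      by (rule extensionalityI [of _ "carrier X"]) (auto simp: module_hom_def module_homD [OF f])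
  qed (auto intro: add zero neg)
  then show ?thesis
  proof (rule moduleI [OF module.axioms(1) [OF eqm_module [OF Y]]])
    fix a b f g assume ab: "a \<in> carrier K" "b \<in> carrier K" and "f \<in> carrier ?M" "g \<in> carrier ?M"
    then have hom: "f \<in> module_hom_set A X Y" "g \<in> module_hom_set A X Y"
      by (simp_all add: module_hom_def)
    note D = hom [THEN module_homD(2)]
    show "(a \<oplus>\<^bsub>K\<^esub> b) \<odot>\<^bsub>?M\<^esub> f = a \<odot>\<^bsub>?M\<^esub> f \<oplus>\<^bsub>?M\<^esub> b \<odot>\<^bsub>?M\<^esub> f"
      using ab by (auto simp: module_hom_def D Y.smult_l_distr intro!: restrict_ext)
    show "a \<odot>\<^bsub>?M\<^esub> (f \<oplus>\<^bsub>?M\<^esub> g) = a \<odot>\<^bsub>?M\<^esub> f \<oplus>\<^bsub>?M\<^esub> a \<odot>\<^bsub>?M\<^esub> g"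
      using ab by (auto simp: module_hom_def D Y.smult_r_distr intro!: restrict_ext)
    show "(a \<otimes>\<^bsub>K\<^esub> b) \<odot>\<^bsub>?M\<^esub> f = a \<odot>\<^bsub>?M\<^esub> (b \<odot>\<^bsub>?M\<^esub> f)"
      using ab by (auto simp: module_hom_def D Y.smult_assoc1 intro!: restrict_ext)
  next
    fix f assume "f \<in> carrier ?M"
    then have f: "f \<in> module_hom_set A X Y" by (simp add: module_hom_def)
    show "\<one>\<^bsub>K\<^esub> \<odot>\<^bsub>?M\<^esub> f = f"
      by (rule extensionalityI [of _ "carrier X"]) (auto simp: module_hom_def module_homD [OF f])
  qed (rule smult)
qed

section \<open>The action on hom modules\<close>

lemma hom_action_evals_to:
  assumes f: "f \<in> module_hom_set A X Y" and h: "h \<in> carrier H" and x: "x \<in> carrier X"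
  shows "tensor_evals_to (add_monoid Y) (hom_action_summand S X Y f x) (\<Delta>R h) (map_act X Y h f x)"
    and "tensor_eval (add_monoid Y) (hom_action_summand S X Y f x) (\<Delta>R h) = map_act X Y h f x"
proof -
  have bal: "right.bal (add_monoid Y) (\<lambda>p q. hact Y p (f (hact X (S q) x)))"
    by (rule map_act_balanced [OF X Y module_hom_base_linear [OF f] x])
  show "tensor_evals_to (add_monoid Y) (hom_action_summand S X Y f x) (\<Delta>R h) (map_act X Y h f x)"
    unfolding hom_action_summand_def map_act_def
    by (rule right.T.tensor_evals_to_sweedler [OF eqm_comm_group [OF Y] bal right.comult_closed [OF h]])
  show "tensor_eval (add_monoid Y) (hom_action_summand S X Y f x) (\<Delta>R h) = map_act X Y h f x"
    unfolding hom_action_summand_def map_act_def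
    by (rule right.T.tensor_eval_sweedler [OF eqm_comm_group [OF Y] bal right.comult_closed [OF h]])
qed

lemma hom_action_eq:
  assumes f: "f \<in> module_hom_set A X Y" and h: "h \<in> carrier H"
  shows "hom_action \<Delta>R S X Y h f = (\<lambda>x\<in>carrier X. map_act X Y h f x)"
  unfolding hom_action_def by (rule restrict_ext) (rule hom_action_evals_to(2) [OF f h])

lemma hom_action_closed:
  assumes f: "f \<in> module_hom_set A X Y" and h: "h \<in> carrier H"
  shows "hom_action \<Delta>R S X Y h f \<in> module_hom_set A X Y"
  unfolding hom_action_eq [OF f h]
proof (rule module_hom_restrictI)
  note b = module_hom_base_linear [OF f]
  show "map_act X Y h f (ract X x a) = ract Y (map_act X Y h f x) a"
    if "x \<in> carrier X" "a \<in> carrier A" for x a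
    by (rule map_act_ract [OF X Y that b h]) (rule module_homD(4) [OF f])
qed (simp_all add: map_act_closed [OF X Y] map_act_add_arg [OF X Y] module_hom_base_linear [OF f])

text \<open>Sums, multiples and composites of morphisms are cut off outside the carrier; inside
  \<open>map_act\<close> they can be exchanged for the plain pointwise expressions.\<close>

lemma map_act_cong:
  assumes "\<And>x. x \<in> carrier X \<Longrightarrow> f x = g x" "x \<in> carrier X"
  shows "map_act X Y h f x = map_act X Y h g x"
  unfolding map_act_def using assms by (intro sweedler_cong) (simp add: hact_closed [OF X])

text \<open>With \<open>map_act_tL\<close> this is the balance over \<open>L\<close> of the
  composite of \<open>p f\<close> and \<open>q g\<close> in \<open>p\<close> and
  \<open>q\<close>.\<close>

lemma map_act_sL:
  assumes "base_linear X Y f" "l \<in> carrier L" "h \<in> carrier H" "x \<in> carrier X"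
  shows "map_act X Y (sL l \<cdot> h) f x = hact Y (sL l) (map_act X Y h f x)"
  unfolding map_act_def right_sw_sL [OF eqm_comm_group [OF Y] assms(3) map_act_balanced [OF X Y assms(1,4)] assms(2)]
  using assms by (simp add: hact_mult [OF Y] hact_sum [OF Y] map_closed_simps [OF X Y assms(1)] cong: sweedler_cong)

lemma hom_action_left_module: "left_module K H (module_hom A X Y) (hom_action \<Delta>R S X Y)"
proof -
  interpret Y: module K Y by (rule eqm_module [OF Y])
  let ?M = "module_hom A X Y" and ?act = "hom_action \<Delta>R S X Y"
  have M: "carrier ?M = module_hom_set A X Y" by (simp add: module_hom_def)
  note simps = hom_action_eq module_hom_base_linear map_act_closed [OF X Y] map_closed_simps [OF X Y]
  show ?thesis
  proof (intro left_module.intro left_module_axioms.intro module_hom_module, unfold M)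
    show "kalgebra K H" by (rule left.kalgebra_axioms)
  next
    fix h m assume *: "h \<in> carrier H" "m \<in> module_hom_set A X Y"
    then show "?act h m \<in> module_hom_set A X Y" by (intro hom_action_closed)
  next
    fix h g m assume *: "h \<in> carrier H" "g \<in> carrier H" "m \<in> module_hom_set A X Y"
    show "?act (h \<oplus>\<^bsub>H\<^esub> g) m = ?act h m \<oplus>\<^bsub>?M\<^esub> ?act g m"
      using * by (auto simp: module_hom_def simps map_act_add_left [OF X Y] intro!: restrict_ext)
    have "map_act X Y h (map_act X Y g m) x = map_act X Y h (\<lambda>x\<in>carrier X. map_act X Y g m x) x"
      if "x \<in> carrier X" for x
      by (rule map_act_cong) (use that in auto)
    then show "?act (h \<cdot> g) m = ?act h (?act g m)"
      unfolding hom_action_eq [OF hom_action_closed [OF *(3,2)] *(1)]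
      using * by (auto simp: simps map_act_mult [OF X Y] intro!: restrict_ext)
  next
    fix h f g assume *: "h \<in> carrier H" "f \<in> module_hom_set A X Y" "g \<in> module_hom_set A X Y"
    note D = *(2,3) [THEN module_homD(2)]
    have fg: "f \<oplus>\<^bsub>?M\<^esub> g \<in> module_hom_set A X Y"
      using * module_hom_module M module.axioms(2) abelian_group.axioms(1) abelian_monoid.a_closed by metis
    have "map_act X Y h (f \<oplus>\<^bsub>?M\<^esub> g) x = map_act X Y h f x \<oplus>\<^bsub>Y\<^esub> map_act X Y h g x" if "x \<in> carrier X" for x
    proof -
      have "map_act X Y h (f \<oplus>\<^bsub>?M\<^esub> g) x = map_act X Y h (\<lambda>x. f x \<oplus>\<^bsub>Y\<^esub> g x) x"
        using that by (intro map_act_cong) (simp_all add: module_hom_def)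
      also have "\<dots> = map_act X Y h f x \<oplus>\<^bsub>Y\<^esub> map_act X Y h g x"
        unfolding map_act_def using that *
        by (simp add: D hact_closed [OF X] hact_closed [OF Y] hact_add_right [OF Y] eqm_sum_add [OF Y] cong: sweedler_cong)
      finally show ?thesis .
    qed
    then show "?act h (f \<oplus>\<^bsub>?M\<^esub> g) = ?act h f \<oplus>\<^bsub>?M\<^esub> ?act h g"
      unfolding hom_action_eq [OF fg *(1)]
      using * by (auto simp: simps module_hom_def intro!: restrict_ext)
  next
    fix c h m assume *: "c \<in> carrier K" "h \<in> carrier H" "m \<in> module_hom_set A X Y"
    then show "?act (c \<odot>\<^bsub>H\<^esub> h) m = c \<odot>\<^bsub>?M\<^esub> ?act h m"
      by (auto simp: module_hom_def simps map_act_smult_left [OF X Y] intro!: restrict_ext)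
    note D = *(3) [THEN module_homD(2)]
    have cm: "c \<odot>\<^bsub>?M\<^esub> m \<in> module_hom_set A X Y"
      using * module_hom_module M module.smult_closed by metis
    have "map_act X Y h (c \<odot>\<^bsub>?M\<^esub> m) x = c \<odot>\<^bsub>Y\<^esub> map_act X Y h m x" if "x \<in> carrier X" for x
    proof -
      have "map_act X Y h (c \<odot>\<^bsub>?M\<^esub> m) x = map_act X Y h (\<lambda>x. c \<odot>\<^bsub>Y\<^esub> m x) x"
        using that by (intro map_act_cong) (simp_all add: module_hom_def)
      also have "\<dots> = SR Y (\<lambda>p q. c \<odot>\<^bsub>Y\<^esub> hact Y p (m (hact X (S q) x))) h"
        unfolding map_act_def using that *
        by (simp add: D hact_closed [OF X] hact_smult_right [OF Y] cong: sweedler_cong)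
      also have "\<dots> = c \<odot>\<^bsub>Y\<^esub> map_act X Y h m x"
        unfolding map_act_def using * that
        by (intro abelian_group.sweedler_sum_additive [OF eqm_abelian [OF Y] eqm_abelian [OF Y], symmetric])
          (auto simp: D hact_closed [OF X] hact_closed [OF Y] Y.smult_r_distr)
      finally show ?thesis .
    qed
    then show "?act h (c \<odot>\<^bsub>?M\<^esub> m) = c \<odot>\<^bsub>?M\<^esub> ?act h m"
      unfolding hom_action_eq [OF cm *(2)]
      using * by (auto simp: simps module_hom_def intro!: restrict_ext)
  next
    fix m assume m: "m \<in> module_hom_set A X Y"
    then show "?act \<one>\<^bsub>H\<^esub> m = m"
      by (intro module_hom_eqI hom_action_closed) (auto simp: simps map_act_one [OF X Y])
  qed
qed

end

section \<open>Identities and composites\<close>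

lemma module_hom_id: "eqm X \<Longrightarrow> (\<lambda>x\<in>carrier X. x) \<in> module_hom_set A X X"
  by (rule module_hom_restrictI) auto

text \<open>At the identity the summand is \<open>p \<cdot> S q\<close> acting on \<open>x\<close>,
  so the antipode law for \<open>\<Delta>R\<close> makes the value depend on \<open>h\<close> only
  through \<open>\<epsilon>L h\<close>. As \<open>\<epsilon>L\<close> is a left inverse of both
  \<open>sL\<close> and \<open>tL\<close>, all conditions on identities follow.\<close>

lemma hom_action_id:
  assumes X: "eqm X" and h: "h \<in> carrier H"
  shows "hom_action \<Delta>R S X X h (\<lambda>x\<in>carrier X. x) = (\<lambda>x\<in>carrier X. hact X (sL (\<epsilon>L h)) x)"
  unfolding hom_action_eq [OF X X module_hom_id [OF X] h]
proof (rule restrict_ext)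
  fix x assume x: "x \<in> carrier X"
  have "map_act X X h (\<lambda>x\<in>carrier X. x) x = SR X (\<lambda>p q. hact X (p \<cdot> S q) x) h"
    unfolding map_act_def using x by (simp add: hact_closed [OF X] hact_mult [OF X] cong: sweedler_cong)
  also have "\<dots> = hact X (sL (\<epsilon>L h)) x"
    using x h by (simp add: antipode_sum_right flip: hact_sum_left [OF X])
  finally show "map_act X X h (\<lambda>x\<in>carrier X. x) x = hact X (sL (\<epsilon>L h)) x" .
qed

lemma module_hom_compose:
  assumes X: "eqm X" and Y: "eqm Y" and Z: "eqm Z"
    and f: "f \<in> module_hom_set A Y Z" and g: "g \<in> module_hom_set A X Y"
  shows "compose (carrier X) f g \<in> module_hom_set A X Z"
  unfolding compose_def
  by (rule module_hom_restrictI [OF X Z]) (simp_all add: module_homD [OF Y Z f] module_homD [OF X Y g])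

lemma hom_action_compose:
  assumes X: "eqm X" and Y: "eqm Y" and Z: "eqm Z" and h: "h \<in> carrier H"
    and f: "f \<in> module_hom_set A Y Z" and g: "g \<in> module_hom_set A X Y"
  shows "tensor_evals_to (add_monoid (module_hom A X Z))
      (\<lambda>(p, q). compose (carrier X) (hom_action \<Delta>R S Y Z p f) (hom_action \<Delta>R S X Y q g)) (\<Delta>L h)
      (hom_action \<Delta>R S X Z h (compose (carrier X) f g))"
proof -
  let ?M = "module_hom A X Z"
  let ?\<phi> = "\<lambda>p q. compose (carrier X) (hom_action \<Delta>R S Y Z p f) (hom_action \<Delta>R S X Y q g)"
  have M: "carrier ?M = module_hom_set A X Z" by (simp add: module_hom_def)
  have ag: "abelian_group ?M" using module_hom_module [OF X Z] by (rule module.axioms)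
  note f' = module_hom_base_linear [OF Y Z f] and g' = module_hom_base_linear [OF X Y g]
  note clos = map_act_closed [OF X Y g'] map_act_closed [OF Y Z f']
  have \<phi>: "?\<phi> p q = (\<lambda>x\<in>carrier X. map_act Y Z p f (map_act X Y q g x))"
    if "p \<in> carrier H" "q \<in> carrier H" for p q
    unfolding compose_def using that
    by (auto simp: hom_action_eq [OF Y Z f] hom_action_eq [OF X Y g] clos intro!: restrict_ext)
  have \<phi>_closed: "?\<phi> p q \<in> carrier ?M" if "p \<in> carrier H" "q \<in> carrier H" for p q
    unfolding M by (rule module_hom_compose [OF X Y Z hom_action_closed [OF Y Z f] hom_action_closed [OF X Y g]])
      (fact that)+
  \<comment> \<open>The claim concerns all representatives of \<open>\<Delta>L h\<close>, so balance
    is needed besides the value at the chosen one.\<close>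
  have bal: "left.bal (add_monoid ?M) ?\<phi>"
    unfolding left_bal_iff
  proof (intro conjI ballI)
    fix p q assume "p \<in> carrier H" "q \<in> carrier H"
    then show "?\<phi> p q \<in> carrier (add_monoid ?M)" using \<phi>_closed by simp
  next
    fix p p' q assume "p \<in> carrier H" "p' \<in> carrier H" "q \<in> carrier H"
    then show "?\<phi> (p \<oplus>\<^bsub>H\<^esub> p') q = ?\<phi> p q \<otimes>\<^bsub>add_monoid ?M\<^esub> ?\<phi> p' q"
      by (auto simp: \<phi> module_hom_def clos map_act_add_left [OF Y Z f'] intro!: restrict_ext)
  next
    fix p q q' assume "p \<in> carrier H" "q \<in> carrier H" "q' \<in> carrier H"
    then show "?\<phi> p (q \<oplus>\<^bsub>H\<^esub> q') = ?\<phi> p q \<otimes>\<^bsub>add_monoid ?M\<^esub> ?\<phi> p q'"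
      by (auto simp: \<phi> module_hom_def clos map_act_add_left [OF X Y g'] map_act_add_arg [OF Y Z f'] intro!: restrict_ext)
  next
    fix p l q assume "p \<in> carrier H" "l \<in> carrier L" "q \<in> carrier H"
    then show "?\<phi> (tL l \<cdot> p) q = ?\<phi> p (sL l \<cdot> q)"
      by (auto simp: \<phi> clos map_act_tL [OF Y Z f'] map_act_sL [OF X Y g'] intro!: restrict_ext)
  qed
  have "SL ?M ?\<phi> h = hom_action \<Delta>R S X Z h (compose (carrier X) f g)"
  proof (rule module_hom_eqI [OF X Z])
    show "SL ?M ?\<phi> h \<in> module_hom_set A X Z"
      using abelian_group.sweedler_sum_closed [OF ag, of _ _ ?\<phi>] \<phi>_closed unfolding M by blast
    have fg: "compose (carrier X) f g \<in> module_hom_set A X Z" by (rule module_hom_compose [OF X Y Z f g])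
    show "hom_action \<Delta>R S X Z h (compose (carrier X) f g) \<in> module_hom_set A X Z"
      by (rule hom_action_closed [OF X Z fg h])
    fix x assume x: "x \<in> carrier X"
    \<comment> \<open>Evaluation at \<open>x\<close> is additive on morphisms, so a Sweedler sum of
      morphisms is computed pointwise.\<close>
    have "(SL ?M ?\<phi> h) x = SL Z (\<lambda>p q. (?\<phi> p q) x) h"
      by (rule abelian_group.sweedler_sum_additive [OF ag eqm_abelian [OF Z], where f = "\<lambda>m. m x"])
        (use x in \<open>auto simp: M module_homD [OF X Z] \<phi>_closed [unfolded M] module_hom_def\<close>)
    also have "\<dots> = SL Z (\<lambda>p q. map_act Y Z p f (map_act X Y q g x)) h"
      using x by (simp add: \<phi> cong: sweedler_cong)
    also have "\<dots> = map_act X Z h (\<lambda>x. f (g x)) x"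
      by (rule map_act_compose [OF X Y Z f' g' h x])
    also have "\<dots> = map_act X Z h (compose (carrier X) f g) x"
      by (rule map_act_cong [OF X Z]) (simp_all add: compose_def x)
    also have "\<dots> = hom_action \<Delta>R S X Z h (compose (carrier X) f g) x"
      using x by (simp add: hom_action_eq [OF X Z fg h])
    finally show "(SL ?M ?\<phi> h) x = hom_action \<Delta>R S X Z h (compose (carrier X) f g) x" .
  qed
  then show ?thesis
    using left.T.tensor_evals_to_sweedler [OF abelian_group.a_comm_group [OF ag] bal left.comult_closed [OF h]]
    by simp
qed

lemma fg_equivariant_modules_linear_category:
  "linear_category K (fg_equivariant_modules K H \<Delta>L A act :: ('k, ('k, 'm, 'h, 'a) eqmod, 'm \<Rightarrow> 'm) lincat)"
    (is "linear_category K ?C")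
proof -
  have O: "X \<in> Obj ?C \<Longrightarrow> eqm X" for X
    by (simp add: fg_equivariant_modules_def)
  have M: "carrier (Mor ?C X Y) = module_hom_set A X Y" for X Y
    by (simp add: fg_equivariant_modules_def module_hom_def)
  have C: "Comp ?C X Y Z f g = compose (carrier X) f g" for X Y Z f g
    by (simp add: fg_equivariant_modules_def)
  have I: "Ident ?C X = (\<lambda>x\<in>carrier X. x)" for X
    by (simp add: fg_equivariant_modules_def)
  have Mor: "Mor ?C X Y = module_hom A X Y" for X Y
    by (simp add: fg_equivariant_modules_def)
  show ?thesis
  proof (intro linear_category.intro, unfold M C I)
    fix X Y assume "X \<in> Obj ?C" "Y \<in> Obj ?C"
    then show "Module.module K (Mor ?C X Y)"
      unfolding Mor by (intro module_hom_module O)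
  next
    fix X assume "X \<in> Obj ?C"
    then show "(\<lambda>x\<in>carrier X. x) \<in> module_hom_set A X X"
      by (intro module_hom_id O)
  next
    fix X Y Z f g
    assume "X \<in> Obj ?C" "Y \<in> Obj ?C" "Z \<in> Obj ?C" "f \<in> module_hom_set A Y Z" "g \<in> module_hom_set A X Y"
    then show "compose (carrier X) f g \<in> module_hom_set A X Z"
      by (intro module_hom_compose O)
  next
    fix W X Y Z f g h
    assume "W \<in> Obj ?C" "X \<in> Obj ?C" and h: "h \<in> module_hom_set A W X"
    then have "h x \<in> carrier X" if "x \<in> carrier W" for x
      using module_homD(2) [OF O O h that] by blast
    then show "compose (carrier W) (compose (carrier X) f g) h = compose (carrier W) f (compose (carrier W) g h)"
      by (auto simp: compose_def intro!: restrict_ext)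
  next
    fix X Y f assume *: "X \<in> Obj ?C" "Y \<in> Obj ?C" "f \<in> module_hom_set A X Y"
    note D = module_homD [OF O O, OF *]
    show "compose (carrier X) (\<lambda>x\<in>carrier Y. x) f = f"
      by (rule extensionalityI [OF compose_extensional D(1)]) (simp add: compose_def D)
    show "compose (carrier X) f (\<lambda>x\<in>carrier X. x) = f"
      by (rule extensionalityI [OF compose_extensional D(1)]) (simp add: compose_def)
  next
    fix X Y Z f f' g
    assume "X \<in> Obj ?C" "Y \<in> Obj ?C" and g: "g \<in> module_hom_set A X Y"
    then have "g x \<in> carrier Y" if "x \<in> carrier X" for x
      using module_homD(2) [OF O O g that] by blast
    then show "compose (carrier X) (f \<oplus>\<^bsub>Mor ?C Y Z\<^esub> f') g
        = compose (carrier X) f g \<oplus>\<^bsub>Mor ?C X Z\<^esub> compose (carrier X) f' g"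
      unfolding Mor by (auto simp: compose_def module_hom_def intro!: restrict_ext)
  next
    fix X Y Z f g g'
    assume *: "X \<in> Obj ?C" "Y \<in> Obj ?C" "Z \<in> Obj ?C"
      and f: "f \<in> module_hom_set A Y Z" and g: "g \<in> module_hom_set A X Y" "g' \<in> module_hom_set A X Y"
    have "g x \<in> carrier Y" "g' x \<in> carrier Y" if "x \<in> carrier X" for x
      using module_homD(2) [OF O O g(1) that] module_homD(2) [OF O O g(2) that] * by blast+
    then show "compose (carrier X) f (g \<oplus>\<^bsub>Mor ?C X Y\<^esub> g')
        = compose (carrier X) f g \<oplus>\<^bsub>Mor ?C X Z\<^esub> compose (carrier X) f g'"
      unfolding Mor using module_homD(3) [OF O O f] *
      by (auto simp: compose_def module_hom_def intro!: restrict_ext)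
  next
    fix X Y Z c f g
    assume *: "X \<in> Obj ?C" "Y \<in> Obj ?C" "Z \<in> Obj ?C" "c \<in> carrier K"
      and f: "f \<in> module_hom_set A Y Z" and g: "g \<in> module_hom_set A X Y"
    have gx: "g x \<in> carrier Y" if "x \<in> carrier X" for x
      using module_homD(2) [OF O O g that] * by blast
    then show "compose (carrier X) (c \<odot>\<^bsub>Mor ?C Y Z\<^esub> f) g = c \<odot>\<^bsub>Mor ?C X Z\<^esub> compose (carrier X) f g"
      unfolding Mor by (auto simp: compose_def module_hom_def intro!: restrict_ext)
    show "compose (carrier X) f (c \<odot>\<^bsub>Mor ?C X Y\<^esub> g) = c \<odot>\<^bsub>Mor ?C X Z\<^esub> compose (carrier X) f g"
      unfolding Mor using module_hom_smult [OF O O f] * gx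
      by (auto simp: compose_def module_hom_def intro!: restrict_ext)
  qed
qed

theorem fg_equivariant_modules_H_category:
  "H_category K H L sL tL \<Delta>L \<epsilon>L
     (fg_equivariant_modules K H \<Delta>L A act :: ('k, ('k, 'm, 'h, 'a) eqmod, 'm \<Rightarrow> 'm) lincat) (hom_action \<Delta>R S)"
    (is "H_category K H L sL tL \<Delta>L \<epsilon>L ?C _")
proof -
  have O: "X \<in> Obj ?C \<Longrightarrow> eqm X" for X
    by (simp add: fg_equivariant_modules_def)
  have C: "Comp ?C X Y Z f g = compose (carrier X) f g" for X Y Z f g
    by (simp add: fg_equivariant_modules_def)
  have I: "Ident ?C X = (\<lambda>x\<in>carrier X. x)" for X
    by (simp add: fg_equivariant_modules_def)
  have Mor: "Mor ?C X Y = module_hom A X Y" for X Y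
    by (simp add: fg_equivariant_modules_def)
  show ?thesis
  proof (intro H_category.intro H_category_axioms.intro fg_equivariant_modules_linear_category, unfold C I Mor)
    fix X Y assume "X \<in> Obj ?C" "Y \<in> Obj ?C"
    then show mod: "left_module K H (module_hom A X Y) (hom_action \<Delta>R S X Y)"
      by (intro hom_action_left_module O)
    then show "bimodule L (module_hom A X Y) (\<lambda>l. hom_action \<Delta>R S X Y (sL l)) (\<lambda>f l. hom_action \<Delta>R S X Y (tL l) f)"
      by (rule left_module_bimodule)
  next
    fix X l assume "X \<in> Obj ?C" "l \<in> carrier L"
    then show "hom_action \<Delta>R S X X (sL l) (\<lambda>x\<in>carrier X. x) = hom_action \<Delta>R S X X (tL l) (\<lambda>x\<in>carrier X. x)"
      by (simp add: hom_action_id O \<epsilon>L_sL \<epsilon>L_tL)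
  next
    fix X h assume "X \<in> Obj ?C" "h \<in> carrier H"
    then show "hom_action \<Delta>R S X X h (\<lambda>x\<in>carrier X. x) = hom_action \<Delta>R S X X (sL (\<epsilon>L h)) (\<lambda>x\<in>carrier X. x)"
      and "hom_action \<Delta>R S X X h (\<lambda>x\<in>carrier X. x) = hom_action \<Delta>R S X X (tL (\<epsilon>L h)) (\<lambda>x\<in>carrier X. x)"
      by (simp_all add: hom_action_id O \<epsilon>L_sL \<epsilon>L_tL)
  next
    fix X Y Z h f g
    assume "X \<in> Obj ?C" "Y \<in> Obj ?C" "Z \<in> Obj ?C" "h \<in> carrier H"
      "f \<in> carrier (module_hom A Y Z)" "g \<in> carrier (module_hom A X Y)"
    then show "tensor_evals_to (add_monoid (module_hom A X Z))
        (\<lambda>(h\<^sub>1, h\<^sub>2). compose (carrier X) (hom_action \<Delta>R S Y Z h\<^sub>1 f) (hom_action \<Delta>R S X Y h\<^sub>2 g)) (\<Delta>L h)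
        (hom_action \<Delta>R S X Z h (compose (carrier X) f g))"
      by (intro hom_action_compose O) (simp_all add: module_hom_def)
  qed
qed

end

text \<open>Since \<open>hom_action\<close> is defined by a definite description, the second
  conjunct certifies that its values are the intended Sweedler sums for every representative of
  \<open>\<Delta>R h\<close>.\<close>

theorem lemma3p6:
  fixes K :: "('k, 'x) ring_scheme" and H :: "('k, 'h) module"
    and L :: "('k, 'l) module" and sL tL :: "'l \<Rightarrow> 'h"
    and \<Delta>L :: "'h \<Rightarrow> ('h \<times> 'h \<Rightarrow>\<^sub>0 int) set" and \<epsilon>L :: "'h \<Rightarrow> 'l"
    and R :: "('k, 'r) module" and sR tR :: "'r \<Rightarrow> 'h"
    and \<Delta>R :: "'h \<Rightarrow> ('h \<times> 'h \<Rightarrow>\<^sub>0 int) set" and \<epsilon>R :: "'h \<Rightarrow> 'r"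
    and S :: "'h \<Rightarrow> 'h"
    and A :: "('k, 'a) module" and act :: "'h \<Rightarrow> 'a \<Rightarrow> 'a"
    and \<C> :: "('k, ('k, 'm, 'h, 'a) eqmod, 'm \<Rightarrow> 'm) lincat"
  assumes "cring K"
    and "hopf_algebroid K H L sL tL \<Delta>L \<epsilon>L R sR tR \<Delta>R \<epsilon>R S"
    and "bij_betw S (carrier H) (carrier H)"
    and "module_algebra K H sL tL \<Delta>L \<epsilon>L A act"
    and "\<C> = fg_equivariant_modules K H \<Delta>L A act"
  shows "H_category K H L sL tL \<Delta>L \<epsilon>L \<C> (hom_action \<Delta>R S)
     \<and> (\<forall>X\<in>Obj \<C>. \<forall>Y\<in>Obj \<C>. \<forall>h\<in>carrier H. \<forall>f\<in>carrier (Mor \<C> X Y). \<forall>x\<in>carrier X.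
          tensor_evals_to (add_monoid Y) (hom_action_summand S X Y f x) (\<Delta>R h)
            (hom_action \<Delta>R S X Y h f x))"
proof -
  interpret hopf_module_algebra K H L sL tL \<Delta>L \<epsilon>L R sR tR \<Delta>R \<epsilon>R S A act
    by (rule hopf_module_algebra.intro [OF assms(2,4)])
  have "tensor_evals_to (add_monoid Y) (hom_action_summand S X Y f x) (\<Delta>R h) (hom_action \<Delta>R S X Y h f x)"
    if "X \<in> Obj \<C>" "Y \<in> Obj \<C>" "h \<in> carrier H" "f \<in> carrier (Mor \<C> X Y)" "x \<in> carrier X" for X Y h f x
  proof -
    have *: "eqm X" "eqm Y" "f \<in> module_hom_set A X Y"
      using that assms(5) by (simp_all add: fg_equivariant_modules_def module_hom_def)
    show ?thesis
      using hom_action_evals_to(1) [OF * that(3,5)] that by (simp add: hom_action_eq [OF *])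
  qed
  then show ?thesis
    using fg_equivariant_modules_H_category assms(5) by blast
qed

end
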